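(* Let $Y_i\sim\mathrm{Bernoulli}(\theta_i^* )$, $i=1,\dots,n$, be independent, $Y=(Y_i)\in\mathbb{R}^n$, let $\Psi:\mathbb{R}^n\to\mathbb{R}^p$ be linear with columns $\Psi_i\in\mathbb{R}^p$, and let $\xi=\Psi(Y-\mathbb{E}Y)$. Let $V^2$ be a symmetric positive definite operator on $\mathbb{R}^p$ with $V^2\ge2\operatorname{Var}(\xi)$. Define $$w^*=\max_{i\le n}\|V^{-1}\Psi_i\|,\qquad\mathtt g=\log(2)/w^* .$$ Let $Q:\mathbb{R}^p\to\mathbb{R}^q$ be linear and $B=QV^2Q^\top$. Then with the function $z_c(B,x)$ defined in the context (for this $B$ and this $\mathtt g$), for all $x>0$ $$\mathbb{P}\bigl(\|Q\xi\|\ge z_c(B,x)\bigr)\le3e^{-x}.$$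
   Context: Norms: $\|\cdot\|$ is the Euclidean norm of vectors and the operator norm of matrices. $\Psi\ne0$, $B\neq0$. Notation: $\mathtt p=\operatorname{tr}(B)$, $\mathtt v^2=\operatorname{tr}(B^2)$, $\lambda=\|B\|$, $z^2(B,x)=\mathtt p+2\mathtt v\sqrt{x}+2x\lambda$. For $x>0$ define $\mu(x)\in(0,1)$ by $\mu(x)^{-1}=1+\frac{\mathtt v}{2\lambda\sqrt{x}}$. Critical value: $x_c>0$ is the unique root of $$z^2(B,x_c)=\frac12\Bigl(\frac{\mathtt g\sqrt{\lambda}}{\mu_c}-\sqrt{\frac{\mathtt p}{\mu_c}}\Bigr)^2,\qquad \mu_c=\mu(x_c),$$ for which the expression inside the parentheses is positive. Quantile function: with $\varkappa=\frac{\mathtt g}{(\sqrt8+1)\sqrt\lambda}$, $z_c(B,x)=z(B,x)$ for $x\le x_c$ and $z_c(B,x)=z(B,x_c)+\varkappa^{-1}(x-x_c)$ for $x>x_c$. *)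

theory Defs
  imports "HOL-Probability.Probability"
begin

definition sym_posdef :: "real^'m^'m \<Rightarrow> bool" where
  "sym_posdef A \<longleftrightarrow> transpose A = A \<and> (\<forall>u. u \<noteq> 0 \<longrightarrow> u \<bullet> (A *v u) > 0)"

definition sym_possemidef :: "real^'m^'m \<Rightarrow> bool" where
  "sym_possemidef A \<longleftrightarrow> transpose A = A \<and> (\<forall>u. u \<bullet> (A *v u) \<ge> 0)"

definition loewner_le :: "real^'m^'m \<Rightarrow> real^'m^'m \<Rightarrow> bool" where
  "loewner_le A C \<longleftrightarrow> sym_possemidef (C - A)"

text \<open>For \<open>A\<close> symmetric positive definite, the operator called \<open>V\<close> when \<open>A\<close> is called \<open>V\<^sup>2\<close>.
  The description is well defined only for such \<open>A\<close>.\<close>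

definition posdef_sqrt :: "real^'m^'m \<Rightarrow> real^'m^'m" where
  "posdef_sqrt A = (THE V. sym_posdef V \<and> V ** V = A)"

definition covariance_matrix :: "'a measure \<Rightarrow> ('a \<Rightarrow> real^'m) \<Rightarrow> real^'m^'m" where
  "covariance_matrix M X = (\<chi> i j. \<integral>\<omega>. (X \<omega> $ i - (\<integral>\<omega>'. X \<omega>' $ i \<partial>M)) *
                                       (X \<omega> $ j - (\<integral>\<omega>'. X \<omega>' $ j \<partial>M)) \<partial>M)"

definition op_norm :: "real^'m^'m \<Rightarrow> real" where
  "op_norm B = onorm (\<lambda>u. B *v u)"

definition v_of :: "real^'m^'m \<Rightarrow> real" where
  "v_of B = sqrt (trace (B ** B))"

definition z_sq :: "real^'m^'m \<Rightarrow> real \<Rightarrow> real" where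
  "z_sq B x = trace B + 2 * v_of B * sqrt x + 2 * x * op_norm B"

definition z_of :: "real^'m^'m \<Rightarrow> real \<Rightarrow> real" where
  "z_of B x = sqrt (z_sq B x)"

definition mu_of :: "real^'m^'m \<Rightarrow> real \<Rightarrow> real" where
  "mu_of B x = inverse (1 + v_of B / (2 * op_norm B * sqrt x))"

definition crit_term :: "real^'m^'m \<Rightarrow> real \<Rightarrow> real \<Rightarrow> real" where
  "crit_term B g x = g * sqrt (op_norm B) / mu_of B x - sqrt (trace B / mu_of B x)"

text \<open>For \<open>g > 0\<close> and \<open>B \<noteq> 0\<close> symmetric positive semidefinite there is exactly one such root:
  \<^term>\<open>z_sq B\<close> is strictly increasing and unbounded, while \<^term>\<open>crit_term B g\<close> is positive on an
  initial interval of the positive axis, decreases there, and tends to infinity at \<open>0\<close>.\<close>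

definition x_crit :: "real^'m^'m \<Rightarrow> real \<Rightarrow> real" where
  "x_crit B g = (THE x. x > 0 \<and> crit_term B g x > 0 \<and> z_sq B x = 1 / 2 * (crit_term B g x)\<^sup>2)"

definition kappa_of :: "real^'m^'m \<Rightarrow> real \<Rightarrow> real" where
  "kappa_of B g = g / ((sqrt 8 + 1) * sqrt (op_norm B))"

definition z_crit :: "real^'m^'m \<Rightarrow> real \<Rightarrow> real \<Rightarrow> real" where
  "z_crit B g x =
     (if x \<le> x_crit B g then z_of B x
      else z_of B (x_crit B g) + inverse (kappa_of B g) * (x - x_crit B g))"

end

theory Submission
  imports Defs
begin

text \<open>
  After normalising to \<open>\<lambda> = 1\<close>, put \<open>S = Q \<xi>\<close> and fix a level \<open>t \<le> x\<^sub>c\<close>, with \<open>\<mu> = \<mu>(t)\<close>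
  and \<open>z = z(B, t)\<close>. It suffices to bound the tail of \<open>|S|\<close> along the line of slope \<open>1/\<kappa>\<close>
  through \<open>(t, z)\<close>: the choice \<open>t = x\<close> covers \<open>x \<le> x\<^sub>c\<close> and \<open>t = x\<^sub>c\<close> covers the linear part, while
  \<open>x < ln 3\<close> is trivial.

  When \<open>\<surd>\<mu> z\<close> is large compared with \<open>\<surd>p\<close>, one averages \<open>exp \<langle>u, S\<rangle>\<close> over a Gaussian \<open>u\<close>
  truncated to an ellipsoid on which the exponential moment condition holds; without the truncation the
  average would be \<open>exp (\<mu>|S|\<^sup>2/2)\<close>, and the truncated average still grows exponentially beyond
  its critical radius.

  Exponential moments in the ellipsoid alone do not imply the bound when \<open>\<mu>\<close> is small. There the
  argument uses that \<open>S\<close> is a sum of independent bounded vectors: the identity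
  \<open>E \<langle>S, F(S)\<rangle> = \<Sum> \<theta>(1-\<theta>) E \<langle>\<psi>, F(S\<^sup>1) - F(S\<^sup>0)\<rangle>\<close>, where \<open>S\<^sup>1\<close> and \<open>S\<^sup>0\<close> differ by flipping one
  coordinate, is applied to \<open>F(s) = s exp (\<kappa>(|s| - r)\<^sub>+)\<close>. The factor \<open>2\<close> in \<open>V\<^sup>2 \<ge> 2 Var(\<xi>)\<close> makes
  \<open>|S|\<^sup>2\<close> dominate the right-hand side outside the ball of radius \<open>r\<close>, which bounds
  \<open>E exp (\<kappa>(|S| - r)\<^sub>+)\<close> there by an absolute constant.
\<close>

subsection \<open>Stein's identity for sums of independent Bernoulli vectors\<close>

text \<open>With lambda = 1 let \<open>gt = sqrt 2 * \<mu> * z + sqrt (\<mu> * p)\<close> at the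
  level \<open>t\<close>. After a square root the critical equation says \<open>gt = g\<close> at
  \<open>t = x_crit B g\<close>, and \<open>t \<le> x_crit B g\<close> enters the tail estimate only
  through \<open>gt \<le> g\<close>: this makes \<open>gt^2\<close> an admissible level for the
  ellipsoid and bounds the jumps of the sum by \<open>ln 2 / gt\<close>. The prefactor 3 is fixed,
  and each argument spends it in its own way: the Gaussian one as the inverse of a truncated mass of
  at least 1/3, the Stein one as \<open>C = exp x0 / 3\<close>, where the line is followed back to a
  level \<open>x0\<close> equal to 0 or \<open>ln 3\<close>. The \<open>ln 2\<close> in
  \<open>g\<close> is used twice: as \<open>ln 2 \<le> 1\<close> in the exponential moments, and as
  \<open>2^(1/(sqrt 8 + 1)) \<le> 6/5\<close> for the change of the exponential weight in one jump.
  The trace is at least lambda, so \<open>\<tau> = a/b\<close> can be small only if \<open>b\<close>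
  is large; this leaves the small values of \<open>\<tau>\<close> to the Gaussian argument.\<close>

definition bern_weight :: "('n::finite \<Rightarrow> real) \<Rightarrow> ('n \<Rightarrow> bool) \<Rightarrow> real" where
  "bern_weight \<theta> b = (\<Prod>i\<in>UNIV. if b i then \<theta> i else 1 - \<theta> i)"

text \<open>The product Bernoulli law is kept as a finite sum over outcomes, so integrability never
  has to be discussed; \<open>bern_integral\<close> connects it with the given probability
  space.\<close>

definition bern_expect :: "('n::finite \<Rightarrow> real) \<Rightarrow> (('n \<Rightarrow> bool) \<Rightarrow> 'v::real_vector) \<Rightarrow> 'v" where
  "bern_expect \<theta> F = (\<Sum>b\<in>UNIV. bern_weight \<theta> b *\<^sub>R F b)"

lemma bern_weight_nonneg: "(\<And>i. 0 \<le> \<theta> i \<and> \<theta> i \<le> 1) \<Longrightarrow> 0 \<le> bern_weight \<theta> b"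
  unfolding bern_weight_def by (rule prod_nonneg) auto

lemma bern_expect_mono:
  fixes F G :: "('n::finite \<Rightarrow> bool) \<Rightarrow> real"
  assumes "\<And>i. 0 \<le> \<theta> i \<and> \<theta> i \<le> 1" "\<And>b. F b \<le> G b"
  shows "bern_expect \<theta> F \<le> bern_expect \<theta> G"
  unfolding bern_expect_def
  by (intro sum_mono scaleR_left_mono assms bern_weight_nonneg)

lemma bern_expect_diff: "bern_expect \<theta> (\<lambda>b. F b - G b) = bern_expect \<theta> F - bern_expect \<theta> G"
  unfolding bern_expect_def by (simp add: scaleR_diff_right sum_subtractf)

lemma bern_expect_cmult:
  fixes F :: "('n::finite \<Rightarrow> bool) \<Rightarrow> real"
  shows "bern_expect \<theta> (\<lambda>b. c * F b) = c * bern_expect \<theta> F"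
  unfolding bern_expect_def by (simp add: sum_distrib_left mult_ac)

lemma bern_expect_sum: "bern_expect \<theta> (\<lambda>b. \<Sum>i\<in>A. F i b) = (\<Sum>i\<in>A. bern_expect \<theta> (F i))"
  unfolding bern_expect_def by (simp add: scaleR_sum_right) (rule sum.swap)

lemma bern_expect_prod:
  fixes f :: "'n::finite \<Rightarrow> bool \<Rightarrow> real"
  shows "bern_expect \<theta> (\<lambda>b. \<Prod>i\<in>UNIV. f i (b i)) =
    (\<Prod>i\<in>UNIV. \<theta> i * f i True + (1 - \<theta> i) * f i False)"
proof -
  have "bern_expect \<theta> (\<lambda>b. \<Prod>i\<in>UNIV. f i (b i)) =
     (\<Sum>b\<in>UNIV. \<Prod>i\<in>UNIV. (if b i then \<theta> i else 1 - \<theta> i) * f i (b i))"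
    unfolding bern_expect_def bern_weight_def by (simp add: prod.distrib)
  also have "\<dots> = (\<Sum>b\<in>(UNIV \<rightarrow>\<^sub>E UNIV). \<Prod>i\<in>UNIV. (if b i then \<theta> i else 1 - \<theta> i) * f i (b i))"
    by (simp add: PiE_UNIV_domain)
  also have "\<dots> = (\<Prod>i\<in>UNIV. \<Sum>c\<in>UNIV. (if c then \<theta> i else 1 - \<theta> i) * f i c)"
    by (rule prod_sum_PiE[symmetric]) auto
  also have "\<dots> = (\<Prod>i\<in>UNIV. \<theta> i * f i True + (1 - \<theta> i) * f i False)"
    by (simp add: UNIV_bool add.commute)
  finally show ?thesis .
qed

lemma bern_expect_const: "bern_expect \<theta> (\<lambda>b. c) = c"
proof -
  have "bern_expect \<theta> (\<lambda>b. \<Prod>i\<in>UNIV. (\<lambda>i x. 1) i (b i)) = (1::real)"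
    by (subst bern_expect_prod) simp
  then have "(\<Sum>b\<in>UNIV. bern_weight \<theta> b) = 1"
    by (simp add: bern_expect_def)
  then show ?thesis
    by (simp add: bern_expect_def flip: scaleR_left.sum)
qed

text \<open>Drawing coordinate \<open>i\<close> afresh, given all others, preserves the product
  law.\<close>

lemma bern_expect_resample:
  fixes F :: "('n::finite \<Rightarrow> bool) \<Rightarrow> real"
  shows "bern_expect \<theta> F =
    bern_expect \<theta> (\<lambda>b. \<theta> i * F (b(i := True)) + (1 - \<theta> i) * F (b(i := False)))"
proof -
  define w where "w c = (if c then \<theta> i else 1 - \<theta> i)" for c
  define R where "R b = (\<Prod>j\<in>UNIV-{i}. if b j then \<theta> j else 1 - \<theta> j)" for b
  define flip where "flip b = b(i := \<not> b i)" for b :: "'n \<Rightarrow> bool"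
  have W: "bern_weight \<theta> b = w (b i) * R b" for b
    unfolding bern_weight_def w_def R_def by (subst prod.remove[of _ i]) auto
  have Rflip: "R (flip b) = R b" for b
    unfolding R_def flip_def by (rule prod.cong) auto
  have "flip (flip b) = b" for b by (auto simp: flip_def)
  then have "bij flip" by (rule involuntory_imp_bij)
  \<comment> \<open>Symmetrised under \<open>flip\<close>, the sum depends on \<open>G\<close> only
    through its average over coordinate \<open>i\<close>. Replacing \<open>G\<close> by that average
    therefore changes nothing.\<close>
  then have half: "bern_expect \<theta> G = (\<Sum>b\<in>UNIV. R b * (\<theta> i * G (b(i:=True)) + (1 - \<theta> i) * G (b(i:=False)))) / 2"
    for G :: "('n \<Rightarrow> bool) \<Rightarrow> real"
  proof -
    assume "bij flip"
    have "bern_expect \<theta> G = (\<Sum>b\<in>UNIV. w (b i) * R b * G b)"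
      by (simp add: bern_expect_def W)
    moreover have "\<dots> = (\<Sum>b\<in>UNIV. w (flip b i) * R (flip b) * G (flip b))"
      using sum.reindex_bij_betw[OF \<open>bij flip\<close>, of "\<lambda>b. w (b i) * R b * G b"] by simp
    ultimately have "2 * bern_expect \<theta> G
        = (\<Sum>b\<in>UNIV. w (b i) * R b * G b + w (flip b i) * R (flip b) * G (flip b))"
      by (simp add: sum.distrib)
    also have "\<dots> = (\<Sum>b\<in>UNIV. R b * (\<theta> i * G (b(i:=True)) + (1 - \<theta> i) * G (b(i:=False))))"
    proof (rule sum.cong[OF refl])
      fix b
      show "w (b i) * R b * G b + w (flip b i) * R (flip b) * G (flip b) =
        R b * (\<theta> i * G (b(i:=True)) + (1 - \<theta> i) * G (b(i:=False)))"
        by (cases "b i") (simp_all add: Rflip, auto simp: w_def flip_def fun_upd_idem algebra_simps)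
    qed
    finally show ?thesis by simp
  qed
  show ?thesis
    by (subst half, subst half) (simp add: algebra_simps)
qed

text \<open>Discrete integration by parts: after resampling, the centred factor takes the values
  \<open>1 - \<theta> i\<close> and \<open>- \<theta> i\<close>, so both terms carry the weight
  \<open>\<theta> i * (1 - \<theta> i)\<close>.\<close>

lemma bern_expect_centered_mult:
  fixes F :: "('n::finite \<Rightarrow> bool) \<Rightarrow> real"
  shows "bern_expect \<theta> (\<lambda>b. (of_bool (b i) - \<theta> i) * F b) =
    \<theta> i * (1 - \<theta> i) * bern_expect \<theta> (\<lambda>b. F (b(i := True)) - F (b(i := False)))"
  by (subst bern_expect_resample[of _ _ i])
     (simp add: bern_expect_cmult[symmetric] algebra_simps)

text \<open>With \<open>Y\<close> the component of \<open>u\<close> along \<open>s\<close>, the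
  squared norm of \<open>s + u\<close> is \<open>(m + Y)^2\<close> plus the squared transversal
  part, and \<open>D\<close> is the first-order effect of that part on the norm. As \<open>Y\<close>
  is nonnegative, completing the square gives an upper bound.\<close>

lemma norm_add_upper:
  fixes s u :: "'v::real_inner"
  assumes "s \<noteq> 0" "0 \<le> s \<bullet> u"
  shows "norm s * (norm (s + u) - norm s) \<le> s \<bullet> u + ((norm u)\<^sup>2 - (s \<bullet> u / norm s)\<^sup>2) / 2"
proof -
  define m Y P where "m = norm s" and "Y = s \<bullet> u / norm s" and "P = norm u"
  have m: "m > 0" using assms by (simp add: m_def)
  have Ym: "m * Y = s \<bullet> u" using m by (simp add: Y_def m_def)
  have Y0: "0 \<le> Y" using assms by (simp add: Y_def)
  have "\<bar>s \<bullet> u\<bar> \<le> norm s * norm u" by (rule Cauchy_Schwarz_ineq2)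
  then have YP: "Y \<le> P" using m assms(2) by (simp add: Y_def P_def m_def field_simps)
  define D where "D = (P\<^sup>2 - Y\<^sup>2) / 2 / m"
  have D0: "D \<ge> 0" using m YP Y0 by (simp add: D_def power_mono)
  have "(norm (s + u))\<^sup>2 = m\<^sup>2 + 2 * (m * Y) + P\<^sup>2"
    unfolding Ym by (simp add: m_def P_def power2_norm_eq_inner inner_add_left inner_add_right inner_commute)
  also have "\<dots> = (m + Y)\<^sup>2 + 2 * m * D" using m by (simp add: D_def field_simps power2_eq_square)
  also have "\<dots> \<le> (m + Y + D)\<^sup>2" using D0 Y0 by (simp add: power2_eq_square algebra_simps)
  finally have "norm (s + u) \<le> m + Y + D"
    by (rule power2_le_imp_le) (use m Y0 D0 in simp)
  then have "m * (norm (s + u) - m) \<le> m * (Y + D)" using m by (intro mult_left_mono) auto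
  also have "m * (Y + D) = s \<bullet> u + (P\<^sup>2 - Y\<^sup>2) / 2" using m by (simp add: distrib_left Ym D_def)
  finally show ?thesis by (simp add: m_def P_def Y_def)
qed

text \<open>The sharp constant is \<open>2 / (3 sqrt 3)\<close>, about 0.385, attained at
  \<open>y = P / sqrt 3\<close>. The decomposition is
  \<open>(y - c)^2 (y + 2 c) = y^3 - 3 c^2 y + 2 c^3\<close> with 29/50 in place of
  \<open>1 / sqrt 3\<close>.\<close>

lemma cubic_le: "y * (P\<^sup>2 - y\<^sup>2) \<le> 2 / 5 * P ^ 3" if "0 \<le> y" "0 \<le> P" for y P :: real
proof -
  have "2 / 5 * P ^ 3 - y * (P\<^sup>2 - y\<^sup>2) = (y - 29/50 * P)\<^sup>2 * (y + 29/25 * P) + P\<^sup>2 * (23/2500 * y + (2/5 - 24389/62500) * P)"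
    by (simp add: power2_eq_square power3_eq_cube field_simps)
  also have "\<dots> \<ge> 0" using that by (intro add_nonneg_nonneg mult_nonneg_nonneg) auto
  finally show ?thesis by simp
qed

lemma exp_chord:
  fixes \<kappa> U x :: real
  assumes "exp (\<kappa> * U) \<le> 6 / 5" "0 < U" "0 \<le> x" "x \<le> U"
  shows "exp (\<kappa> * x) \<le> 1 + x / (5 * U)"
proof -
  have "exp ((1 - x / U) *\<^sub>R 0 + (x / U) *\<^sub>R (\<kappa> * U)) \<le> (1 - x / U) * exp 0 + (x / U) * exp (\<kappa> * U)"
    using assms by (intro convex_onD[OF exp_convex]) auto
  also have "\<dots> \<le> (1 - x / U) + (x / U) * (6 / 5)" using assms by (intro add_mono mult_left_mono divide_nonneg_pos) auto
  also have "\<dots> = 1 + x / (5 * U)" using assms by (simp add: field_simps)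
  finally show ?thesis using assms by (simp add: field_simps)
qed

text \<open>One step of the Stein identity for the vector field \<open>\<phi>(s) s\<close>, where \<open>\<phi>(s)\<close> grows
  exponentially outside the ball of radius \<open>r\<close>; the numerical constants only use that the
  exponent changes by at most \<open>ln (6/5)\<close> in the step.\<close>

lemma stein_step:
  fixes s u :: "'v::real_inner" and \<kappa> U r :: real
  defines "\<phi> \<equiv> \<lambda>s. exp (\<kappa> * max (norm s - r) 0)"
  assumes \<kappa>: "0 \<le> \<kappa>" "exp (\<kappa> * U) \<le> 6 / 5" and U: "0 < U" "norm u \<le> U"
  shows "(u \<bullet> (s + u)) * \<phi> (s + u) - (u \<bullet> s) * \<phi> s
    \<le> \<phi> s * (31/25 * (norm u)\<^sup>2 + (u \<bullet> s)\<^sup>2 / norm s / (5 * U))"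
proof -
  have pos: "\<phi> x > 0" for x by (simp add: \<phi>_def)
  have ratio: "\<phi> (s + u) \<le> \<phi> s * exp (\<kappa> * d)" if "norm (s + u) - norm s \<le> d" "0 \<le> d" for d
  proof -
    have "max (norm (s + u) - r) 0 \<le> max (norm s - r) 0 + d" using that by auto
    then have "\<kappa> * max (norm (s + u) - r) 0 \<le> \<kappa> * max (norm s - r) 0 + \<kappa> * d"
      using \<kappa> by (metis distrib_left mult_left_mono)
    then show ?thesis by (simp add: \<phi>_def flip: exp_add)
  qed
  have "norm (s + u) - norm s \<le> U" using norm_triangle_ineq[of s u] U by simp
  from ratio[OF this] U have "\<phi> (s + u) \<le> \<phi> s * exp (\<kappa> * U)" by simp
  also have "\<dots> \<le> \<phi> s * (6 / 5)" using \<kappa> pos[of s] by (intro mult_left_mono) auto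
  finally have a: "(norm u)\<^sup>2 * \<phi> (s + u) \<le> \<phi> s * (6/5 * (norm u)\<^sup>2)"
    by (metis mult.assoc mult.commute mult_left_mono zero_le_power2)
  have \<kappa>U: "\<kappa> \<le> 1 / (5 * U)"
  proof -
    have "1 + \<kappa> * U \<le> 6 / 5" using \<kappa>(2) exp_ge_add_one_self[of "\<kappa> * U"] by linarith
    then show ?thesis using U by (simp add: field_simps)
  qed
  \<comment> \<open>The cost of the changing weight. An outward jump cannot shorten
    \<open>s\<close>, so only lengthening outward jumps and inward jumps remain. At
    \<open>s = 0\<close> the left side vanishes and the quotient by the norm is 0 by
    convention.\<close>
  have T: "(u \<bullet> s) * (\<phi> (s + u) - \<phi> s)
    \<le> \<phi> s * (1/25 * (norm u)\<^sup>2 + (u \<bullet> s)\<^sup>2 / norm s / (5 * U))"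
  proof (cases "s = 0")
    case True
    then show ?thesis using pos[of 0] by simp
  next
    case False
    define m Y where "m = norm s" and "Y = s \<bullet> u / norm s"
    have m: "m > 0" using False by (simp add: m_def)
    have us: "u \<bullet> s = m * Y" using m by (simp add: Y_def m_def inner_commute)
    have YP: "\<bar>Y\<bar> \<le> norm u"
      using m Cauchy_Schwarz_ineq2[of s u] by (simp add: Y_def m_def field_simps)
    have sq: "(u \<bullet> s)\<^sup>2 / norm s = m * Y\<^sup>2"
      using m unfolding us by (simp add: power2_eq_square m_def)
    consider "0 \<le> Y" "norm s \<le> norm (s + u)" | "Y < 0"
      | "0 \<le> Y" "norm (s + u) < norm s" by linarith
    then show ?thesis
    proof cases
      case 1
      define d where "d = norm (s + u) - norm s"
      have d: "0 \<le> d" "d \<le> U" using 1 U norm_triangle_ineq[of s u] by (auto simp: d_def)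
      have "\<phi> (s + u) \<le> \<phi> s * exp (\<kappa> * d)" by (rule ratio) (use d in \<open>auto simp: d_def\<close>)
      also have "\<dots> \<le> \<phi> s * (1 + d / (5 * U))"
        using pos[of s] exp_chord[OF \<kappa>(2) U(1) d] by (intro mult_left_mono) auto
      finally have "\<phi> (s + u) - \<phi> s \<le> \<phi> s * (d / (5 * U))" by (simp add: algebra_simps)
      then have "(m * Y) * (\<phi> (s + u) - \<phi> s) \<le> (m * Y) * (\<phi> s * (d / (5 * U)))"
        using m 1 by (intro mult_left_mono) auto
      also have "\<dots> = \<phi> s * (Y * (m * d)) / (5 * U)" by simp
      also have "\<dots> \<le> \<phi> s * (m * Y\<^sup>2 + 1 / 5 * (U * (norm u)\<^sup>2)) / (5 * U)"
      proof -
        have "m * d \<le> s \<bullet> u + ((norm u)\<^sup>2 - Y\<^sup>2) / 2"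
          using norm_add_upper[OF False, of u] 1 m
          by (simp add: m_def Y_def d_def zero_le_divide_iff)
        then have "Y * (m * d) \<le> Y * (m * Y + ((norm u)\<^sup>2 - Y\<^sup>2) / 2)"
          using 1 us by (intro mult_left_mono) (auto simp: inner_commute)
        also have "\<dots> = m * Y\<^sup>2 + Y * ((norm u)\<^sup>2 - Y\<^sup>2) / 2" by (simp add: power2_eq_square algebra_simps)
        also have "Y * ((norm u)\<^sup>2 - Y\<^sup>2) \<le> 2 / 5 * norm u ^ 3" using 1 by (intro cubic_le) auto
        also have "norm u ^ 3 \<le> U * (norm u)\<^sup>2"
          using mult_right_mono[OF U(2), of "(norm u)\<^sup>2"] by (simp add: power3_eq_cube power2_eq_square)
        finally have "Y * (m * d) \<le> m * Y\<^sup>2 + 1 / 5 * (U * (norm u)\<^sup>2)" by simp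
        then show ?thesis using pos[of s] U by (intro divide_right_mono mult_left_mono) auto
      qed
      \<comment> \<open>The cubic bound leaves \<open>1/5 * U\<close> times the squared norm of
        \<open>u\<close>; dividing by \<open>5 * U\<close> gives 1/25, which together with the 6/5
        from \<open>a\<close> makes 31/25.\<close>
      also have "\<dots> = \<phi> s * (1/25 * (norm u)\<^sup>2 + m * Y\<^sup>2 / (5 * U))"
        using U by (simp add: field_simps)
      finally show ?thesis by (simp add: us[symmetric] sq)
    next
      case 2
      \<comment> \<open>By projection onto \<open>s\<close>, an inward jump lowers the norm by at
        most \<open>- Y\<close>; the tangent of the exponential and
        \<open>\<kappa> \<le> 1 / (5 * U)\<close> then suffice.\<close>
      have key: "\<phi> s - \<phi> (s + u) \<le> \<phi> s * (- Y / (5 * U))"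
      proof (cases "\<phi> s \<le> \<phi> (s + u)")
        case True
        have "0 \<le> \<phi> s * (- Y / (5 * U))" using 2 U pos[of s] by (intro mult_nonneg_nonneg divide_nonneg_pos) auto
        then show ?thesis using True by linarith
      next
        case False
        have "s \<bullet> (s + u) \<le> norm s * norm (s + u)" by (rule norm_cauchy_schwarz)
        then have "m * m + m * Y \<le> m * norm (s + u)"
          using us by (simp add: inner_add_right inner_commute m_def power2_norm_eq_inner[symmetric] power2_eq_square)
        then have "m + Y \<le> norm (s + u)" using m by (metis distrib_left mult_le_cancel_left_pos)
        then have "max (norm s - r) 0 \<le> max (norm (s + u) - r) 0 + (- Y)" using 2 by (auto simp: m_def)
        then have "\<kappa> * max (norm s - r) 0 + \<kappa> * Y \<le> \<kappa> * max (norm (s + u) - r) 0"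
          using \<kappa>(1) mult_left_mono[of "max (norm s - r) 0 + Y" "max (norm (s + u) - r) 0" \<kappa>]
          by (metis (no_types) add_uminus_conv_diff diff_ge_0_iff_ge distrib_left le_diff_eq minus_minus)
        then have "\<phi> s * exp (\<kappa> * Y) \<le> \<phi> (s + u)" by (simp add: \<phi>_def flip: exp_add)
        moreover have "\<phi> s * (1 + \<kappa> * Y) \<le> \<phi> s * exp (\<kappa> * Y)"
          using pos[of s] exp_ge_add_one_self[of "\<kappa> * Y"] by (intro mult_left_mono) auto
        ultimately have "\<phi> s - \<phi> (s + u) \<le> \<phi> s * (\<kappa> * - Y)" by (simp add: algebra_simps)
        also have "\<dots> \<le> \<phi> s * (1 / (5 * U) * - Y)"
          using \<kappa>U 2 pos[of s] by (intro mult_left_mono mult_right_mono) auto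
        finally show ?thesis by simp
      qed
      have "(u \<bullet> s) * (\<phi> (s + u) - \<phi> s) = (m * - Y) * (\<phi> s - \<phi> (s + u))" by (simp add: us algebra_simps)
      also have "\<dots> \<le> (m * - Y) * (\<phi> s * (- Y / (5 * U)))" using key 2 m by (intro mult_left_mono) (auto intro: mult_nonneg_nonpos)
      also have "\<dots> = \<phi> s * (m * Y\<^sup>2 / (5 * U))" by (simp add: power2_eq_square)
      also have "\<dots> \<le> \<phi> s * (1/25 * (norm u)\<^sup>2 + m * Y\<^sup>2 / (5 * U))" using pos[of s] by (intro mult_left_mono) auto
      finally show ?thesis by (simp add: sq)
    next
      case 3
      have "(norm (s + u))\<^sup>2 = (norm s)\<^sup>2 + 2 * (u \<bullet> s) + (norm u)\<^sup>2"
        by (simp add: power2_norm_eq_inner inner_add_left inner_add_right inner_commute)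
      moreover have "0 \<le> u \<bullet> s" using 3 m us by simp
      ultimately have "(norm s)\<^sup>2 \<le> (norm (s + u))\<^sup>2" by simp
      with 3 show ?thesis by (simp add: power2_le_iff_abs_le)
    qed
  qed
  have "(u \<bullet> (s + u)) * \<phi> (s + u) - (u \<bullet> s) * \<phi> s
    = (norm u)\<^sup>2 * \<phi> (s + u) + (u \<bullet> s) * (\<phi> (s + u) - \<phi> s)"
    by (simp add: inner_add_right algebra_simps flip: power2_norm_eq_inner)
  also have "\<dots> \<le> \<phi> s * (6/5 * (norm u)\<^sup>2) + \<phi> s * (1/25 * (norm u)\<^sup>2 + (u \<bullet> s)\<^sup>2 / norm s / (5 * U))"
    by (rule add_mono[OF a T])
  also have "\<dots> = \<phi> s * (31/25 * (norm u)\<^sup>2 + (u \<bullet> s)\<^sup>2 / norm s / (5 * U))"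
    by (simp add: algebra_simps)
  finally show ?thesis .
qed


section \<open>Exponential tails of Bernoulli sums from the Stein identity\<close>

definition bern_sum :: "('n::finite \<Rightarrow> real) \<Rightarrow> ('n \<Rightarrow> 'v::real_vector) \<Rightarrow> ('n \<Rightarrow> bool) \<Rightarrow> 'v" where
  "bern_sum \<theta> \<psi> b = (\<Sum>i\<in>UNIV. (of_bool (b i) - \<theta> i) *\<^sub>R \<psi> i)"

lemma bern_sum_upd: "bern_sum \<theta> \<psi> (b(i := True)) = bern_sum \<theta> \<psi> (b(i := False)) + \<psi> i"
proof -
  have "bern_sum \<theta> \<psi> (b(i := c)) = (of_bool c - \<theta> i) *\<^sub>R \<psi> i
      + (\<Sum>j\<in>UNIV-{i}. (of_bool (b j) - \<theta> j) *\<^sub>R \<psi> j)" for c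
    unfolding bern_sum_def by (subst sum.remove[of _ i]) (auto intro!: sum.cong)
  note this[of True] this[of False]
  then show ?thesis by (simp add: scaleR_left_diff_distrib)
qed

lemma inner_bern_sum: "bern_sum \<theta> \<psi> b \<bullet> y = (\<Sum>i\<in>UNIV. (of_bool (b i) - \<theta> i) * (\<psi> i \<bullet> y))"
  unfolding bern_sum_def by (simp add: inner_sum_left)

text \<open>The identity bounds the mean of \<open>|S|^2 \<phi>(S)\<close> by that of
  \<open>\<phi>(S) (31/25 A + |S| / (10 U))\<close>. Inside the ball of radius \<open>r0\<close> the
  weight is 1 and the deficit of the first integrand is at most \<open>N\<close>; outside,
  \<open>large\<close> gives a surplus of at least \<open>C N \<phi>\<close>. Comparing the two,
  \<open>N\<close> cancels.\<close>

lemma stein_tail: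
  fixes \<theta> :: "'n::finite \<Rightarrow> real" and \<psi> :: "'n \<Rightarrow> 'v::real_inner"
  assumes \<theta>: "\<And>i. 0 \<le> \<theta> i \<and> \<theta> i \<le> 1"
    and weak: "\<And>y. (\<Sum>i\<in>UNIV. \<theta> i * (1 - \<theta> i) * (\<psi> i \<bullet> y)\<^sup>2) \<le> (norm y)\<^sup>2 / 2"
    and A: "(\<Sum>i\<in>UNIV. \<theta> i * (1 - \<theta> i) * (norm (\<psi> i))\<^sup>2) \<le> A"
    and \<kappa>: "0 \<le> \<kappa>" "exp (\<kappa> * U) \<le> 6 / 5" and U: "0 < U" "\<And>i. norm (\<psi> i) \<le> U"
    and C: "0 < C" and r0: "0 < r0" "r0 \<le> r"
    and large: "(1 + C) * (31/25 * A + r0 / (10 * U)) \<le> r0\<^sup>2"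
  shows "bern_expect \<theta> (\<lambda>b. of_bool (r \<le> norm (bern_sum \<theta> \<psi> b))) \<le> exp (- (\<kappa> * (r - r0))) / C"
proof -
  define S where "S = bern_sum \<theta> \<psi>"
  define \<phi> where "\<phi> s = exp (\<kappa> * max (norm s - r0) 0)" for s :: 'v
  define v where "v i = \<theta> i * (1 - \<theta> i)" for i
  have v0: "0 \<le> v i" for i using \<theta>[of i] by (simp add: v_def)
  have A0: "0 \<le> A" by (rule order.trans[OF sum_nonneg A]) (use v0 in \<open>simp add: v_def\<close>)
  define H where "H i s = \<phi> s * (31/25 * (norm (\<psi> i))\<^sup>2 + (\<psi> i \<bullet> s)\<^sup>2 / norm s / (5 * U))" for i s
  define N where "N = 31/25 * A + r0 / (10 * U)"
  have N: "0 < N" using A0 r0 U by (auto simp: N_def intro!: add_nonneg_pos)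
  have pos: "\<phi> s > 0" for s by (simp add: \<phi>_def)
  have "bern_expect \<theta> (\<lambda>b. (norm (S b))\<^sup>2 * \<phi> (S b)) =
    bern_expect \<theta> (\<lambda>b. \<Sum>i\<in>UNIV. (of_bool (b i) - \<theta> i) * ((\<psi> i \<bullet> S b) * \<phi> (S b)))"
    by (simp add: power2_norm_eq_inner S_def inner_bern_sum sum_distrib_right mult.assoc)
  also have "\<dots> = (\<Sum>i\<in>UNIV. v i * bern_expect \<theta> (\<lambda>b. (\<psi> i \<bullet> S (b(i:=True))) * \<phi> (S (b(i:=True)))
      - (\<psi> i \<bullet> S (b(i:=False))) * \<phi> (S (b(i:=False)))))"
    unfolding bern_expect_sum v_def by (intro sum.cong refl bern_expect_centered_mult)
  also have "\<dots> \<le> (\<Sum>i\<in>UNIV. v i * bern_expect \<theta> (\<lambda>b. H i (S b)))"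
  proof (intro sum_mono mult_left_mono v0)
    fix i
    have "(\<psi> i \<bullet> S (b(i:=True))) * \<phi> (S (b(i:=True))) - (\<psi> i \<bullet> S (b(i:=False))) * \<phi> (S (b(i:=False)))
      \<le> \<theta> i * H i (S (b(i:=True))) + (1 - \<theta> i) * H i (S (b(i:=False)))" (is "?D \<le> _") for b
    proof -
      have eq: "S (b(i:=True)) = S (b(i:=False)) + \<psi> i" by (simp add: S_def bern_sum_upd)
      have "?D \<le> H i (S (b(i:=False)))"
        unfolding eq H_def \<phi>_def by (intro stein_step \<kappa> U)
      \<comment> \<open>Seen from the other end, the same difference is a step by
        \<open>- \<psi> i\<close>. With a bound at both ends, averaging over coordinate
        \<open>i\<close> recombines into the expectation of \<open>H i (S b)\<close>.\<close>
      moreover have "?D \<le> H i (S (b(i:=True)))"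
        using stein_step[OF \<kappa> U(1), where u="- \<psi> i" and r=r0 and s="S (b(i:=True))"] U(2)[of i]
        unfolding eq H_def \<phi>_def by simp
      ultimately have "\<theta> i * ?D + (1 - \<theta> i) * ?D \<le> \<theta> i * H i (S (b(i:=True))) + (1 - \<theta> i) * H i (S (b(i:=False)))"
        using \<theta>[of i] by (intro add_mono mult_left_mono) auto
      then show ?thesis by (simp add: algebra_simps)
    qed
    then have "bern_expect \<theta> (\<lambda>b. (\<psi> i \<bullet> S (b(i:=True))) * \<phi> (S (b(i:=True))) - (\<psi> i \<bullet> S (b(i:=False))) * \<phi> (S (b(i:=False))))
      \<le> bern_expect \<theta> (\<lambda>b. \<theta> i * H i (S (b(i:=True))) + (1 - \<theta> i) * H i (S (b(i:=False))))"
      by (intro bern_expect_mono \<theta>)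
    also have "\<dots> = bern_expect \<theta> (\<lambda>b. H i (S b))" by (rule bern_expect_resample[symmetric])
    finally show "bern_expect \<theta> (\<lambda>b. (\<psi> i \<bullet> S (b(i:=True))) * \<phi> (S (b(i:=True))) - (\<psi> i \<bullet> S (b(i:=False))) * \<phi> (S (b(i:=False))))
      \<le> bern_expect \<theta> (\<lambda>b. H i (S b))" .
  qed
  also have "\<dots> = bern_expect \<theta> (\<lambda>b. \<Sum>i\<in>UNIV. v i * H i (S b))"
    by (simp add: bern_expect_sum bern_expect_cmult)
  also have "\<dots> \<le> bern_expect \<theta> (\<lambda>b. \<phi> (S b) * (31/25 * A + norm (S b) / (10 * U)))"
  proof (intro bern_expect_mono \<theta>)
    fix b
    have "(\<Sum>i\<in>UNIV. v i * H i s) \<le> \<phi> s * (31/25 * A + norm s / (10 * U))" for s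
    proof -
      have "(\<Sum>i\<in>UNIV. v i * H i s) = \<phi> s * (31/25 * (\<Sum>i\<in>UNIV. v i * (norm (\<psi> i))\<^sup>2)
          + (\<Sum>i\<in>UNIV. v i * (\<psi> i \<bullet> s)\<^sup>2) / norm s / (5 * U))"
        by (simp add: H_def sum_distrib_left sum_divide_distrib sum.distrib algebra_simps)
      also have "\<dots> \<le> \<phi> s * (31/25 * A + ((norm s)\<^sup>2 / 2) / norm s / (5 * U))"
        using A weak[of s] U pos[of s]
        by (intro mult_left_mono add_mono divide_right_mono) (auto simp: v_def)
      also have "((norm s)\<^sup>2 / 2) / norm s / (5 * U) = norm s / (10 * U)"
        by (simp add: power2_eq_square)
      finally show ?thesis .
    qed
    then show "(\<Sum>i\<in>UNIV. v i * H i (S b)) \<le> \<phi> (S b) * (31/25 * A + norm (S b) / (10 * U))" .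
  qed
  finally have main: "bern_expect \<theta> (\<lambda>b. (norm (S b))\<^sup>2 * \<phi> (S b) - \<phi> (S b) * (31/25 * A + norm (S b) / (10 * U))) \<le> 0"
    by (simp add: bern_expect_diff)
  have low: "C * N * exp (\<kappa> * (r - r0)) * of_bool (r \<le> norm s) - N
      \<le> (norm s)\<^sup>2 * \<phi> s - \<phi> s * (31/25 * A + norm s / (10 * U))" for s
  proof -
    define m where "m = norm s"
    have *: "(norm s)\<^sup>2 * \<phi> s - \<phi> s * (31/25 * A + norm s / (10 * U)) = \<phi> s * (m\<^sup>2 - (31/25 * A + m / (10 * U)))"
      by (simp add: m_def algebra_simps)
    show ?thesis
    proof (cases "m < r0")
      case True
      then have "\<phi> s = 1" by (simp add: \<phi>_def m_def)
      moreover have "m / (10 * U) \<le> r0 / (10 * U)" using True U by (intro divide_right_mono) auto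
      then have "- (r0 / (10 * U)) \<le> (norm s)\<^sup>2 - norm s / (10 * U)"
        using zero_le_power2[of "norm s"] unfolding m_def by linarith
      moreover have "\<not> r \<le> norm s" using True r0 by (simp add: m_def)
      ultimately show ?thesis unfolding * N_def m_def by simp
    next
      case False
      then have m: "r0 \<le> m" by simp
      have "(1 + C) * (r0 / (10 * U)) \<le> (1 + C) * N" using C A0 U r0 by (intro mult_left_mono) (auto simp: N_def)
      then have "r0 / (10 * U) \<le> r0\<^sup>2"
        using large C r0 U mult_right_mono[of 1 "1 + C" "r0 / (10 * U)"] by (simp add: N_def)
      then have "r0 * (1 / (10 * U)) \<le> r0 * r0" by (simp add: power2_eq_square)
      \<comment> \<open>Hence \<open>m^2 - m / (10 U)\<close> increases beyond \<open>r0\<close>,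
        and the surplus only has to be known at \<open>r0\<close>.\<close>
      then have "1 / (10 * U) \<le> r0" using r0 by (subst (asm) mult_le_cancel_left_pos)
      then have "0 \<le> (m - r0) * (m + r0 - 1 / (10 * U))" using m r0 by (intro mult_nonneg_nonneg) auto
      then have "r0\<^sup>2 - r0 / (10 * U) \<le> m\<^sup>2 - m / (10 * U)" by (simp add: power2_eq_square algebra_simps diff_divide_distrib)
      then have q: "C * N \<le> m\<^sup>2 - (31/25 * A + m / (10 * U))" proof -
        have "C * N + N \<le> r0\<^sup>2" using large unfolding N_def by (simp only: distrib_right mult_1_left add.commute)
        moreover have "N = 31/25 * A + r0 / (10 * U)" by (rule N_def)
        ultimately show ?thesis using \<open>r0\<^sup>2 - r0 / (10 * U) \<le> m\<^sup>2 - m / (10 * U)\<close> by linarith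
      qed
      have "exp (\<kappa> * (r - r0)) * of_bool (r \<le> norm s) \<le> \<phi> s"
        using \<kappa> r0 by (auto simp: \<phi>_def m_def intro!: mult_left_mono)
      then have "(exp (\<kappa> * (r - r0)) * of_bool (r \<le> norm s)) * (C * N) \<le> \<phi> s * (m\<^sup>2 - (31/25 * A + m / (10 * U)))"
        using q C N pos[of s] by (intro mult_mono) auto
      then show ?thesis unfolding * using N by (simp add: algebra_simps)
    qed
  qed
  have "C * N * exp (\<kappa> * (r - r0)) * bern_expect \<theta> (\<lambda>b. of_bool (r \<le> norm (S b))) - N
     = bern_expect \<theta> (\<lambda>b. C * N * exp (\<kappa> * (r - r0)) * of_bool (r \<le> norm (S b)) - N)"
    by (simp add: bern_expect_diff bern_expect_const bern_expect_cmult)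
  also have "\<dots> \<le> bern_expect \<theta> (\<lambda>b. (norm (S b))\<^sup>2 * \<phi> (S b) - \<phi> (S b) * (31/25 * A + norm (S b) / (10 * U)))"
    by (intro bern_expect_mono \<theta> low)
  also have "\<dots> \<le> 0" by (rule main)
  finally have "N * (C * exp (\<kappa> * (r - r0)) * bern_expect \<theta> (\<lambda>b. of_bool (r \<le> norm (S b)))) \<le> N * 1"
    by (simp add: algebra_simps)
  then have "C * exp (\<kappa> * (r - r0)) * bern_expect \<theta> (\<lambda>b. of_bool (r \<le> norm (S b))) \<le> 1"
    using N by (subst (asm) mult_le_cancel_left_pos)
  then have "exp (\<kappa> * (r - r0)) * (bern_expect \<theta> (\<lambda>b. of_bool (r \<le> norm (S b))) * C) \<le> exp (\<kappa> * (r - r0)) * exp (- (\<kappa> * (r - r0)))"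
    by (simp add: mult_ac flip: exp_add)
  then have "bern_expect \<theta> (\<lambda>b. of_bool (r \<le> norm (S b))) * C \<le> exp (- (\<kappa> * (r - r0)))"
    by (rule mult_left_le_imp_le) simp
  then show ?thesis using C by (simp add: S_def pos_le_divide_eq)
qed

subsection \<open>Truncated Gaussian averages\<close>

abbreviation std_gauss :: "real measure" where
  "std_gauss \<equiv> density lborel (\<lambda>x. ennreal (std_normal_density x))"

text \<open>Completing the square: an exponential tilt is a shift of the mean.\<close>

lemma normal_density_exp_tilt:
  "std_normal_density x * exp (t * x) = exp (t\<^sup>2 / 2) * normal_density t 1 x"
  unfolding std_normal_density_def normal_density_def
  by (simp add: power2_eq_square field_simps flip: exp_add)

lemma has_bochner_integral_std_gauss_iff:
  assumes [measurable]: "g \<in> borel_measurable borel"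
  shows "has_bochner_integral std_gauss g x \<longleftrightarrow>
    has_bochner_integral lborel (\<lambda>x. std_normal_density x * g x) (x::real)"
  by (simp add: has_bochner_integral_iff integrable_density integral_density)

lemma has_bochner_integral_gauss_exp:
  "has_bochner_integral std_gauss (\<lambda>x. exp (t * x)) (exp (t\<^sup>2 / 2))"
proof (subst has_bochner_integral_std_gauss_iff)
  have "has_bochner_integral lborel (\<lambda>x. exp (t\<^sup>2 / 2) * normal_density t 1 x) (exp (t\<^sup>2 / 2) * 1)"
    by (rule has_bochner_integral_mult_right)
       (simp add: has_bochner_integral_iff)
  then show "has_bochner_integral lborel (\<lambda>x. std_normal_density x * exp (t * x)) (exp (t\<^sup>2 / 2))"
    by (simp add: normal_density_exp_tilt)
qed auto

lemma has_bochner_integral_gauss_square_exp: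
  "has_bochner_integral std_gauss (\<lambda>x. x\<^sup>2 * exp (t * x)) ((1 + t\<^sup>2) * exp (t\<^sup>2 / 2))"
proof (subst has_bochner_integral_std_gauss_iff)
  have 0: "has_bochner_integral lborel (normal_density t 1) 1"
    by (simp add: has_bochner_integral_iff)
  have 1: "has_bochner_integral lborel (\<lambda>x. normal_density t 1 x * (x - t)) 0"
    using normal_moment_odd[of 1 t 0] by simp
  have 2: "has_bochner_integral lborel (\<lambda>x. normal_density t 1 x * (x - t)\<^sup>2) 1"
    using normal_moment_even[of 1 t 1] by (simp add: fact_numeral)
  have "has_bochner_integral lborel (\<lambda>x. exp (t\<^sup>2 / 2) * (normal_density t 1 x * (x - t)\<^sup>2
      + (2 * t) * (normal_density t 1 x * (x - t)) + t\<^sup>2 * normal_density t 1 x))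
      (exp (t\<^sup>2 / 2) * (1 + (2 * t) * 0 + t\<^sup>2 * 1))"
    by (intro has_bochner_integral_mult_right has_bochner_integral_add 0 1 2)
  moreover have "std_normal_density x * (x\<^sup>2 * exp (t * x)) = exp (t\<^sup>2 / 2) * (normal_density t 1 x * (x - t)\<^sup>2
      + (2 * t) * (normal_density t 1 x * (x - t)) + t\<^sup>2 * normal_density t 1 x)" for x
  proof -
    have "std_normal_density x * (x\<^sup>2 * exp (t * x)) = (std_normal_density x * exp (t * x)) * x\<^sup>2" by simp
    also have "\<dots> = exp (t\<^sup>2 / 2) * (normal_density t 1 x * (x - t)\<^sup>2
      + (2 * t) * (normal_density t 1 x * (x - t)) + t\<^sup>2 * normal_density t 1 x)"
      unfolding normal_density_exp_tilt by (simp add: power2_eq_square algebra_simps)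
    finally show ?thesis .
  qed
  ultimately show "has_bochner_integral lborel (\<lambda>x. std_normal_density x * (x\<^sup>2 * exp (t * x)))
      ((1 + t\<^sup>2) * exp (t\<^sup>2 / 2))"
    by (simp add: mult.commute)
qed auto

lemma has_bochner_integral_gauss_exp_square:
  assumes "c < 1"
  shows "has_bochner_integral std_gauss (\<lambda>x. exp (c * x\<^sup>2 / 2)) (1 / sqrt (1 - c))"
proof (subst has_bochner_integral_std_gauss_iff)
  define \<sigma> where "\<sigma> = 1 / sqrt (1 - c)"
  have \<sigma>: "\<sigma> > 0" and \<sigma>2: "\<sigma>\<^sup>2 = 1 / (1 - c)" using assms by (auto simp: \<sigma>_def power_divide)
  have "has_bochner_integral lborel (\<lambda>x. \<sigma> * normal_density 0 \<sigma> x) (\<sigma> * 1)"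
    using \<sigma> by (intro has_bochner_integral_mult_right) (simp add: has_bochner_integral_iff)
  moreover have "\<sigma> * normal_density 0 \<sigma> x = std_normal_density x * exp (c * x\<^sup>2 / 2)" for x
  proof -
    have "sqrt (2 * pi * \<sigma>\<^sup>2) = sqrt (2 * pi) * \<sigma>" using \<sigma> by (simp add: real_sqrt_mult)
    then have "\<sigma> * normal_density 0 \<sigma> x = exp (- (x\<^sup>2 * (1 - c)) / 2) / sqrt (2 * pi)"
      using \<sigma> assms by (simp add: normal_density_def \<sigma>2 real_sqrt_mult)
    also have "\<dots> = std_normal_density x * exp (c * x\<^sup>2 / 2)"
      by (simp add: std_normal_density_def field_simps flip: exp_add)
    finally show ?thesis .
  qed
  ultimately show "has_bochner_integral lborel (\<lambda>x. std_normal_density x * exp (c * x\<^sup>2 / 2)) (1 / sqrt (1 - c))"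
    by (simp add: \<sigma>_def)
qed auto

interpretation std_gauss: prob_space std_gauss
  using prob_space_normal_density[of 1 0] by simp

interpretation gauss_product: product_prob_space "\<lambda>_. std_gauss" I for I
  by unfold_locales

lemma has_bochner_integral_gauss_prod:
  assumes "finite I" "\<And>i. i \<in> I \<Longrightarrow> has_bochner_integral std_gauss (f i) (c i :: real)"
  shows "has_bochner_integral (Pi\<^sub>M I (\<lambda>_. std_gauss)) (\<lambda>x. \<Prod>i\<in>I. f i (x i)) (\<Prod>i\<in>I. c i)"
  unfolding has_bochner_integral_iff
proof
  show "integrable (Pi\<^sub>M I (\<lambda>_. std_gauss)) (\<lambda>x. \<Prod>i\<in>I. f i (x i))"
    using assms by (intro gauss_product.product_integrable_prod) (auto simp: has_bochner_integral_iff)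
  have "(\<integral>x. (\<Prod>i\<in>I. f i (x i)) \<partial>Pi\<^sub>M I (\<lambda>_. std_gauss)) = (\<Prod>i\<in>I. integral\<^sup>L std_gauss (f i))"
    using assms by (intro gauss_product.product_integral_prod) (auto simp: has_bochner_integral_iff)
  also have "\<dots> = (\<Prod>i\<in>I. c i)"
    using assms by (intro prod.cong) (auto simp: has_bochner_integral_iff)
  finally show "(\<integral>x. (\<Prod>i\<in>I. f i (x i)) \<partial>Pi\<^sub>M I (\<lambda>_. std_gauss)) = (\<Prod>i\<in>I. c i)" .
qed

lemma has_bochner_integral_gauss_exp_inner:
  assumes "finite I"
  shows "has_bochner_integral (Pi\<^sub>M I (\<lambda>_. std_gauss)) (\<lambda>x. exp (\<Sum>i\<in>I. t i * x i)) (exp ((\<Sum>i\<in>I. (t i)\<^sup>2) / 2))"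
  using has_bochner_integral_gauss_prod[OF assms has_bochner_integral_gauss_exp, of t] assms
  by (simp add: exp_sum sum_divide_distrib)

lemma has_bochner_integral_gauss_square_exp_inner:
  assumes "finite I" "j \<in> I"
  shows "has_bochner_integral (Pi\<^sub>M I (\<lambda>_. std_gauss)) (\<lambda>x. (x j)\<^sup>2 * exp (\<Sum>i\<in>I. t i * x i))
    ((1 + (t j)\<^sup>2) * exp ((\<Sum>i\<in>I. (t i)\<^sup>2) / 2))"
proof -
  have "has_bochner_integral (Pi\<^sub>M I (\<lambda>_. std_gauss))
      (\<lambda>x. \<Prod>i\<in>I. (\<lambda>y. (if i = j then y\<^sup>2 else 1) * exp (t i * y)) (x i))
      (\<Prod>i\<in>I. (if i = j then 1 + (t i)\<^sup>2 else 1) * exp ((t i)\<^sup>2 / 2))"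
    by (intro has_bochner_integral_gauss_prod assms)
       (use has_bochner_integral_gauss_exp has_bochner_integral_gauss_square_exp in auto)
  then show ?thesis using assms by (simp add: exp_sum sum_divide_distrib prod.distrib prod.delta)
qed

lemma has_bochner_integral_gauss_exp_quadratic:
  assumes "finite I" "\<And>i. i \<in> I \<Longrightarrow> c i < 1"
  shows "has_bochner_integral (Pi\<^sub>M I (\<lambda>_. std_gauss)) (\<lambda>x. exp (\<Sum>i\<in>I. c i * (x i)\<^sup>2 / 2)) (\<Prod>i\<in>I. 1 / sqrt (1 - c i))"
  using has_bochner_integral_gauss_prod[OF assms(1) has_bochner_integral_gauss_exp_square, of c] assms
  by (simp add: exp_sum)

text \<open>Tilting by \<open>t\<close> moves the standard Gaussian to mean \<open>t\<close>. The mass of the ellipsoid under the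
  tilted law is bounded below by Markov's inequality at the shorter tilt of length \<open>R\<close>, and the
  remaining tilt in the same direction by a tangent line of the exponential, with
  \<open>- X \<le> exp (- X - 1)\<close> controlling the negative part of the direction \<open>X\<close>.\<close>

lemma gauss_tilt_lower:
  fixes t l :: "'i \<Rightarrow> real"
  assumes I: "finite I" and l: "\<And>i. i \<in> I \<Longrightarrow> 0 \<le> l i \<and> l i \<le> 1"
    and t: "(\<Sum>i\<in>I. (t i)\<^sup>2) = r\<^sup>2" and R: "0 < R" "R \<le> r" and G: "0 < G"
    and \<rho>: "0 < \<rho>" "\<rho> \<le> 1 - ((\<Sum>i\<in>I. l i) + R\<^sup>2) / G"
  shows "\<rho> * exp (R\<^sup>2 / 2 + (r - R) * (R - exp (- 1 / 2) / \<rho>)) \<le>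
    (\<integral>x. exp (\<Sum>i\<in>I. t i * x i) * indicator {x. (\<Sum>i\<in>I. l i * (x i)\<^sup>2) \<le> G} x \<partial>Pi\<^sub>M I (\<lambda>_. std_gauss))"
proof -
  define P where "P = Pi\<^sub>M I (\<lambda>_. std_gauss)"
  define \<beta> where "\<beta> = r - R"
  \<comment> \<open>For standard Gaussian \<open>X\<close> the mean of \<open>exp (- X - 1)\<close>
    is \<open>exp (- 1 / 2)\<close>. The offset \<open>c\<close> solves
    \<open>(1 + \<beta> c) \<rho> - \<beta> exp (- 1 / 2) = \<rho>\<close>, which removes
    \<open>\<beta>\<close> from the prefactor.\<close>
  define c where "c = exp (- 1 / 2) / \<rho>"
  have \<beta>: "0 \<le> \<beta>" using R by (simp add: \<beta>_def)
  have c: "0 \<le> c" using \<rho> by (simp add: c_def)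
  have r: "0 < r" using R by simp
  define n where "n i = t i / r" for i
  define d where "d u x = (\<Sum>i\<in>I. u i * x i)" for u x :: "'i \<Rightarrow> real"
  define L where "L x = (\<Sum>i\<in>I. l i * (x i)\<^sup>2)" for x
  define a where "a i = R * n i" for i
  define b where "b i = (R - 1) * n i" for i
  have n2: "(\<Sum>i\<in>I. (n i)\<^sup>2) = 1"
    using t r by (simp add: n_def power_divide flip: sum_divide_distrib)
  have a2: "(\<Sum>i\<in>I. (a i)\<^sup>2) = R\<^sup>2" and b2: "(\<Sum>i\<in>I. (b i)\<^sup>2) = (R - 1)\<^sup>2"
    using n2 by (simp_all add: a_def b_def power_mult_distrib flip: sum_distrib_left)
  have da: "d a x = R * d n x" and db: "d b x = (R - 1) * d n x" and dt: "d t x = r * d n x" for x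
    using r by (simp_all add: d_def a_def b_def n_def sum_distrib_left mult_ac)
  \<comment> \<open>A minorant of the truncated exponential with an explicit integral. The factor
    with \<open>G\<close> is Markov's inequality under the tilt \<open>a\<close>; the subtracted
    \<open>\<beta> exp (- X - 1)\<close>, multiplied by that tilt, is again a pure exponential,
    namely the tilt \<open>b\<close>.\<close>
  define h where "h x = exp (\<beta> * R - \<beta> * c) * ((1 + \<beta> * c) * (exp (d a x) - (\<Sum>i\<in>I. l i * ((x i)\<^sup>2 * exp (d a x))) / G)
      - \<beta> * (exp (R - 1) * exp (d b x)))" for x
  have "has_bochner_integral P h (exp (\<beta> * R - \<beta> * c) * ((1 + \<beta> * c) *
      (exp (R\<^sup>2 / 2) - (\<Sum>i\<in>I. l i * ((1 + (a i)\<^sup>2) * exp (R\<^sup>2 / 2))) / G) - \<beta> * (exp (R - 1) * exp ((R - 1)\<^sup>2 / 2))))"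
    unfolding h_def P_def d_def
    by (intro has_bochner_integral_mult_right has_bochner_integral_diff has_bochner_integral_divide_zero
        has_bochner_integral_sum)
      (use has_bochner_integral_gauss_exp_inner[OF I, of a] has_bochner_integral_gauss_exp_inner[OF I, of b]
        has_bochner_integral_gauss_square_exp_inner[OF I, of _ a] in \<open>simp_all add: a2 b2\<close>)
  then have h: "integrable P h" and ih: "integral\<^sup>L P h = exp (\<beta> * R - \<beta> * c) * ((1 + \<beta> * c) *
      (exp (R\<^sup>2 / 2) - (\<Sum>i\<in>I. l i * ((1 + (a i)\<^sup>2) * exp (R\<^sup>2 / 2))) / G) - \<beta> * (exp (R - 1) * exp ((R - 1)\<^sup>2 / 2)))"
    by (auto simp: has_bochner_integral_iff)
  have "\<rho> * exp (R\<^sup>2 / 2 + \<beta> * (R - c)) \<le> integral\<^sup>L P h"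
  proof -
    have s: "(\<Sum>i\<in>I. l i * (1 + (a i)\<^sup>2)) \<le> (\<Sum>i\<in>I. l i) + R\<^sup>2"
    proof -
      have "(\<Sum>i\<in>I. l i * (a i)\<^sup>2) \<le> (\<Sum>i\<in>I. 1 * (a i)\<^sup>2)"
        using l by (intro sum_mono mult_right_mono) auto
      then show ?thesis by (simp add: distrib_left sum.distrib a2)
    qed
    have "exp (R - 1) * exp ((R - 1)\<^sup>2 / 2) = exp (R\<^sup>2 / 2) * exp (- 1 / 2)"
      by (simp add: power2_eq_square field_simps flip: exp_add)
    moreover have "(\<Sum>i\<in>I. l i * ((1 + (a i)\<^sup>2) * exp (R\<^sup>2 / 2))) = (\<Sum>i\<in>I. l i * (1 + (a i)\<^sup>2)) * exp (R\<^sup>2 / 2)"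
      by (simp only: sum_distrib_right mult.assoc)
    ultimately have "integral\<^sup>L P h = exp (\<beta> * R - \<beta> * c) * ((1 + \<beta> * c) *
        (exp (R\<^sup>2 / 2) - (\<Sum>i\<in>I. l i * (1 + (a i)\<^sup>2)) * exp (R\<^sup>2 / 2) / G) - \<beta> * (exp (R\<^sup>2 / 2) * exp (- 1 / 2)))"
      unfolding ih by simp
    also have "\<dots> = exp (\<beta> * R - \<beta> * c) * exp (R\<^sup>2 / 2) *
        ((1 + \<beta> * c) * (1 - (\<Sum>i\<in>I. l i * (1 + (a i)\<^sup>2)) / G) - \<beta> * exp (- 1 / 2))"
      by (simp add: right_diff_distrib left_diff_distrib distrib_left distrib_right mult_ac)
    also have "\<dots> \<ge> exp (\<beta> * R - \<beta> * c) * exp (R\<^sup>2 / 2) * ((1 + \<beta> * c) * \<rho> - \<beta> * exp (- 1 / 2))"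
    proof -
      have "(\<Sum>i\<in>I. l i * (1 + (a i)\<^sup>2)) / G \<le> ((\<Sum>i\<in>I. l i) + R\<^sup>2) / G"
        using s G by (intro divide_right_mono) auto
      then have "\<rho> \<le> 1 - (\<Sum>i\<in>I. l i * (1 + (a i)\<^sup>2)) / G" using \<rho> by linarith
      then show ?thesis using \<beta> c by (intro mult_left_mono diff_mono) auto
    qed
    also have "(1 + \<beta> * c) * \<rho> - \<beta> * exp (- 1 / 2) = \<rho>" using \<rho> by (simp add: c_def algebra_simps)
    finally show ?thesis by (simp add: exp_add right_diff_distrib mult_ac)
  qed
  also have "integral\<^sup>L P h \<le> (\<integral>x. exp (d t x) * indicator {x. L x \<le> G} x \<partial>P)"
  proof (rule integral_mono[OF h])
    have "integrable P (\<lambda>x. exp (d t x))"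
      using has_bochner_integral_gauss_exp_inner[OF I, of t] by (auto simp: P_def d_def has_bochner_integral_iff)
    moreover have [measurable]: "(\<lambda>x. L x) \<in> borel_measurable P" "(\<lambda>x. d t x) \<in> borel_measurable P"
      unfolding L_def d_def P_def by measurable
    have "(\<lambda>x. exp (d t x) * indicator {x. L x \<le> G} x) \<in> borel_measurable P"
    proof -
      have "(\<lambda>x. exp (d t x) * (if L x \<le> G then 1 else 0)) \<in> borel_measurable P" by measurable
      then show ?thesis by (simp add: indicator_def)
    qed
    ultimately show "integrable P (\<lambda>x. exp (d t x) * indicator {x. L x \<le> G} x)"
      by (rule Bochner_Integration.integrable_bound) (auto simp: indicator_def)
    fix x
    define X where "X = d n x - R"
    have L0: "0 \<le> L x" unfolding L_def using l by (intro sum_nonneg) auto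
    have hx: "h x = exp (\<beta> * R - \<beta> * c) * exp (d a x) * ((1 + \<beta> * c) * (1 - L x / G) - \<beta> * exp (- X - 1))"
    proof -
      have "exp (R - 1) * exp (d b x) = exp (d a x) * exp (- X - 1)"
        by (simp add: da db X_def algebra_simps flip: exp_add)
      moreover have "(\<Sum>i\<in>I. l i * ((x i)\<^sup>2 * exp (d a x))) = L x * exp (d a x)"
        by (simp only: L_def sum_distrib_right mult.assoc)
      ultimately show ?thesis unfolding h_def
        by (simp add: add_divide_distrib right_diff_distrib left_diff_distrib distrib_left distrib_right mult_ac)
    qed
    have tx: "exp (d t x) = exp (\<beta> * R - \<beta> * c) * exp (d a x) * exp (\<beta> * (X + c))"
      by (simp add: dt da X_def \<beta>_def algebra_simps flip: exp_add)
    have "(1 + \<beta> * c) * (1 - L x / G) - \<beta> * exp (- X - 1) \<le> exp (\<beta> * (X + c)) * indicator {x. L x \<le> G} x"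
    proof (cases "L x \<le> G")
      case True
      have "(1 + \<beta> * c) * (1 - L x / G) \<le> (1 + \<beta> * c) * 1"
        using L0 G \<beta> c by (intro mult_left_mono) auto
      moreover have "\<beta> * (- X) \<le> \<beta> * exp (- X - 1)"
        using exp_ge_add_one_self[of "- X - 1"] \<beta> by (intro mult_left_mono) auto
      ultimately have "(1 + \<beta> * c) * (1 - L x / G) - \<beta> * exp (- X - 1) \<le> (1 + \<beta> * c) * 1 - \<beta> * (- X)"
        by (rule diff_mono)
      also have "\<dots> = 1 + \<beta> * (X + c)" by (simp add: distrib_left)
      also have "\<dots> \<le> exp (\<beta> * (X + c))" by (rule exp_ge_add_one_self)
      finally have "(1 + \<beta> * c) * (1 - L x / G) - \<beta> * exp (- X - 1) \<le> exp (\<beta> * (X + c))" .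
      then show ?thesis using True by simp
    next
      case False
      then have "(1 + \<beta> * c) * (1 - L x / G) \<le> 0"
        using G \<beta> c by (intro mult_nonneg_nonpos) (auto simp: field_simps)
      moreover have "0 \<le> \<beta> * exp (- X - 1)" using \<beta> by simp
      ultimately show ?thesis using False by simp
    qed
    then show "h x \<le> exp (d t x) * indicator {x. L x \<le> G} x"
      unfolding hx tx by (subst (2) mult.assoc) (intro mult_left_mono, auto)
  qed
  finally show ?thesis by (simp add: \<beta>_def c_def d_def L_def P_def)
qed

text \<open>For \<open>y = ln (1 / (1 - s))\<close> the right-hand side is exactly
  \<open>sinh y\<close>, which is at least \<open>y\<close>.\<close>

lemma ln_inverse_one_minus_le:
  fixes s :: real
  assumes "0 \<le> s" "s < 1"
  shows "ln (1 / (1 - s)) \<le> s + s\<^sup>2 / (2 * (1 - s))"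
proof -
  define y where "y = ln (1 / (1 - s))"
  have y: "0 \<le> y" using assms by (simp add: y_def)
  have ey: "exp y = 1 / (1 - s)" using assms by (simp add: y_def)
  have "y \<le> (exp y - inverse (exp y)) / 2" by (rule real_le_x_sinh[OF y])
  also have "\<dots> = s + s\<^sup>2 / (2 * (1 - s))"
    unfolding ey using assms by (simp add: field_simps power2_eq_square)
  finally show ?thesis by (simp add: y_def)
qed

text \<open>The product is the Gaussian average without truncation. Putting \<open>\<mu>\<close> for
  \<open>\<mu> * l i\<close> in the denominators leaves only the trace and the trace of the square
  in the exponent.\<close>

lemma gauss_det_le:
  assumes "finite I" "\<And>i. i \<in> I \<Longrightarrow> 0 \<le> l i \<and> l i \<le> 1" "0 < \<mu>" "\<mu> < 1"
  shows "(\<Prod>i\<in>I. 1 / sqrt (1 - \<mu> * l i)) \<le> exp (\<mu> / 2 * (\<Sum>i\<in>I. l i) + \<mu>\<^sup>2 / (4 * (1 - \<mu>)) * (\<Sum>i\<in>I. (l i)\<^sup>2))"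
proof -
  have l1: "\<mu> * l i < 1" if "i \<in> I" for i
    using assms(2)[OF that] mult_left_mono[of "l i" 1 \<mu>] assms(3,4) by linarith
  have "1 / sqrt (1 - \<mu> * l i) \<le> exp (\<mu> / 2 * l i + \<mu>\<^sup>2 / (4 * (1 - \<mu>)) * (l i)\<^sup>2)" if "i \<in> I" for i
  proof -
    define s where "s = \<mu> * l i"
    have s: "0 \<le> s" "s \<le> \<mu>" using assms that mult_left_mono[of "l i" 1 \<mu>] by (auto simp: s_def)
    then have s1: "s < 1" using assms by simp
    have "1 / sqrt (1 - s) = exp (ln (1 / (1 - s)) / 2)"
      using s1 by (simp add: ln_div ln_sqrt[symmetric] exp_minus inverse_eq_divide)
    also have "\<dots> \<le> exp ((s + s\<^sup>2 / (2 * (1 - s))) / 2)"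
      using ln_inverse_one_minus_le[OF s(1) s1] by simp
    also have "\<dots> \<le> exp ((s + s\<^sup>2 / (2 * (1 - \<mu>))) / 2)"
      using s assms by (auto intro!: divide_left_mono mult_pos_pos)
    also have "(s + s\<^sup>2 / (2 * (1 - \<mu>))) / 2 = \<mu> / 2 * l i + \<mu>\<^sup>2 / (4 * (1 - \<mu>)) * (l i)\<^sup>2"
      using assms by (simp add: s_def power2_eq_square field_simps)
    finally show ?thesis by (simp add: s_def)
  qed
  then have "(\<Prod>i\<in>I. 1 / sqrt (1 - \<mu> * l i)) \<le> (\<Prod>i\<in>I. exp (\<mu> / 2 * l i + \<mu>\<^sup>2 / (4 * (1 - \<mu>)) * (l i)\<^sup>2))"
    using l1 by (intro prod_mono) (simp add: less_imp_le)
  then show ?thesis using assms by (simp add: exp_sum[symmetric] sum.distrib sum_distrib_left)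
qed

text \<open>The finite expectation is exchanged with the Gaussian integral: on the ellipsoid
  \<open>mgf\<close> applies to \<open>u = sqrt \<mu> x\<close>, off it the integrand is 0. The
  lower bound uses the tilt length \<open>sqrt \<mu> * r1\<close> and continues linearly to the
  actual radius; \<open>slope\<close> makes this continuation nondecreasing, so its value at
  \<open>r\<close> serves for all larger radii.\<close>

lemma gauss_tail:
  fixes \<theta> :: "'n::finite \<Rightarrow> real" and \<sigma> :: "('n \<Rightarrow> bool) \<Rightarrow> 'i \<Rightarrow> real" and l :: "'i \<Rightarrow> real"
  assumes \<theta>: "\<And>i. 0 \<le> \<theta> i \<and> \<theta> i \<le> 1"
    and I: "finite I" and l: "\<And>i. i \<in> I \<Longrightarrow> 0 \<le> l i \<and> l i \<le> 1"
    and mgf: "\<And>u. (\<Sum>i\<in>I. l i * (u i)\<^sup>2) \<le> \<mu> * G \<Longrightarrow>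
      bern_expect \<theta> (\<lambda>b. exp (\<Sum>i\<in>I. u i * \<sigma> b i)) \<le> exp ((\<Sum>i\<in>I. l i * (u i)\<^sup>2) / 2)"
    and \<mu>: "0 < \<mu>" "\<mu> < 1" and G: "0 < G"
    and r: "0 < r1" "r1 \<le> r"
    and \<rho>: "0 < \<rho>" "\<rho> \<le> 1 - ((\<Sum>i\<in>I. l i) + \<mu> * r1\<^sup>2) / G"
    and slope: "exp (- 1 / 2) / \<rho> \<le> sqrt \<mu> * r1"
  shows "bern_expect \<theta> (\<lambda>b. of_bool (r \<le> sqrt (\<Sum>i\<in>I. (\<sigma> b i)\<^sup>2))) \<le>
    exp (\<mu> / 2 * (\<Sum>i\<in>I. l i) + \<mu>\<^sup>2 / (4 * (1 - \<mu>)) * (\<Sum>i\<in>I. (l i)\<^sup>2)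
      - \<mu> * r1\<^sup>2 / 2 - sqrt \<mu> * (r - r1) * (sqrt \<mu> * r1 - exp (- 1 / 2) / \<rho>)) / \<rho>"
proof -
  define P where "P = Pi\<^sub>M I (\<lambda>_. std_gauss)"
  define L where "L x = (\<Sum>i\<in>I. l i * (x i)\<^sup>2)" for x :: "'i \<Rightarrow> real"
  have l1: "\<mu> * l i < 1" if "i \<in> I" for i
    using l[OF that] mult_left_mono[of "l i" 1 \<mu>] \<mu> by linarith
  define nrm where "nrm b = sqrt (\<Sum>i\<in>I. (\<sigma> b i)\<^sup>2)" for b
  define f where "f b x = exp (\<Sum>i\<in>I. sqrt \<mu> * \<sigma> b i * x i) * indicator {x. L x \<le> G} x" for b x
  define low where "low = \<rho> * exp (\<mu> * r1\<^sup>2 / 2 + sqrt \<mu> * (r - r1) * (sqrt \<mu> * r1 - exp (- 1 / 2) / \<rho>))"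
  have intf: "integrable P (f b)" for b
  proof -
    have "integrable P (\<lambda>x. exp (\<Sum>i\<in>I. sqrt \<mu> * \<sigma> b i * x i))"
      using has_bochner_integral_gauss_exp_inner[OF I] by (auto simp: P_def has_bochner_integral_iff)
    moreover have [measurable]: "(\<lambda>x. L x) \<in> borel_measurable P" "(\<lambda>x. (\<Sum>i\<in>I. sqrt \<mu> * \<sigma> b i * x i)) \<in> borel_measurable P"
      unfolding L_def P_def by measurable
    have "f b \<in> borel_measurable P"
    proof -
      have "(\<lambda>x. exp (\<Sum>i\<in>I. sqrt \<mu> * \<sigma> b i * x i) * (if L x \<le> G then 1 else 0)) \<in> borel_measurable P" by measurable
      then show ?thesis by (simp add: f_def[abs_def] indicator_def)
    qed
    ultimately show ?thesis
      by (rule Bochner_Integration.integrable_bound) (auto simp: indicator_def f_def)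
  qed
  have lower: "low * of_bool (r \<le> nrm b) \<le> integral\<^sup>L P (f b)" for b
  proof (cases "r \<le> nrm b")
    case False
    then show ?thesis by (auto intro!: Bochner_Integration.integral_nonneg simp: f_def)
  next
    case True
    have nn: "0 \<le> (\<Sum>i\<in>I. (\<sigma> b i)\<^sup>2)" by (intro sum_nonneg) auto
    have "low \<le> \<rho> * exp ((sqrt \<mu> * r1)\<^sup>2 / 2 + (sqrt \<mu> * nrm b - sqrt \<mu> * r1) * (sqrt \<mu> * r1 - exp (- 1 / 2) / \<rho>))"
    proof -
      have "sqrt \<mu> * (r - r1) * (sqrt \<mu> * r1 - exp (- 1 / 2) / \<rho>)
        \<le> (sqrt \<mu> * nrm b - sqrt \<mu> * r1) * (sqrt \<mu> * r1 - exp (- 1 / 2) / \<rho>)"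
        using True slope \<mu> by (intro mult_right_mono) (auto simp: algebra_simps)
      then show ?thesis using \<mu> \<rho> by (simp add: low_def power_mult_distrib)
    qed
    also have "\<dots> \<le> integral\<^sup>L P (f b)"
      unfolding f_def P_def L_def
    proof (rule gauss_tilt_lower[OF I l])
      show "(\<Sum>i\<in>I. (sqrt \<mu> * \<sigma> b i)\<^sup>2) = (sqrt \<mu> * nrm b)\<^sup>2"
        using \<mu> nn by (simp add: power_mult_distrib nrm_def sum_distrib_left)
      show "sqrt \<mu> * r1 \<le> sqrt \<mu> * nrm b" using True r \<mu> by (intro mult_left_mono) auto
    qed (use \<mu> G r \<rho> in \<open>auto simp: power_mult_distrib\<close>)
    finally show ?thesis using True by simp
  qed
  have "low * bern_expect \<theta> (\<lambda>b. of_bool (r \<le> nrm b)) \<le> bern_expect \<theta> (\<lambda>b. integral\<^sup>L P (f b))"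
    unfolding bern_expect_cmult[symmetric] by (intro bern_expect_mono \<theta> lower)
  also have "\<dots> = (\<integral>x. bern_expect \<theta> (\<lambda>b. f b x) \<partial>P)"
    unfolding bern_expect_def using intf by (simp add: Bochner_Integration.integral_sum)
  also have "\<dots> \<le> (\<integral>x. exp (\<Sum>i\<in>I. (\<mu> * l i) * (x i)\<^sup>2 / 2) \<partial>P)"
  proof (rule integral_mono)
    show "integrable P (\<lambda>x. bern_expect \<theta> (\<lambda>b. f b x))"
      unfolding bern_expect_def using intf by simp
    show "integrable P (\<lambda>x. exp (\<Sum>i\<in>I. (\<mu> * l i) * (x i)\<^sup>2 / 2))"
      using has_bochner_integral_gauss_exp_quadratic[OF I, of "\<lambda>i. \<mu> * l i"] l1
      by (simp add: P_def has_bochner_integral_iff)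
    fix x
    have Lx: "(\<Sum>i\<in>I. l i * (sqrt \<mu> * x i)\<^sup>2) = \<mu> * L x"
      using \<mu> by (simp add: L_def power_mult_distrib sum_distrib_left mult_ac)
    show "bern_expect \<theta> (\<lambda>b. f b x) \<le> exp (\<Sum>i\<in>I. (\<mu> * l i) * (x i)\<^sup>2 / 2)"
    proof (cases "L x \<le> G")
      case True
      then have "bern_expect \<theta> (\<lambda>b. f b x) = bern_expect \<theta> (\<lambda>b. exp (\<Sum>i\<in>I. (sqrt \<mu> * x i) * \<sigma> b i))"
        by (simp add: f_def mult_ac)
      also have "\<dots> \<le> exp (\<mu> * L x / 2)"
        using mgf[of "\<lambda>i. sqrt \<mu> * x i"] True \<mu> unfolding Lx by simp
      also have "\<mu> * L x / 2 = (\<Sum>i\<in>I. (\<mu> * l i) * (x i)\<^sup>2 / 2)"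
        by (simp add: L_def sum_distrib_left sum_divide_distrib mult_ac)
      finally show ?thesis .
    next
      case False
      then show ?thesis by (simp add: f_def bern_expect_const)
    qed
  qed
  also have "\<dots> = (\<Prod>i\<in>I. 1 / sqrt (1 - \<mu> * l i))"
    using has_bochner_integral_gauss_exp_quadratic[OF I, of "\<lambda>i. \<mu> * l i"] l1
    by (simp add: P_def has_bochner_integral_iff)
  also have "\<dots> \<le> exp (\<mu> / 2 * (\<Sum>i\<in>I. l i) + \<mu>\<^sup>2 / (4 * (1 - \<mu>)) * (\<Sum>i\<in>I. (l i)\<^sup>2))"
    by (rule gauss_det_le[OF I l \<mu>])
  finally have "bern_expect \<theta> (\<lambda>b. of_bool (r \<le> nrm b)) \<le>
      exp (\<mu> / 2 * (\<Sum>i\<in>I. l i) + \<mu>\<^sup>2 / (4 * (1 - \<mu>)) * (\<Sum>i\<in>I. (l i)\<^sup>2)) / low"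
    using \<rho> by (simp add: low_def pos_le_divide_eq mult.commute)
  also have "\<dots> = exp (\<mu> / 2 * (\<Sum>i\<in>I. l i) + \<mu>\<^sup>2 / (4 * (1 - \<mu>)) * (\<Sum>i\<in>I. (l i)\<^sup>2)
      - \<mu> * r1\<^sup>2 / 2 - sqrt \<mu> * (r - r1) * (sqrt \<mu> * r1 - exp (- 1 / 2) / \<rho>)) / \<rho>"
    by (simp add: low_def exp_add exp_diff)
  finally show ?thesis by (simp add: nrm_def)
qed

subsection \<open>The critical inequalities\<close>

lemma exp_minus_half_le: "exp (- 1 / 2) \<le> (607/1000 :: real)"
proof -
  have "exp 1 = (exp (1/2) :: real)\<^sup>2" using exp_double[of "1/2 :: real"] by simp
  moreover have "(1000/607 :: real)\<^sup>2 \<le> 2715/1000" by (simp add: power2_eq_square)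
  moreover have "2715/1000 \<le> (exp 1 :: real)" using abs_le_D2[OF e_approx_32] by simp
  ultimately have "(1000/607 :: real)\<^sup>2 \<le> (exp (1/2))\<^sup>2" by linarith
  then have "1000/607 \<le> (exp (1/2) :: real)" by (rule power2_le_imp_le) simp
  then show ?thesis by (simp add: exp_minus field_simps)
qed

lemma ln3_ge: "109/100 \<le> ln (3::real)"
proof -
  \<comment> \<open>The power 12 turns 109/100 into the integer 13 and a small remainder, which the
    bound on \<open>exp 1\<close> can handle.\<close>
  have "exp (109/100 :: real) ^ 12 = exp (real 12 * (109/100))" by (rule exp_of_nat_mult[symmetric])
  also have "real 12 * (109/100) = real 13 * 1 + 2/25" by simp
  also have "exp (real 13 * 1 + 2/25) = exp 1 ^ 13 * exp (2/25)"
    unfolding exp_add exp_of_nat_mult ..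
  also have "\<dots> \<le> (272/100) ^ 13 * (1 + 2 * (2/25))"
    using e_less_272 by (intro mult_mono power_mono real_exp_bound_lemma) auto
  also have "\<dots> \<le> (3 :: real) ^ 12" by (simp add: power_divide)
  finally have "exp (109/100 :: real) \<le> 3" by (subst (asm) power_mono_iff) auto
  then show ?thesis using ln_ge_iff[of 3 "109/100"] by simp
qed

lemma sqrt2_bounds: "14142/10000 \<le> sqrt 2" "sqrt 2 \<le> 14143/10000"
  by (rule real_le_rsqrt, simp add: power_divide, rule real_le_lsqrt, simp_all add: power_divide)

lemma sqrt8_eq: "sqrt 8 = 2 * sqrt 2"
  using real_sqrt_mult[of 4 2] by simp

lemma exp_kappa_U_le: "exp (ln 2 / (sqrt 8 + 1)) \<le> (6/5 :: real)"
proof -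
  \<comment> \<open>16/61 is a rational upper bound of \<open>1 / (sqrt 8 + 1)\<close> that still
    satisfies \<open>2 ^ 16 \<le> (6/5) ^ 61\<close>.\<close>
  have "61 * (ln 2 / (sqrt 8 + 1)) \<le> 16 * (ln 2 :: real)"
  proof -
    have "61 \<le> 16 * (sqrt 8 + 1)" using sqrt2_bounds sqrt8_eq by simp
    then have "61 * ln 2 \<le> 16 * (sqrt 8 + 1) * (ln 2 :: real)" by (intro mult_right_mono) auto
    then show ?thesis by (simp add: pos_divide_le_eq add_pos_pos mult_ac)
  qed
  then have "exp (real 61 * (ln 2 / (sqrt 8 + 1))) \<le> exp (real 16 * ln 2)" by simp
  then have "exp (ln 2 / (sqrt 8 + 1)) ^ 61 \<le> (exp (ln 2) :: real) ^ 16"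
    by (simp only: exp_of_nat_mult)
  also have "\<dots> \<le> (6/5) ^ 61" by (simp add: power_divide)
  finally show ?thesis by (subst (asm) power_mono_iff) auto
qed

text \<open>Validity at \<open>y0\<close> forces \<open>B \<le> k * y0\<close>, so from
  \<open>y0\<close> on the right side grows at least as fast as the left.\<close>

lemma quadratic_ge_mono:
  fixes k :: real
  assumes "A + B * y0 \<le> k * y0\<^sup>2" "0 \<le> A" "0 < y0" "y0 \<le> y" "0 \<le> B" "0 < k"
  shows "A + B * y \<le> k * y\<^sup>2"
proof -
  have "B * y0 \<le> k * y0\<^sup>2" using assms(1,2) by linarith
  then have "y0 * B \<le> y0 * (k * y0)" by (simp only: power2_eq_square mult_ac)
  then have "B \<le> k * y0" by (rule mult_left_le_imp_le) (use assms in simp)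
  also have "\<dots> \<le> k * (y + y0)" using assms by (intro mult_left_mono) auto
  finally have "(y - y0) * B \<le> (y - y0) * (k * (y + y0))" using assms by (intro mult_left_mono) auto
  also have "\<dots> = k * y\<^sup>2 - k * y0\<^sup>2" by (simp add: power2_eq_square algebra_simps)
  finally show ?thesis using assms by (simp add: algebra_simps)
qed

text \<open>Since \<open>(1 + m)/2 \<ge> \<surd>m\<close>, only the boundary value \<open>m = 1\<close> of the parameter has to be checked.\<close>

lemma quadratic_ge_scale:
  fixes m :: real
  assumes m: "0 < m" "m \<le> 1" and W: "(1 + m) / 2 * W1 \<le> W" and W1: "0 < W1"
    and D: "0 \<le> D" "0 \<le> c" and le: "D + c * W1 \<le> W1\<^sup>2"
  shows "0 < W" "m * (D + c * W) \<le> W\<^sup>2"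
proof -
  define y0 where "y0 = sqrt m * W1"
  have y0: "0 < y0" using m(1) W1 by (simp add: y0_def)
  have "sqrt (m * 1) \<le> (m + 1) / 2" by (rule arith_geo_mean_sqrt) (use m in simp_all)
  then have "sqrt m * W1 \<le> (1 + m) / 2 * W1" by (intro mult_right_mono) (use W1 in simp_all)
  then have y0W: "y0 \<le> W" using W unfolding y0_def by (rule order.trans)
  have "m * c * (sqrt m * W1) \<le> m * c * W1"
  proof (rule mult_left_mono)
    show "sqrt m * W1 \<le> W1" using m W1 by (simp add: mult_le_cancel_right1)
  qed (use m D in simp)
  then have "m * D + m * c * y0 \<le> m * (D + c * W1)" by (simp add: y0_def distrib_left mult.assoc)
  also have "\<dots> \<le> m * W1\<^sup>2" using le m(1) by simp
  also have "\<dots> = 1 * y0\<^sup>2" using m(1) by (simp add: y0_def power_mult_distrib)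
  finally have "m * D + m * c * W \<le> 1 * W\<^sup>2"
    by (rule quadratic_ge_mono) (use y0 y0W m D in simp_all)
  then show "m * (D + c * W) \<le> W\<^sup>2" by (simp add: distrib_left mult.assoc)
  show "0 < W" using y0 y0W by simp
qed

text \<open>Lets \<open>\<epsilon>\<close> be replaced by an upper bound and \<open>y\<close> by a
  lower bound. The factor 2 is \<open>1 + exp x0 / 3\<close> at \<open>x0 = ln 3\<close>.\<close>

lemma stein_poly_transfer:
  fixes k :: real
  assumes "2 * eh\<^sup>2 * (62/100 * T + 575/1000 * y0) \<le> k * y0\<^sup>2"
    and "0 \<le> \<epsilon>" "\<epsilon> \<le> eh" "0 < y0" "y0 \<le> y" "0 \<le> T" "0 < k"
  shows "2 * \<epsilon>\<^sup>2 * (62/100 * T + 575/1000 * y) \<le> k * y\<^sup>2"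
proof -
  have "\<epsilon>\<^sup>2 \<le> eh\<^sup>2" using assms by (intro power_mono) auto
  then have "2 * \<epsilon>\<^sup>2 * (62/100 * T + 575/1000 * y0) \<le> 2 * eh\<^sup>2 * (62/100 * T + 575/1000 * y0)"
    using assms by (intro mult_right_mono) auto
  also note assms(1)
  finally have "2 * \<epsilon>\<^sup>2 * (62/100) * T + 2 * \<epsilon>\<^sup>2 * (575/1000) * y0 \<le> k * y0\<^sup>2"
    by (simp only: distrib_left mult.assoc)
  then have "2 * \<epsilon>\<^sup>2 * (62/100) * T + 2 * \<epsilon>\<^sup>2 * (575/1000) * y \<le> k * y\<^sup>2"
    by (rule quadratic_ge_mono) (use assms in auto)
  then show ?thesis by (simp only: distrib_left mult.assoc)
qed

text \<open>The polynomials below are written in the variable \<open>u\<close> measured from the left end point, where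
  their expansion is visibly nonnegative.\<close>

lemma stein_poly_1:
  fixes t u :: real
  assumes "t = 1 + u" "0 \<le> u" "u \<le> 1"
  shows "2 * (3695/10000 + 2613/10000 * t)\<^sup>2 * (62/100 * t\<^sup>2 + 575/1000 * (3693/10000 + 2611/10000 * t + 377/1000)) \<le> t\<^sup>2 * (3693/10000 + 2611/10000 * t + 377/1000)\<^sup>2"
proof -
  have "u\<^sup>2 \<le> 1" using assms by (simp add: power_le_one)
  then have "0 \<le> 37791817421/625000000000 + 205874665803/312500000000 * u + u\<^sup>2 * (5614538328969/10000000000000 + 1276141780243/20000000000000 * u - 20613907/1250000000 * u\<^sup>2)"
    using assms by (intro add_nonneg_nonneg mult_nonneg_nonneg) (auto simp: field_simps)
  also have "\<dots> = t\<^sup>2 * (3693/10000 + 2611/10000 * t + 377/1000)\<^sup>2 - 2 * (3695/10000 + 2613/10000 * t)\<^sup>2 * (62/100 * t\<^sup>2 + 575/1000 * (3693/10000 + 2611/10000 * t + 377/1000))"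
    unfolding assms(1) by (simp add: power2_eq_square field_simps)
  finally show ?thesis by simp
qed

lemma stein_poly_2:
  fixes t u :: real
  assumes "t = 16/10 + u" "0 \<le> u" "u \<le> 1"
  shows "2 * (3695/10000 + 2613/10000 * t)\<^sup>2 * (62/100 * t\<^sup>2 + 575/1000 * (3693/10000 + 2611/10000 * t + 286/1000)) \<le> t\<^sup>2 * (3693/10000 + 2611/10000 * t + 286/1000)\<^sup>2"
proof -
  have "u\<^sup>2 \<le> 1" using assms by (simp add: power_le_one)
  then have "0 \<le> 533169475848421/2500000000000000 + 328589309371401/500000000000000 * u + u\<^sup>2 * (29218846208127/100000000000000 - 465836248557/20000000000000 * u - 20613907/1250000000 * u\<^sup>2)"
    using assms by (intro add_nonneg_nonneg mult_nonneg_nonneg) (auto simp: field_simps)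
  also have "\<dots> = t\<^sup>2 * (3693/10000 + 2611/10000 * t + 286/1000)\<^sup>2 - 2 * (3695/10000 + 2613/10000 * t)\<^sup>2 * (62/100 * t\<^sup>2 + 575/1000 * (3693/10000 + 2611/10000 * t + 286/1000))"
    unfolding assms(1) by (simp add: power2_eq_square field_simps)
  finally show ?thesis by simp
qed

lemma stein_poly_3:
  fixes t u :: real
  assumes "t = 58/100 + u" "0 \<le> u" "u \<le> 1"
  shows "2 * (3695/10000 + 2613/10000 * t)\<^sup>2 * (62/100 * t\<^sup>2 + 575/1000 * (3693/10000 + 2611/10000 * t + 377/1000 - (1 - t\<^sup>2) / 2)) \<le> (3693/10000 + 2611/10000 * t + 377/1000 - (1 - t\<^sup>2) / 2)\<^sup>2"
proof -
  have "u\<^sup>2 \<le> 1" using assms by (simp add: power_le_one)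
  then have "0 \<le> 75840795898438337/2500000000000000000 + 403981073211049/50000000000000000 * u + u\<^sup>2 * (52632136132351/1000000000000000 + 3652342637203/20000000000000 * u + 2521519853/20000000000 * u\<^sup>2)"
    using assms by (intro add_nonneg_nonneg mult_nonneg_nonneg) (auto simp: field_simps)
  also have "\<dots> = (3693/10000 + 2611/10000 * t + 377/1000 - (1 - t\<^sup>2) / 2)\<^sup>2 - 2 * (3695/10000 + 2613/10000 * t)\<^sup>2 * (62/100 * t\<^sup>2 + 575/1000 * (3693/10000 + 2611/10000 * t + 377/1000 - (1 - t\<^sup>2) / 2))"
    unfolding assms(1) by (simp add: power2_eq_square field_simps)
  finally show ?thesis by simp
qed

text \<open>
  In the application \<open>a = \<surd>p\<close>, \<open>b = \<surd>\<mu> z\<close> and \<open>\<kappa> = \<surd>\<mu> e\<close>, all for \<open>\<lambda> = 1\<close>; the equation for \<open>b\<^sup>2\<close> is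
  the definition of \<open>z\<^sup>2\<close> with \<open>v\<close> eliminated by means of \<open>\<mu>\<close>. In terms of \<open>\<tau> = a/b\<close> everything but
  the scale \<open>b\<close> is homogeneous: the Gaussian argument works for large \<open>b\<close>, the Stein argument for
  large \<open>\<tau>\<close> or small \<open>b\<close>.
\<close>

locale critical_shape =
  fixes a b e \<mu> t \<tau> \<epsilon> :: real
  assumes a: "1 \<le> a" and b: "0 < b" and \<mu>: "0 < \<mu>" "\<mu> < 1" and t: "0 < t"
    and b2: "b\<^sup>2 = \<mu> * a\<^sup>2 + 2 * t * (2 - \<mu>)"
    and e: "e = (sqrt 2 * b + a) / (sqrt 8 + 1)"
    and a_eq: "a = \<tau> * b" and e_eq: "e = \<epsilon> * b"
begin

text \<open>Quadratic decay is used up to the radius \<open>\<eta> * z\<close>, linear decay beyond.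
  \<open>\<rho>\<close> is the Markov bound for the mass of the ellipsoid of level
  \<open>(a + sqrt 2 * b)^2\<close> under the tilt \<open>\<eta> * b\<close>. The inequality
  \<open>e \<le> b\<close> yields the slope below that radius and the last one the slope above it;
  the remaining one is the slope hypothesis of \<open>gauss_tail\<close>.\<close>

definition gauss_ok :: bool where
  "gauss_ok \<longleftrightarrow> (\<exists>\<eta> \<rho>. 1 \<le> \<eta> \<and> 1/3 \<le> \<rho> \<and> \<rho> = 1 - (a\<^sup>2 + \<eta>\<^sup>2 * b\<^sup>2) / (a + sqrt 2 * b)\<^sup>2 \<and>
     e \<le> b \<and> exp (- 1 / 2) \<le> \<rho> * b \<and> exp (- 1 / 2) \<le> \<rho> * (\<eta> * b - e))"

text \<open>\<open>b * e + x0 - t\<close> is \<open>\<kappa> * r0\<close>, where \<open>r0\<close>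
  is the point at which the line reaches the level \<open>x0\<close>. The inequality is hypothesis
  \<open>large\<close> of \<open>stein_tail\<close> multiplied by \<open>\<kappa>^2\<close>: 62/100
  is half of 31/25, because \<open>A = p / 2\<close>, and 575/1000 bounds
  \<open>(sqrt 8 + 1) / (10 * ln 2)\<close>.\<close>

definition stein_ok :: "real \<Rightarrow> bool" where
  "stein_ok x0 \<longleftrightarrow> 0 < b * e + x0 - t \<and>
     (1 + exp x0 / 3) * (\<mu> * e\<^sup>2 * (62/100 * a\<^sup>2 + 575/1000 * (b * e + x0 - t))) \<le> (b * e + x0 - t)\<^sup>2"

lemma \<tau>_pos: "0 < \<tau>" using a b zero_less_mult_pos2[of \<tau> b] by (simp add: a_eq)

lemma \<epsilon>_bounds: "3693/10000 + 2611/10000 * \<tau> \<le> \<epsilon>" "\<epsilon> \<le> 3695/10000 + 2613/10000 * \<tau>"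
proof -
  define q where "q = sqrt (2::real)"
  have q: "14142/10000 \<le> q" "q \<le> 14143/10000" using sqrt2_bounds by (auto simp: q_def)
  have "\<epsilon> = (q + \<tau>) / (2 * q + 1)"
  proof -
    have "\<epsilon> * b = (q * b + \<tau> * b) / (2 * q + 1)"
      using e unfolding sqrt8_eq q_def[symmetric] e_eq a_eq .
    also have "\<dots> = (q + \<tau>) / (2 * q + 1) * b" by (simp add: algebra_simps)
    finally show ?thesis using b mult_right_cancel[of b] by blast
  qed
  then have eq: "\<epsilon> * (2 * q + 1) = q + \<tau>" using q by simp
  show "3693/10000 + 2611/10000 * \<tau> \<le> \<epsilon>"
  proof (rule ccontr)
    assume "\<not> ?thesis"
    then have "\<epsilon> * (2 * q + 1) < (3693/10000 + 2611/10000 * \<tau>) * (2 * q + 1)"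
      using q by (intro mult_strict_right_mono) auto
    also have "\<dots> = 3693/10000 * (2 * q + 1) + \<tau> * (2611/10000 * (2 * q + 1))" by (simp add: algebra_simps)
    also have "\<dots> \<le> q + \<tau> * 1" using q \<tau>_pos by (intro add_mono mult_left_mono) auto
    finally show False using eq by simp
  qed
  show "\<epsilon> \<le> 3695/10000 + 2613/10000 * \<tau>"
  proof (rule ccontr)
    assume "\<not> ?thesis"
    then have "(3695/10000 + 2613/10000 * \<tau>) * (2 * q + 1) < \<epsilon> * (2 * q + 1)"
      using q by (intro mult_strict_right_mono) auto
    moreover have "(3695/10000 + 2613/10000 * \<tau>) * (2 * q + 1) = 3695/10000 * (2 * q + 1) + \<tau> * (2613/10000 * (2 * q + 1))" by (simp add: algebra_simps)
    moreover have "q + \<tau> * 1 \<le> 3695/10000 * (2 * q + 1) + \<tau> * (2613/10000 * (2 * q + 1))"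
      using q \<tau>_pos by (intro add_mono mult_left_mono) auto
    ultimately show False using eq by simp
  qed
qed

lemma \<epsilon>_pos: "0 < \<epsilon>" using \<epsilon>_bounds \<tau>_pos by linarith

lemma \<mu>_\<tau>: "\<mu> * \<tau>\<^sup>2 \<le> 1"
proof -
  have "\<mu> * a\<^sup>2 \<le> b\<^sup>2" using b2 t \<mu> by simp
  then have "(\<mu> * \<tau>\<^sup>2) * b\<^sup>2 \<le> 1 * b\<^sup>2" by (simp add: a_eq power_mult_distrib mult_ac)
  then show ?thesis by (rule mult_right_le_imp_le) (use b in simp)
qed

lemma t_eq: "t = b\<^sup>2 * (1 - \<mu> * \<tau>\<^sup>2) / (2 * (2 - \<mu>))"
proof -
  have "2 * t * (2 - \<mu>) = b\<^sup>2 * (1 - \<mu> * \<tau>\<^sup>2)"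
    using b2 by (simp add: a_eq power_mult_distrib algebra_simps)
  then show ?thesis using \<mu> by (simp add: field_simps)
qed

text \<open>In units of \<open>b\<close>, \<open>\<rho>\<close> becomes
  \<open>(2 sqrt 2 \<tau> + 2 - \<eta>^2) / (\<tau> + sqrt 2)^2\<close>. The scale survives only in
  the slope conditions, which improve as \<open>b\<close> grows, hence \<open>bmin\<close>.
  \<open>main\<close> is kept expanded so that a linear bound on \<open>\<tau>^2\<close> reduces it
  to linear arithmetic.\<close>

lemma gauss_okI:
  assumes \<eta>: "1 \<le> \<eta>" "\<eta> - 1 \<le> \<epsilon>" "\<epsilon> \<le> 1"
    and bmin: "0 < bmin" "bmin \<le> b"
    and c: "0 \<le> 2 * 14142/10000 * \<tau> + (2 - \<eta>\<^sup>2)"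
    and \<rho>: "\<tau>\<^sup>2 + 2 \<le> 4 * 14142/10000 * \<tau> + 3 * (2 - \<eta>\<^sup>2)"
    and s: "0 \<le> \<eta> - (3695/10000 + 2613/10000 * \<tau>)"
    and main: "607/1000 * (\<tau>\<^sup>2 + 28286/10000 * \<tau> + 2) \<le>
      bmin * (28284/10000 * (\<eta> - 3695/10000) * \<tau> - 28284/10000 * (2613/10000) * \<tau>\<^sup>2
        + (2 - \<eta>\<^sup>2) * (\<eta> - 3695/10000) - (2 - \<eta>\<^sup>2) * (2613/10000) * \<tau>)"
  shows gauss_ok
proof -
  define q where "q = sqrt (2::real)"
  have q: "14142/10000 \<le> q" "q \<le> 14143/10000" "q\<^sup>2 = 2" using sqrt2_bounds by (auto simp: q_def)
  define \<rho>' where "\<rho>' = 1 - (a\<^sup>2 + \<eta>\<^sup>2 * b\<^sup>2) / (a + q * b)\<^sup>2"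
  define N where "N = \<tau>\<^sup>2 + 2 * q * \<tau> + 2"
  have N: "0 < N" using q \<tau>_pos by (simp add: N_def add_pos_pos)
  have sq: "(a + q * b)\<^sup>2 = b\<^sup>2 * N"
    unfolding a_eq N_def power2_sum power_mult_distrib q(3) by (simp add: algebra_simps power2_eq_square)
  have \<rho>N: "\<rho>' = (2 * q * \<tau> + (2 - \<eta>\<^sup>2)) / N"
  proof -
    have "(a\<^sup>2 + \<eta>\<^sup>2 * b\<^sup>2) / (b\<^sup>2 * N) = (\<tau>\<^sup>2 + \<eta>\<^sup>2) / N"
      using b by (simp add: a_eq power_mult_distrib distrib_right[symmetric] mult.commute[of "b\<^sup>2"])
    then show ?thesis unfolding \<rho>'_def sq using N by (simp add: field_simps N_def)
  qed
  have qt: "14142/10000 * \<tau> \<le> q * \<tau>" "q * \<tau> \<le> 14143/10000 * \<tau>" using q \<tau>_pos by (auto intro!: mult_right_mono)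
  have "N \<le> 3 * (2 * q * \<tau> + (2 - \<eta>\<^sup>2))" proof -
    have lin: "T + 2 * z + 2 \<le> 3 * (2 * z + H)"
      if "T + 2 \<le> 4 * 14142/10000 * \<tau> + 3 * H" "14142/10000 * \<tau> \<le> z" for T z H :: real
      using that by simp
    show ?thesis using lin[OF \<rho> qt(1)] by (simp only: N_def mult.assoc)
  qed
  then have r1: "1/3 \<le> \<rho>'" unfolding \<rho>N using N by (simp add: field_simps)
  have e1: "e \<le> b" using \<eta>(3) b by (simp add: e_eq)
  have low: "\<rho>' * (\<eta> * b - e) \<le> \<rho>' * b"
  proof (rule mult_left_mono)
    have "(\<eta> - \<epsilon>) * b \<le> 1 * b" using \<eta> b by (intro mult_right_mono) auto
    then show "\<eta> * b - e \<le> b" by (simp add: e_eq algebra_simps)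
  qed (use r1 in simp)
  have "exp (- 1 / 2) * N \<le> 607/1000 * N" using exp_minus_half_le N by (intro mult_right_mono) auto
  also have "\<dots> \<le> 607/1000 * (\<tau>\<^sup>2 + 2 * 14143/10000 * \<tau> + 2)" using qt(2) by (simp add: N_def mult.commute)
  also have "\<dots> \<le> (2 * 14142/10000 * \<tau> + (2 - \<eta>\<^sup>2)) * (\<eta> - (3695/10000 + 2613/10000 * \<tau>)) * bmin"
  proof -
    have eq: "bmin * (28284/10000 * (\<eta> - 3695/10000) * \<tau> - 28284/10000 * (2613/10000) * \<tau>\<^sup>2
        + (2 - \<eta>\<^sup>2) * (\<eta> - 3695/10000) - (2 - \<eta>\<^sup>2) * (2613/10000) * \<tau>)
      = (2 * 14142/10000 * \<tau> + (2 - \<eta>\<^sup>2)) * (\<eta> - (3695/10000 + 2613/10000 * \<tau>)) * bmin"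
      by (simp add: field_simps power2_eq_square)
    show ?thesis using main unfolding eq by simp
  qed
  also have "(2 * 14142/10000 * \<tau> + (2 - \<eta>\<^sup>2)) * (\<eta> - (3695/10000 + 2613/10000 * \<tau>)) * bmin \<le>
    (2 * q * \<tau> + (2 - \<eta>\<^sup>2)) * (\<eta> - \<epsilon>) * b"
    using c s qt \<epsilon>_bounds bmin by (intro mult_mono mult_nonneg_nonneg) auto
  finally have "exp (- 1 / 2) \<le> (2 * q * \<tau> + (2 - \<eta>\<^sup>2)) * (\<eta> - \<epsilon>) * b / N"
    using N by (simp add: pos_le_divide_eq)
  also have "\<dots> = \<rho>' * (\<eta> * b - e)" unfolding \<rho>N by (simp add: e_eq algebra_simps)
  finally have "exp (- 1 / 2) \<le> \<rho>' * (\<eta> * b - e)" .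
  note facts = this low r1 e1 \<eta>(1)
  show ?thesis
    unfolding gauss_ok_def
    by (rule exI[of _ \<eta>], rule exI[of _ \<rho>']) (use facts in \<open>simp add: \<rho>'_def q_def\<close>)
qed

text \<open>The scaling parameter is \<open>m = \<mu> * \<tau>^2\<close>, where \<open>m = 1\<close>
  means \<open>t = 0\<close> and the value \<open>W1\<close>. Hypothesis \<open>c\<close> keeps the
  actual value above \<open>(1 + m) / 2 * W1\<close>, as \<open>quadratic_ge_scale\<close> requires.
  \<open>X\<close> bounds \<open>x0 / b^2\<close> from below and makes \<open>main\<close> free of
  the scale \<open>b\<close>.\<close>

lemma stein_okI_large:
  assumes x0: "0 \<le> X" "X * b\<^sup>2 \<le> x0"
    and h: "h = 1 + exp x0 / 3"
    and c: "1 \<le> (\<epsilon> + X) * (2 - \<mu>)"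
    and main: "h * \<epsilon>\<^sup>2 * (62/100 * \<tau>\<^sup>2 + 575/1000 * (\<epsilon> + X)) \<le> \<tau>\<^sup>2 * (\<epsilon> + X)\<^sup>2"
  shows "stein_ok x0"
proof -
  define W1 where "W1 = b * e + x0"
  define y where "y = W1 / b\<^sup>2"
  define m where "m = \<mu> * \<tau>\<^sup>2"
  have h0: "0 < h" unfolding h by (simp add: add_pos_pos)
  have W1y: "W1 = b\<^sup>2 * y" using b by (simp add: y_def)
  have y: "\<epsilon> + X \<le> y"
    using x0 b by (simp add: y_def W1_def e_eq field_simps power2_eq_square)
  have y0: "0 < \<epsilon> + X" using \<epsilon>_pos x0 by simp
  then have W1: "0 < W1" using y b by (simp add: W1y)
  have m: "0 < m" "m \<le> 1" using \<mu> \<tau>_pos \<mu>_\<tau> by (auto simp: m_def)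
  have tb: "t = b\<^sup>2 * (1 - m) / (2 * (2 - \<mu>))" unfolding m_def by (rule t_eq)
  have W: "(1 + m) / 2 * W1 \<le> b * e + x0 - t"
  proof -
    have "1 \<le> y * (2 - \<mu>)"
    proof -
      have "(\<epsilon> + X) * (2 - \<mu>) \<le> y * (2 - \<mu>)" using y \<mu> by (intro mult_right_mono) auto
      with c show ?thesis by simp
    qed
    then have "(b\<^sup>2 * (1 - m)) * 1 \<le> (b\<^sup>2 * (1 - m)) * (y * (2 - \<mu>))"
      using m by (intro mult_left_mono) auto
    then have "t \<le> (1 - m) / 2 * W1" unfolding tb W1y using \<mu> by (simp add: field_simps)
    then show ?thesis by (simp add: W1_def field_simps)
  qed
  have main': "h * \<epsilon>\<^sup>2 * (62/100 * \<tau>\<^sup>2) + h * \<epsilon>\<^sup>2 * (575/1000) * y \<le> \<tau>\<^sup>2 * y\<^sup>2"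
  proof (rule quadratic_ge_mono[OF _ _ y0 y])
    show "h * \<epsilon>\<^sup>2 * (62/100 * \<tau>\<^sup>2) + h * \<epsilon>\<^sup>2 * (575/1000) * (\<epsilon> + X) \<le> \<tau>\<^sup>2 * (\<epsilon> + X)\<^sup>2"
      using main by (simp add: algebra_simps)
  qed (use h0 \<tau>_pos in auto)
  have "h * (62/100) * b\<^sup>2 * e\<^sup>2 + (h * (575/1000) * e\<^sup>2 / \<tau>\<^sup>2) * W1 \<le> W1\<^sup>2"
  proof -
    have "h * (62/100) * b\<^sup>2 * e\<^sup>2 + (h * (575/1000) * e\<^sup>2 / \<tau>\<^sup>2) * W1
       = b ^ 4 / \<tau>\<^sup>2 * (h * \<epsilon>\<^sup>2 * (62/100 * \<tau>\<^sup>2) + h * \<epsilon>\<^sup>2 * (575/1000) * y)"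
      unfolding W1y e_eq using \<tau>_pos by (simp add: field_simps power2_eq_square power4_eq_xxxx)
    also have "\<dots> \<le> b ^ 4 / \<tau>\<^sup>2 * (\<tau>\<^sup>2 * y\<^sup>2)" using main' by (intro mult_left_mono) auto
    also have "\<dots> = W1\<^sup>2" unfolding W1y using \<tau>_pos by (simp add: power_mult_distrib)
    finally show ?thesis .
  qed
  from quadratic_ge_scale[OF m W W1 _ _ this] h0
  have 1: "0 < b * e + x0 - t"
    and 2: "m * (h * (62/100) * b\<^sup>2 * e\<^sup>2 + (h * (575/1000) * e\<^sup>2 / \<tau>\<^sup>2) * (b * e + x0 - t)) \<le> (b * e + x0 - t)\<^sup>2"
    by auto
  have "m * (h * (62/100) * b\<^sup>2 * e\<^sup>2 + (h * (575/1000) * e\<^sup>2 / \<tau>\<^sup>2) * Z) =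
    h * (\<mu> * e\<^sup>2 * (62/100 * a\<^sup>2 + 575/1000 * Z))" for Z
    using \<tau>_pos by (simp add: m_def a_eq power_mult_distrib algebra_simps)
  with 1 2 show ?thesis unfolding stein_ok_def h by simp
qed

text \<open>For \<open>\<tau> \<le> 1\<close> the constraint \<open>\<mu> < 1\<close> is stronger
  than \<open>\<mu> * \<tau>^2 \<le> 1\<close>, so \<open>\<mu>\<close> itself is the scaling
  parameter; \<open>W1\<close> belongs to the boundary \<open>\<mu> = 1\<close>, where
  \<open>t = b^2 (1 - \<tau>^2) / 2\<close>.\<close>

lemma stein_okI_small:
  assumes \<tau>1: "\<tau> \<le> 1"
    and x0: "377/1000 \<le> X" "X * b\<^sup>2 \<le> x0"
    and h: "h = 1 + exp x0 / 3"
    and y0: "0 < \<epsilon> + X - (1 - \<tau>\<^sup>2) / 2"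
    and main: "h * \<epsilon>\<^sup>2 * (62/100 * \<tau>\<^sup>2 + 575/1000 * (\<epsilon> + X - (1 - \<tau>\<^sup>2) / 2)) \<le> (\<epsilon> + X - (1 - \<tau>\<^sup>2) / 2)\<^sup>2"
  shows "stein_ok x0"
proof -
  define W1 where "W1 = b * e + x0 - b\<^sup>2 * ((1 - \<tau>\<^sup>2) / 2)"
  define y where "y = W1 / b\<^sup>2"
  have h0: "0 < h" unfolding h by (simp add: add_pos_pos)
  have W1y: "W1 = b\<^sup>2 * y" using b by (simp add: y_def)
  have y: "\<epsilon> + X - (1 - \<tau>\<^sup>2) / 2 \<le> y"
    using x0 b by (simp add: y_def W1_def e_eq field_simps power2_eq_square)
  with y0 have "0 < y" by (rule less_le_trans)
  then have W1: "0 < W1" using b by (simp add: W1y)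
  have W: "(1 + \<mu>) / 2 * W1 \<le> b * e + x0 - t"
  proof -
    define Y where "Y = y + (1 - \<tau>\<^sup>2) / 2"
    have Y: "\<epsilon> + X \<le> Y" using y by (simp add: Y_def)
    have t2: "\<tau>\<^sup>2 \<le> 1" using \<tau>1 \<tau>_pos by (simp add: power_le_one)
    have "\<tau>\<^sup>2 \<le> \<tau>" using \<tau>1 \<tau>_pos by (simp add: power2_eq_square mult_left_le_one_le)
    \<comment> \<open>The comparison needed for \<open>W\<close> has a common factor
      \<open>1 - \<mu>\<close>; the rest is affine in \<open>\<mu>\<close>, and these two
      inequalities are its end points 1 and 0.\<close>
    then have k: "3 * \<tau>\<^sup>2 - 1 \<le> 2 * Y" "\<tau>\<^sup>2 \<le> 2 * Y" using Y \<epsilon>_bounds x0 t2 \<tau>1 by linarith+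
    have "\<tau>\<^sup>2 * (2 + \<mu>) - \<mu> \<le> 2 * Y * (2 - \<mu>)"
    proof -
      have "(1 - \<mu>) * (2 * \<tau>\<^sup>2) + \<mu> * (3 * \<tau>\<^sup>2 - 1) \<le> (1 - \<mu>) * (2 * (2 * Y)) + \<mu> * (2 * Y)"
        using k \<mu> by (intro add_mono mult_left_mono) auto
      then show ?thesis by (simp add: algebra_simps)
    qed
    then have "(1 - \<mu>) * (\<tau>\<^sup>2 * (2 + \<mu>) - \<mu>) \<le> (1 - \<mu>) * (2 * Y * (2 - \<mu>))"
      using \<mu> by (intro mult_left_mono) auto
    then have le: "(1 - \<mu> * \<tau>\<^sup>2) / (2 * (2 - \<mu>)) \<le> (1 - \<mu>) / 2 * Y + (1 + \<mu>) / 2 * ((1 - \<tau>\<^sup>2) / 2)"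
      using \<mu> by (simp add: field_simps)
    have "(1 + \<mu>) / 2 * y \<le> Y - Z"
      if "Z \<le> (1 - \<mu>) / 2 * Y + (1 + \<mu>) / 2 * ((1 - \<tau>\<^sup>2) / 2)" for Z
      using that by (simp add: Y_def field_simps)
    from this[OF le] have "b\<^sup>2 * ((1 + \<mu>) / 2 * y) \<le> b\<^sup>2 * (Y - (1 - \<mu> * \<tau>\<^sup>2) / (2 * (2 - \<mu>)))"
      by (rule mult_left_mono) simp
    moreover have "b\<^sup>2 * Y = b * e + x0" using b by (simp add: Y_def y_def W1_def field_simps)
    ultimately show ?thesis unfolding W1y t_eq by (simp add: algebra_simps)
  qed
  have main': "h * \<epsilon>\<^sup>2 * (62/100 * \<tau>\<^sup>2) + h * \<epsilon>\<^sup>2 * (575/1000) * y \<le> 1 * y\<^sup>2"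
  proof (rule quadratic_ge_mono[OF _ _ y0 y])
    show "h * \<epsilon>\<^sup>2 * (62/100 * \<tau>\<^sup>2) + h * \<epsilon>\<^sup>2 * (575/1000) * (\<epsilon> + X - (1 - \<tau>\<^sup>2) / 2) \<le> 1 * (\<epsilon> + X - (1 - \<tau>\<^sup>2) / 2)\<^sup>2"
      using main by (simp only: distrib_left mult.assoc mult_1_left)
  qed (use h0 in auto)
  have "h * (62/100) * a\<^sup>2 * e\<^sup>2 + (h * (575/1000) * e\<^sup>2) * W1 \<le> W1\<^sup>2"
  proof -
    have "h * (62/100) * a\<^sup>2 * e\<^sup>2 + (h * (575/1000) * e\<^sup>2) * W1
       = b ^ 4 * (h * \<epsilon>\<^sup>2 * (62/100 * \<tau>\<^sup>2) + h * \<epsilon>\<^sup>2 * (575/1000) * y)"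
      unfolding W1y e_eq a_eq by (simp add: field_simps power2_eq_square power4_eq_xxxx)
    also have "\<dots> \<le> b ^ 4 * (1 * y\<^sup>2)" using main' by (intro mult_left_mono) auto
    also have "\<dots> = W1\<^sup>2" unfolding W1y by (simp add: power_mult_distrib)
    finally show ?thesis .
  qed
  from quadratic_ge_scale[OF \<mu>(1) less_imp_le[OF \<mu>(2)] W W1 _ _ this] h0
  have 1: "0 < b * e + x0 - t"
    and 2: "\<mu> * (h * (62/100) * a\<^sup>2 * e\<^sup>2 + (h * (575/1000) * e\<^sup>2) * (b * e + x0 - t)) \<le> (b * e + x0 - t)\<^sup>2"
    by auto
  have eq: "\<mu> * (h * (62/100) * a\<^sup>2 * e\<^sup>2 + (h * (575/1000) * e\<^sup>2) * Z) =
    h * (\<mu> * e\<^sup>2 * (62/100 * a\<^sup>2 + 575/1000 * Z))" for Z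
    by (simp add: algebra_simps)
  show ?thesis using 1 2 unfolding eq unfolding stein_ok_def h by (rule conjI)
qed

text \<open>For \<open>\<tau> \<ge> 2\<close> Stein with \<open>x0 = 0\<close> works at every scale.
  For \<open>\<tau>\<close> between 1/2 and 2 a threshold on \<open>b\<close> separates the Gaussian
  case from Stein with \<open>x0 = ln 3\<close>, whose relative gain \<open>x0 / b^2\<close> is
  large for small \<open>b\<close>. For \<open>\<tau> \<le> 1/2\<close>,
  \<open>1 \<le> \<tau> * b\<close> forces \<open>b \<ge> 2\<close> and the Gaussian case
  applies.\<close>

lemma gauss_or_stein: "gauss_ok \<or> stein_ok 0 \<or> stein_ok (ln 3)"
proof -
  have ab: "1 \<le> \<tau> * b" using a by (simp add: a_eq)
  consider "2 \<le> \<tau>" | "16/10 \<le> \<tau>" "\<tau> \<le> 2" | "1 \<le> \<tau>" "\<tau> \<le> 16/10" | "1/2 \<le> \<tau>" "\<tau> \<le> 1" | "\<tau> \<le> 1/2"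
    by linarith
  then show ?thesis
  proof cases
    case 1
    have "2 * \<tau> \<le> \<tau> * \<tau>" using 1 by (intro mult_right_mono) auto
    then have t2: "2 * \<tau> \<le> \<tau>\<^sup>2" by (simp add: power2_eq_square)
    then have "4 \<le> \<tau>\<^sup>2" using 1 by linarith
    note t2 = t2 this
    have "\<mu> * 4 \<le> \<mu> * \<tau>\<^sup>2" using t2 \<mu> by (intro mult_left_mono) auto
    then have \<mu>4: "\<mu> \<le> 1/4" using \<mu>_\<tau> by linarith
    have "stein_ok 0"
    proof (rule stein_okI_large[where X = 0 and h = "4/3"])
      have "1 \<le> (89/100) * (7/4 :: real)" by simp
      also have "\<dots> \<le> (\<epsilon> + 0) * (2 - \<mu>)" using \<mu>4 \<epsilon>_bounds 1 by (intro mult_mono) auto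
      finally show "1 \<le> (\<epsilon> + 0) * (2 - \<mu>)" .
      have "4/3 * (62/100 * \<tau>\<^sup>2 + 575/1000 * (\<epsilon> + 0)) \<le> \<tau>\<^sup>2" using \<epsilon>_bounds t2 1 by simp
      then have "\<epsilon>\<^sup>2 * (4/3 * (62/100 * \<tau>\<^sup>2 + 575/1000 * (\<epsilon> + 0))) \<le> \<epsilon>\<^sup>2 * \<tau>\<^sup>2" by (intro mult_left_mono) auto
      then show "4/3 * \<epsilon>\<^sup>2 * (62/100 * \<tau>\<^sup>2 + 575/1000 * (\<epsilon> + 0)) \<le> \<tau>\<^sup>2 * (\<epsilon> + 0)\<^sup>2"
        by (simp only: mult_ac add_0_right)
    qed auto
    then show ?thesis by blast
  next
    case 2
    have "0 \<le> (\<tau> - 16/10) * (2 - \<tau>)" using 2 by (intro mult_nonneg_nonneg) auto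
    \<comment> \<open>The chord of the square over the current interval of \<open>\<tau>\<close>; it
      linearises \<open>main\<close> of \<open>gauss_okI\<close>. The other cases do the
      same.\<close>
    then have p: "\<tau>\<^sup>2 \<le> (16/10 + 2) * \<tau> - 16/10 * (2)" by (simp add: power2_eq_square field_simps)
    show ?thesis
    proof (cases "195/100 \<le> b")
      case True
      have gauss_ok
        by (rule gauss_okI[where \<eta> = "165/100" and bmin = "195/100"])
           (use True 2 p \<epsilon>_bounds in \<open>simp_all add: power_divide\<close>)
      then show ?thesis by blast
    next
      case False
      have "b\<^sup>2 \<le> (195/100)\<^sup>2" using False b by (intro power_mono) auto
      \<comment> \<open>286/1000 is just below \<open>(109/100) / (195/100)^2\<close>; in the same
        way 377/1000 belongs to the threshold 17/10.\<close>
      then have b2': "286/1000 * b\<^sup>2 \<le> ln 3" using ln3_ge by (simp add: power_divide)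
      have "stein_ok (ln 3)"
      proof (rule stein_okI_large[where X = "286/1000" and h = 2, OF _ b2'])
        have "1 \<le> (1 :: real) * 1" by simp
        also have "\<dots> \<le> (\<epsilon> + 286/1000) * (2 - \<mu>)" using \<mu> \<epsilon>_bounds 2 by (intro mult_mono) auto
        finally show "1 \<le> (\<epsilon> + 286/1000) * (2 - \<mu>)" by simp
        show "2 * \<epsilon>\<^sup>2 * (62/100 * \<tau>\<^sup>2 + 575/1000 * (\<epsilon> + 286/1000)) \<le> \<tau>\<^sup>2 * (\<epsilon> + 286/1000)\<^sup>2"
          by (rule stein_poly_transfer[OF stein_poly_2[of \<tau> "\<tau> - 16/10"]])
             (use 2 \<epsilon>_bounds \<epsilon>_pos in auto)
      qed auto
      then show ?thesis by blast
    qed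
  next
    case 3
    have "0 \<le> (\<tau> - 1) * (16/10 - \<tau>)" using 3 by (intro mult_nonneg_nonneg) auto
    then have p: "\<tau>\<^sup>2 \<le> (1 + 16/10) * \<tau> - 1 * (16/10)" by (simp add: power2_eq_square field_simps)
    show ?thesis
    proof (cases "17/10 \<le> b")
      case True
      have gauss_ok
        by (rule gauss_okI[where \<eta> = "163/100" and bmin = "17/10"])
           (use True 3 p \<epsilon>_bounds in \<open>simp_all add: power_divide\<close>)
      then show ?thesis by blast
    next
      case False
      have "b\<^sup>2 \<le> (17/10)\<^sup>2" using False b by (intro power_mono) auto
      then have b2': "377/1000 * b\<^sup>2 \<le> ln 3" using ln3_ge by (simp add: power_divide)
      have "stein_ok (ln 3)"
      proof (rule stein_okI_large[where X = "377/1000" and h = 2, OF _ b2'])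
        have "1 \<le> (1 :: real) * 1" by simp
        also have "\<dots> \<le> (\<epsilon> + 377/1000) * (2 - \<mu>)" using \<mu> \<epsilon>_bounds 3 by (intro mult_mono) auto
        finally show "1 \<le> (\<epsilon> + 377/1000) * (2 - \<mu>)" by simp
        show "2 * \<epsilon>\<^sup>2 * (62/100 * \<tau>\<^sup>2 + 575/1000 * (\<epsilon> + 377/1000)) \<le> \<tau>\<^sup>2 * (\<epsilon> + 377/1000)\<^sup>2"
          by (rule stein_poly_transfer[OF stein_poly_1[of \<tau> "\<tau> - 1"]])
             (use 3 \<epsilon>_bounds \<epsilon>_pos in auto)
      qed auto
      then show ?thesis by blast
    qed
  next
    case 4
    have "0 \<le> (\<tau> - 1/2) * (1 - \<tau>)" using 4 by (intro mult_nonneg_nonneg) auto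
    then have p: "\<tau>\<^sup>2 \<le> (1/2 + 1) * \<tau> - 1/2 * (1)" by (simp add: power2_eq_square field_simps)
    show ?thesis
    proof (cases "17/10 \<le> b")
      case True
      have gauss_ok
        by (rule gauss_okI[where \<eta> = "13/10" and bmin = "17/10"])
           (use True 4 p \<epsilon>_bounds in \<open>simp_all add: power_divide\<close>)
      then show ?thesis by blast
    next
      case False
      have "\<tau> * b \<le> \<tau> * (17/10)" using False \<tau>_pos by (intro mult_left_mono) auto
      \<comment> \<open>The reciprocal of 17/10 exceeds 58/100, the left end point of
        \<open>stein_poly_3\<close>.\<close>
      then have \<tau>': "58/100 \<le> \<tau>" using ab by linarith
      then have t2: "(58/100)\<^sup>2 \<le> \<tau>\<^sup>2" by (intro power_mono) auto
      have "b\<^sup>2 \<le> (17/10)\<^sup>2" using False b by (intro power_mono) auto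
      then have b2': "377/1000 * b\<^sup>2 \<le> ln 3" using ln3_ge by (simp add: power_divide)
      have "stein_ok (ln 3)"
      proof (rule stein_okI_small[where X = "377/1000" and h = 2, OF 4(2) _ b2'])
        show "0 < \<epsilon> + 377/1000 - (1 - \<tau>\<^sup>2) / 2" using \<epsilon>_bounds \<tau>' t2 by (simp add: power_divide)
        show "2 * \<epsilon>\<^sup>2 * (62/100 * \<tau>\<^sup>2 + 575/1000 * (\<epsilon> + 377/1000 - (1 - \<tau>\<^sup>2) / 2)) \<le> (\<epsilon> + 377/1000 - (1 - \<tau>\<^sup>2) / 2)\<^sup>2"
        proof -
          define y0 where "y0 = 3693/10000 + 2611/10000 * \<tau> + 377/1000 - (1 - \<tau>\<^sup>2) / 2"
          have "2 * (3695/10000 + 2613/10000 * \<tau>)\<^sup>2 * (62/100 * \<tau>\<^sup>2 + 575/1000 * y0) \<le> 1 * y0\<^sup>2"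
            unfolding mult_1_left y0_def
            by (rule stein_poly_3[of \<tau> "\<tau> - 58/100"]) (use 4 \<tau>' in simp_all)
          moreover have "0 < y0" using \<tau>' t2 by (simp add: y0_def power_divide)
          moreover have "y0 \<le> \<epsilon> + 377/1000 - (1 - \<tau>\<^sup>2) / 2" using \<epsilon>_bounds by (simp add: y0_def)
          ultimately show ?thesis
            using stein_poly_transfer[of "3695/10000 + 2613/10000 * \<tau>" "\<tau>\<^sup>2" y0 1 \<epsilon> "\<epsilon> + 377/1000 - (1 - \<tau>\<^sup>2) / 2"]
              \<epsilon>_bounds \<epsilon>_pos unfolding mult_1_left by (meson less_imp_le zero_le_power2 zero_less_one)
        qed
      qed auto
      then show ?thesis by blast
    qed
  next
    case 5
    have "\<tau> * b \<le> 1/2 * b" using 5 b by (intro mult_right_mono) auto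
    then have b2': "2 \<le> b" using ab by linarith
    have gauss_ok
    proof (cases "3 \<le> b")
      case True
      have "0 \<le> \<tau> * (1/2 - \<tau>)" using 5 \<tau>_pos by (intro mult_nonneg_nonneg) auto
      then have p: "\<tau>\<^sup>2 \<le> 1/2 * \<tau>" by (simp add: power2_eq_square field_simps)
      show ?thesis
        by (rule gauss_okI[where \<eta> = "115/100" and bmin = 3])
           (use True 5 p \<epsilon>_bounds \<tau>_pos in \<open>simp_all add: power_divide\<close>)
    next
      case False
      have "\<tau> * b \<le> \<tau> * 3" using False \<tau>_pos by (intro mult_left_mono) auto
      then have \<tau>': "1/3 \<le> \<tau>" using ab by linarith
      have "0 \<le> (\<tau> - 1/3) * (1/2 - \<tau>)" using 5 \<tau>' by (intro mult_nonneg_nonneg) auto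
      then have p: "\<tau>\<^sup>2 \<le> (1/3 + 1/2) * \<tau> - 1/3 * (1/2)" by (simp add: power2_eq_square field_simps)
      show ?thesis
        by (rule gauss_okI[where \<eta> = "115/100" and bmin = 2])
           (use b2' 5 p \<epsilon>_bounds \<tau>' in \<open>simp_all add: power_divide\<close>)
    qed
    then show ?thesis by blast
  qed
qed

end

subsection \<open>The tail bound for normalised sums\<close>

lemma exp_le_quadratic:
  fixes x :: real
  assumes "\<bar>x\<bar> \<le> 1"
  shows "exp x \<le> 1 + x + x\<^sup>2"
proof (cases "0 \<le> x")
  case True
  then show ?thesis using assms by (intro exp_bound) auto
next
  case False
  define y where "y = - x"
  have y: "0 < y" using False by (simp add: y_def)
  have "exp x = inverse (exp y)" by (simp add: y_def exp_minus)
  also have "\<dots> \<le> inverse (1 + y)"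
    by (rule le_imp_inverse_le) (use y exp_ge_add_one_self[of y] in simp_all)
  also have "\<dots> = 1 / (1 + y)" by (rule inverse_eq_divide)
  also have "\<dots> \<le> 1 - y + y\<^sup>2"
  proof (rule mult_imp_div_pos_le)
    have "(1 - y + y\<^sup>2) * (1 + y) = 1 + y ^ 3"
      by (simp add: power2_eq_square power3_eq_cube algebra_simps)
    then show "1 \<le> (1 - y + y\<^sup>2) * (1 + y)" using y by simp
  qed (use y in simp)
  finally show ?thesis by (simp add: y_def)
qed

text \<open>The exponent is twice the Gaussian one with the same variance; the factor 2 in the
  condition on \<open>V2\<close> pays for it. The linear terms of the quadratic bounds cancel in the
  mean.\<close>

lemma bernoulli_mgf_le:
  fixes p t :: real
  assumes p: "0 \<le> p" "p \<le> 1" and t: "\<bar>t\<bar> \<le> 1"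
  shows "p * exp ((1 - p) * t) + (1 - p) * exp (- p * t) \<le> exp (p * (1 - p) * t\<^sup>2)"
proof -
  have 1: "\<bar>(1 - p) * t\<bar> \<le> 1" "\<bar>- p * t\<bar> \<le> 1"
    using p t by (auto simp: abs_mult intro!: mult_le_one)
  have "p * exp ((1 - p) * t) + (1 - p) * exp (- p * t)
      \<le> p * (1 + (1 - p) * t + ((1 - p) * t)\<^sup>2) + (1 - p) * (1 + - p * t + (- p * t)\<^sup>2)"
    using p exp_le_quadratic[OF 1(1)] exp_le_quadratic[OF 1(2)] by (intro add_mono mult_left_mono) auto
  also have "\<dots> = 1 + p * (1 - p) * t\<^sup>2"
    by (simp add: power2_eq_square algebra_simps)
  also have "\<dots> \<le> exp (p * (1 - p) * t\<^sup>2)" by (rule exp_ge_add_one_self)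
  finally show ?thesis .
qed

lemma bern_expect_exp_le:
  fixes a :: "'n::finite \<Rightarrow> real"
  assumes \<theta>: "\<And>i. 0 \<le> \<theta> i \<and> \<theta> i \<le> 1" and a: "\<And>i. \<bar>a i\<bar> \<le> 1"
  shows "bern_expect \<theta> (\<lambda>b. exp (\<Sum>i\<in>UNIV. (of_bool (b i) - \<theta> i) * a i))
    \<le> exp (\<Sum>i\<in>UNIV. \<theta> i * (1 - \<theta> i) * (a i)\<^sup>2)"
proof -
  have "bern_expect \<theta> (\<lambda>b. exp (\<Sum>i\<in>UNIV. (of_bool (b i) - \<theta> i) * a i))
    = bern_expect \<theta> (\<lambda>b. \<Prod>i\<in>UNIV. (\<lambda>i c. exp ((of_bool c - \<theta> i) * a i)) i (b i))"
    by (simp add: exp_sum)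
  also have "\<dots> = (\<Prod>i\<in>UNIV. \<theta> i * exp ((1 - \<theta> i) * a i) + (1 - \<theta> i) * exp (- \<theta> i * a i))"
    by (subst bern_expect_prod) simp
  also have "\<dots> \<le> (\<Prod>i\<in>UNIV. exp (\<theta> i * (1 - \<theta> i) * (a i)\<^sup>2))"
    using \<theta> a by (intro prod_mono conjI bernoulli_mgf_le add_nonneg_nonneg mult_nonneg_nonneg) auto
  finally show ?thesis by (simp add: exp_sum)
qed

text \<open>The problem with lambda = 1 in eigencoordinates: \<open>cov\<close> and
  \<open>size\<close> are the variance and jump conditions for the direction with coordinates
  \<open>u\<close>. \<open>gt\<close> is the value of \<open>g\<close> for which \<open>t\<close>
  would be critical, and the radius lies on the line through \<open>(t, z)\<close>.\<close>

lemma bern_sum_tail: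
  fixes \<theta> :: "'n::finite \<Rightarrow> real" and \<psi> :: "'n \<Rightarrow> 'v::real_inner" and l :: "'v \<Rightarrow> real"
  assumes \<theta>: "\<And>i. 0 \<le> \<theta> i \<and> \<theta> i \<le> 1"
    and E: "finite E" and parseval: "\<And>x y. x \<bullet> y = (\<Sum>v\<in>E. (x \<bullet> v) * (y \<bullet> v))"
    and l: "\<And>v. v \<in> E \<Longrightarrow> 0 \<le> l v \<and> l v \<le> 1"
    and p: "p = (\<Sum>v\<in>E. l v)" "1 \<le> p" and w: "w = sqrt (\<Sum>v\<in>E. (l v)\<^sup>2)"
    and cov: "\<And>u. (\<Sum>i\<in>UNIV. \<theta> i * (1 - \<theta> i) * (\<Sum>v\<in>E. u v * (\<psi> i \<bullet> v))\<^sup>2) \<le> (\<Sum>v\<in>E. l v * (u v)\<^sup>2) / 2"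
    and size: "\<And>u i. (\<Sum>v\<in>E. u v * (\<psi> i \<bullet> v))\<^sup>2 \<le> (ln 2 / g)\<^sup>2 * (\<Sum>v\<in>E. l v * (u v)\<^sup>2)"
    and t: "0 < t" and \<mu>: "\<mu> = inverse (1 + w / (2 * sqrt t))"
    and z: "z = sqrt (p + 2 * w * sqrt t + 2 * t)"
    and gt: "gt = sqrt 2 * \<mu> * z + sqrt (\<mu> * p)" "gt \<le> g"
    and x: "t \<le> x" "ln 3 \<le> x"
  shows "bern_expect \<theta> (\<lambda>b. of_bool (z + (x - t) / (gt / (sqrt 8 + 1)) \<le> norm (bern_sum \<theta> \<psi> b))) \<le> 3 * exp (- x)"
proof -
  define s where "s = sqrt t"
  have s: "0 < s" "t = s\<^sup>2" using t by (auto simp: s_def)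
  have w0: "0 < w"
  proof -
    have "\<exists>v\<in>E. l v \<noteq> 0"
    proof (rule ccontr)
      assume "\<not> ?thesis"
      then have "(\<Sum>v\<in>E. l v) = 0" by simp
      with p show False by simp
    qed
    then have "0 < (\<Sum>v\<in>E. (l v)\<^sup>2)" using E by (auto intro!: sum_pos2)
    then show ?thesis by (simp add: w)
  qed
  define D where "D = 1 + w / (2 * s)"
  have D: "1 < D" using w0 s by (simp add: D_def)
  have \<mu>D: "\<mu> = 1 / D" by (simp add: \<mu> D_def s_def inverse_eq_divide)
  have \<mu>01: "0 < \<mu>" "\<mu> < 1" using D by (auto simp: \<mu>D)
  have key: "t * (1 - \<mu>) = \<mu> * w * s / 2"
  proof -
    have "1 - \<mu> = \<mu> * (D - 1)" using D by (simp add: \<mu>D right_diff_distrib)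
    also have "\<dots> = \<mu> * (w / (2 * s))" by (simp add: D_def)
    finally have "1 - \<mu> = \<mu> * (w / (2 * s))" .
    then have "t * (1 - \<mu>) = t * (\<mu> * (w / (2 * s)))" by (rule arg_cong)
    also have "\<dots> = \<mu> * w * s / 2" using s by (simp add: power2_eq_square)
    finally show ?thesis .
  qed
  have zpos: "0 < p + 2 * w * s + 2 * t" using p(2) w0 s(1) t by (intro add_pos_pos mult_pos_pos) auto
  have z2: "z\<^sup>2 = p + 2 * w * s + 2 * t" and z0: "0 < z"
    using zpos unfolding z s_def by simp_all
  define a where "a = sqrt p"
  define b where "b = sqrt \<mu> * z"
  define e where "e = (sqrt 2 * b + a) / (sqrt 8 + 1)"
  have a2: "a\<^sup>2 = p" using p by (simp add: a_def)
  have b0: "0 < b" using \<mu>01 z0 by (simp add: b_def)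
  have bz2: "b\<^sup>2 = \<mu> * z\<^sup>2" using \<mu>01 by (simp add: b_def power_mult_distrib)
  interpret critical_shape a b e \<mu> t "a / b" "e / b"
  proof
    show "1 \<le> a" using p by (simp add: a_def)
    show "b\<^sup>2 = \<mu> * a\<^sup>2 + 2 * t * (2 - \<mu>)"
    proof -
      have "\<mu> * (p + 2 * w * s + 2 * t) - (\<mu> * p + 2 * t * (2 - \<mu>)) = 4 * (\<mu> * w * s / 2 - t * (1 - \<mu>))"
        by (simp add: algebra_simps)
      then show ?thesis unfolding bz2 a2 z2 key by simp
    qed
  qed (use \<mu>01 t b0 in \<open>auto simp: e_def\<close>)
  have gtb: "gt = sqrt \<mu> * (sqrt 2 * b + a)"
    using \<mu>01 p by (simp add: gt a_def b_def real_sqrt_mult algebra_simps)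
  define \<kappa> where "\<kappa> = gt / (sqrt 8 + 1)"
  have \<kappa>e: "\<kappa> = sqrt \<mu> * e" by (simp add: \<kappa>_def gtb e_def)
  have e0: "0 < e" using a b0 by (auto simp: e_def intro!: divide_pos_pos add_pos_pos)
  have \<kappa>0: "0 < \<kappa>" using e0 \<mu>01 by (simp add: \<kappa>e)
  have gt0: "0 < gt" using a b0 \<mu>01 by (auto simp: gtb intro!: mult_pos_pos add_pos_pos)
  have \<kappa>z: "\<kappa> * z = b * e" by (simp add: \<kappa>e b_def)
  define r where "r = z + (x - t) / \<kappa>"
  have r: "z \<le> r" using x \<kappa>0 by (simp add: r_def)
  have \<kappa>r: "\<kappa> * (r - z) = x - t" using \<kappa>0 by (simp add: r_def)
  have parseval2: "(norm y)\<^sup>2 = (\<Sum>v\<in>E. (y \<bullet> v)\<^sup>2)" for y :: 'v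
    unfolding power2_norm_eq_inner by (subst parseval) (simp add: power2_eq_square)
  have "gauss_ok \<or> (\<exists>x0\<in>{0, ln 3}. stein_ok x0)" using gauss_or_stein by blast
  then show ?thesis
  proof
    assume gauss_ok
    then obtain \<eta> \<rho> where \<eta>: "1 \<le> \<eta>" and \<rho>: "1/3 \<le> \<rho>" "\<rho> = 1 - (a\<^sup>2 + \<eta>\<^sup>2 * b\<^sup>2) / (a + sqrt 2 * b)\<^sup>2"
      and eb: "e \<le> b" and slope: "exp (- 1 / 2) \<le> \<rho> * b" "exp (- 1 / 2) \<le> \<rho> * (\<eta> * b - e)"
      unfolding gauss_ok_def by blast
    define G where "G = (a + sqrt 2 * b)\<^sup>2"
    \<comment> \<open>Only the distance beyond \<open>\<eta> * z\<close>, if there is any, has to be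
      covered by the linear continuation.\<close>
    define r1 where "r1 = min r (\<eta> * z)"
    have "1 * z \<le> \<eta> * z" using \<eta> z0 by (intro mult_right_mono) auto
    then have r1: "z \<le> r1" "r1 \<le> r" "r1 \<le> \<eta> * z" using r by (auto simp: r1_def)
    have \<rho>0: "0 < \<rho>" using \<rho>(1) by linarith
    have \<mu>G: "\<mu> * G \<le> g\<^sup>2"
    proof -
      have "\<mu> * G = gt\<^sup>2" using \<mu>01 by (simp add: gtb G_def power_mult_distrib add.commute)
      also have "\<dots> \<le> g\<^sup>2" using gt(2) gt0 by (intro power_mono) auto
      finally show ?thesis .
    qed
    have "0 < a + sqrt 2 * b" using a b0 by (intro add_pos_pos) auto
    then have G0: "0 < G" unfolding G_def by (rule zero_less_power)
    have "bern_expect \<theta> (\<lambda>b. of_bool (r \<le> sqrt (\<Sum>v\<in>E. (bern_sum \<theta> \<psi> b \<bullet> v)\<^sup>2))) \<le>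
      exp (\<mu> / 2 * (\<Sum>v\<in>E. l v) + \<mu>\<^sup>2 / (4 * (1 - \<mu>)) * (\<Sum>v\<in>E. (l v)\<^sup>2)
        - \<mu> * r1\<^sup>2 / 2 - sqrt \<mu> * (r - r1) * (sqrt \<mu> * r1 - exp (- 1 / 2) / \<rho>)) / \<rho>"
    proof (rule gauss_tail[OF \<theta> E l _ \<mu>01 G0 _ _ \<rho>0])
      show "0 < r1" "r1 \<le> r" using r1 z0 by auto
      have "\<mu> * r1\<^sup>2 \<le> \<mu> * (\<eta> * z)\<^sup>2" using r1 z0 \<mu>01 by (intro mult_left_mono power_mono) auto
      also have "\<dots> = \<eta>\<^sup>2 * b\<^sup>2" by (simp add: bz2 power_mult_distrib)
      finally have "((\<Sum>v\<in>E. l v) + \<mu> * r1\<^sup>2) / G \<le> (a\<^sup>2 + \<eta>\<^sup>2 * b\<^sup>2) / G"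
        using G0 by (intro divide_right_mono) (auto simp: a2 p)
      then show "\<rho> \<le> 1 - ((\<Sum>v\<in>E. l v) + \<mu> * r1\<^sup>2) / G" using \<rho>(2) by (simp add: G_def)
      have "exp (- 1 / 2) / \<rho> \<le> b" using slope \<rho>0 by (simp add: pos_divide_le_eq mult.commute)
      also have "b \<le> sqrt \<mu> * r1" using r1 \<mu>01 by (auto simp: b_def intro!: mult_left_mono)
      finally show "exp (- 1 / 2) / \<rho> \<le> sqrt \<mu> * r1" .
      fix u assume u: "(\<Sum>v\<in>E. l v * (u v)\<^sup>2) \<le> \<mu> * G"
      define a' where "a' i = (\<Sum>v\<in>E. u v * (\<psi> i \<bullet> v))" for i
      \<comment> \<open>On the ellipsoid of level \<open>gt^2\<close> each jump changes the exponent
        by at most \<open>ln 2\<close>, hence by at most 1.\<close>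
      have a'1: "\<bar>a' i\<bar> \<le> 1" for i
      proof -
        have "(a' i)\<^sup>2 \<le> (ln 2 / g)\<^sup>2 * (\<Sum>v\<in>E. l v * (u v)\<^sup>2)" unfolding a'_def by (rule size)
        also have "\<dots> \<le> (ln 2 / g)\<^sup>2 * g\<^sup>2" using u \<mu>G by (intro mult_left_mono) auto
        also have "\<dots> = (ln 2)\<^sup>2" using gt gt0 by (simp add: power_divide)
        also have "\<dots> \<le> 1" using ln_le_minus_one[of 2] by (simp add: power_le_one)
        finally show ?thesis by (simp add: abs_square_le_1)
      qed
      have "bern_expect \<theta> (\<lambda>b. exp (\<Sum>v\<in>E. u v * (bern_sum \<theta> \<psi> b \<bullet> v)))
        = bern_expect \<theta> (\<lambda>b. exp (\<Sum>i\<in>UNIV. (of_bool (b i) - \<theta> i) * a' i))"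
      proof -
        have "(\<Sum>v\<in>E. u v * (bern_sum \<theta> \<psi> b \<bullet> v)) = (\<Sum>i\<in>UNIV. (of_bool (b i) - \<theta> i) * a' i)" for b
          unfolding inner_bern_sum a'_def sum_distrib_left
          by (subst sum.swap) (simp add: mult_ac)
        then show ?thesis by simp
      qed
      also have "\<dots> \<le> exp (\<Sum>i\<in>UNIV. \<theta> i * (1 - \<theta> i) * (a' i)\<^sup>2)" by (rule bern_expect_exp_le[OF \<theta> a'1])
      also have "\<dots> \<le> exp ((\<Sum>v\<in>E. l v * (u v)\<^sup>2) / 2)" using cov[of u] by (simp add: a'_def)
      finally show "bern_expect \<theta> (\<lambda>b. exp (\<Sum>v\<in>E. u v * (bern_sum \<theta> \<psi> b \<bullet> v))) \<le> exp ((\<Sum>v\<in>E. l v * (u v)\<^sup>2) / 2)" .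
    qed
    \<comment> \<open>This \<open>\<mu>\<close> minimises the determinant exponent minus
      \<open>\<mu> * z^2 / 2\<close>, and the minimum is exactly \<open>- t\<close>.\<close>
    also have "\<mu> / 2 * (\<Sum>v\<in>E. l v) + \<mu>\<^sup>2 / (4 * (1 - \<mu>)) * (\<Sum>v\<in>E. (l v)\<^sup>2) = \<mu> * z\<^sup>2 / 2 - t"
    proof -
      have f1: "(\<Sum>v\<in>E. (l v)\<^sup>2) = w\<^sup>2" by (simp add: w sum_nonneg)
      have f2: "\<mu>\<^sup>2 / (4 * (1 - \<mu>)) * w\<^sup>2 = \<mu> * w * s / 2"
      proof -
        have "s * (\<mu> * w) = s * (2 * s * (1 - \<mu>))" using key unfolding s(2) power2_eq_square by (simp only: mult_ac)
        then have "\<mu> * w = 2 * s * (1 - \<mu>)" using s(1) by simp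
        then have "(\<mu> * w) * (\<mu> * w) = (2 * s * (1 - \<mu>)) * (\<mu> * w)" by (rule arg_cong)
        then have "\<mu>\<^sup>2 / (4 * (1 - \<mu>)) * w\<^sup>2 = (2 * s * (1 - \<mu>)) * (\<mu> * w) / (4 * (1 - \<mu>))"
          by (simp add: power2_eq_square mult_ac)
        also have "(2 * s * (1 - \<mu>)) * (\<mu> * w) = (4 * (1 - \<mu>)) * (\<mu> * w * s / 2)" by (simp add: field_simps)
        also have "(4 * (1 - \<mu>)) * (\<mu> * w * s / 2) / (4 * (1 - \<mu>)) = \<mu> * w * s / 2" by (rule nonzero_mult_div_cancel_left) (use \<mu>01 in simp)
        finally show ?thesis .
      qed
      have f3: "\<mu> / 2 * p + \<mu> * w * s / 2 - (\<mu> * (p + 2 * w * s + 2 * t) / 2 - t) = t * (1 - \<mu>) - \<mu> * w * s / 2"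
        by (simp add: field_simps)
      show ?thesis unfolding z2 p(1)[symmetric] f1 f2 using f3 unfolding key by simp
    qed
    also have "exp (\<mu> * z\<^sup>2 / 2 - t - \<mu> * r1\<^sup>2 / 2 - sqrt \<mu> * (r - r1) * (sqrt \<mu> * r1 - exp (- 1 / 2) / \<rho>)) / \<rho>
      \<le> exp (- x) / (1/3)"
    proof (rule frac_le)
      \<comment> \<open>From \<open>z\<close> on the quadratic has slope at least
        \<open>\<mu> * z = sqrt \<mu> * b\<close>, which dominates
        \<open>\<kappa> = sqrt \<mu> * e\<close>.\<close>
      have i: "\<kappa> * (r1 - z) \<le> \<mu> * r1\<^sup>2 / 2 - \<mu> * z\<^sup>2 / 2"
      proof -
        have "\<kappa> \<le> sqrt \<mu> * b" unfolding \<kappa>e using eb \<mu>01 by (intro mult_left_mono) auto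
        also have "\<dots> = \<mu> * z" using \<mu>01 by (simp add: b_def flip: mult.assoc)
        also have "\<dots> \<le> \<mu> * ((r1 + z) / 2)" using r1 \<mu>01 by (intro mult_left_mono) auto
        finally have "(r1 - z) * \<kappa> \<le> (r1 - z) * (\<mu> * ((r1 + z) / 2))" using r1 by (intro mult_left_mono) auto
        then show ?thesis by (simp add: power2_eq_square algebra_simps)
      qed
      have ii: "\<kappa> * (r - r1) \<le> sqrt \<mu> * (r - r1) * (sqrt \<mu> * r1 - exp (- 1 / 2) / \<rho>)"
      proof (cases "r1 = r")
        case True
        then show ?thesis by simp
      next
        case False
        then have "r1 = \<eta> * z" by (auto simp: r1_def min_def split: if_splits)
        then have "sqrt \<mu> * r1 = \<eta> * b" by (simp add: b_def)
        moreover have "exp (- 1 / 2) / \<rho> \<le> \<eta> * b - e" using slope \<rho>0 by (simp add: pos_divide_le_eq mult.commute)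
        ultimately have "e \<le> sqrt \<mu> * r1 - exp (- 1 / 2) / \<rho>" by simp
        then have "sqrt \<mu> * (r - r1) * e \<le> sqrt \<mu> * (r - r1) * (sqrt \<mu> * r1 - exp (- 1 / 2) / \<rho>)"
          using r1 \<mu>01 by (intro mult_left_mono) auto
        then show ?thesis by (simp add: \<kappa>e mult_ac)
      qed
      have "\<kappa> * (r1 - z) + \<kappa> * (r - r1) = x - t" using \<kappa>r by (simp add: algebra_simps)
      with i ii show "exp (\<mu> * z\<^sup>2 / 2 - t - \<mu> * r1\<^sup>2 / 2 - sqrt \<mu> * (r - r1) * (sqrt \<mu> * r1 - exp (- 1 / 2) / \<rho>)) \<le> exp (- x)"
        unfolding exp_le_cancel_iff by linarith
    qed (use \<rho> in auto)
    finally show ?thesis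
      by (simp add: r_def \<kappa>_def parseval2[symmetric])
  next
    assume "\<exists>x0\<in>{0, ln 3}. stein_ok x0"
    then obtain x0 where x0: "x0 = 0 \<or> x0 = ln 3" and so: "stein_ok x0" by blast
    have x0x: "x0 \<le> x" "0 \<le> x0" using x0 x t by auto
    define W where "W = b * e + x0 - t"
    have W: "0 < W" and WW: "(1 + exp x0 / 3) * (\<mu> * e\<^sup>2 * (62/100 * a\<^sup>2 + 575/1000 * W)) \<le> W\<^sup>2"
      using so by (auto simp: stein_ok_def W_def)
    define r0 where "r0 = W / \<kappa>"
    \<comment> \<open>Using \<open>gt\<close> in place of \<open>g\<close> weakens the jump bound
      but makes \<open>\<kappa> * U\<close> the pure number
      \<open>ln 2 / (sqrt 8 + 1)\<close>.\<close>
    define U where "U = ln 2 / gt"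
    have U0: "0 < U" using gt0 by (simp add: U_def)
    have rr0: "\<kappa> * (r - r0) = x - x0"
    proof -
      have "\<kappa> * r0 = W" using \<kappa>0 by (simp add: r0_def)
      then have "\<kappa> * (r - r0) = \<kappa> * (r - z) + \<kappa> * z - W" by (simp add: algebra_simps)
      then show ?thesis unfolding \<kappa>r \<kappa>z W_def by simp
    qed
    have "bern_expect \<theta> (\<lambda>b. of_bool (r \<le> norm (bern_sum \<theta> \<psi> b))) \<le> exp (- (\<kappa> * (r - r0))) / (exp x0 / 3)"
    proof (rule stein_tail[OF \<theta>, where U = U and A = "p / 2"])
      show "(\<Sum>i\<in>UNIV. \<theta> i * (1 - \<theta> i) * (\<psi> i \<bullet> y)\<^sup>2) \<le> (norm y)\<^sup>2 / 2" for y
      proof -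
        have "(\<Sum>i\<in>UNIV. \<theta> i * (1 - \<theta> i) * (\<psi> i \<bullet> y)\<^sup>2) \<le> (\<Sum>v\<in>E. l v * (y \<bullet> v)\<^sup>2) / 2"
          using cov[of "\<lambda>v. y \<bullet> v"] by (simp add: parseval[of "\<psi> _" y] mult.commute)
        also have "\<dots> \<le> (\<Sum>v\<in>E. 1 * (y \<bullet> v)\<^sup>2) / 2"
          using l by (intro divide_right_mono sum_mono mult_right_mono) auto
        finally show ?thesis by (simp add: parseval2)
      qed
      show "(\<Sum>i\<in>UNIV. \<theta> i * (1 - \<theta> i) * (norm (\<psi> i))\<^sup>2) \<le> p / 2"
      proof -
        have "(\<Sum>i\<in>UNIV. \<theta> i * (1 - \<theta> i) * (norm (\<psi> i))\<^sup>2) = (\<Sum>v\<in>E. \<Sum>i\<in>UNIV. \<theta> i * (1 - \<theta> i) * (\<psi> i \<bullet> v)\<^sup>2)"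
          unfolding parseval2 sum_distrib_left by (rule sum.swap)
        also have "\<dots> \<le> (\<Sum>v\<in>E. l v / 2)"
        proof (rule sum_mono)
          fix v assume v: "v \<in> E"
          have "(\<Sum>v'\<in>E. (if v' = v then 1 else 0) * (\<psi> i \<bullet> v')) = \<psi> i \<bullet> v" for i
            using E v by (simp add: if_distrib[of "\<lambda>c. c * _"] cong: if_cong)
          moreover have "(\<Sum>v'\<in>E. l v' * (if v' = v then 1 else 0)\<^sup>2) = l v"
            using E v by (simp add: if_distrib[of "\<lambda>c. c\<^sup>2"] if_distrib[of "\<lambda>c. _ * c"] cong: if_cong)
          ultimately show "(\<Sum>i\<in>UNIV. \<theta> i * (1 - \<theta> i) * (\<psi> i \<bullet> v)\<^sup>2) \<le> l v / 2"
            using cov[of "\<lambda>v'. if v' = v then 1 else 0"] by simp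
        qed
        finally show ?thesis by (simp add: p sum_divide_distrib)
      qed
      show "0 \<le> \<kappa>" using \<kappa>0 by simp
      have "\<kappa> * U = ln 2 / (sqrt 8 + 1)" using gt0 by (simp add: \<kappa>_def U_def)
      then show "exp (\<kappa> * U) \<le> 6 / 5" using exp_kappa_U_le by simp
      show "0 < U" by (rule U0)
      show "norm (\<psi> i) \<le> U" for i
      proof -
        \<comment> \<open>\<open>size\<close> for the coordinates of \<open>\<psi> i\<close> itself;
          one factor of the squared norm then cancels.\<close>
        have "((norm (\<psi> i))\<^sup>2)\<^sup>2 = (\<Sum>v\<in>E. (\<psi> i \<bullet> v) * (\<psi> i \<bullet> v))\<^sup>2"
          by (simp add: power2_norm_eq_inner parseval[symmetric])
        also have "\<dots> \<le> (ln 2 / g)\<^sup>2 * (\<Sum>v\<in>E. l v * (\<psi> i \<bullet> v)\<^sup>2)" by (rule size)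
        also have "\<dots> \<le> (ln 2 / g)\<^sup>2 * (\<Sum>v\<in>E. 1 * (\<psi> i \<bullet> v)\<^sup>2)"
          using l by (intro mult_left_mono sum_mono mult_right_mono) auto
        also have "\<dots> = (ln 2 / g)\<^sup>2 * (norm (\<psi> i))\<^sup>2" by (simp add: parseval2)
        finally have "(norm (\<psi> i))\<^sup>2 * (norm (\<psi> i))\<^sup>2 \<le> (ln 2 / g)\<^sup>2 * (norm (\<psi> i))\<^sup>2"
          by (simp add: power2_eq_square)
        then have "(norm (\<psi> i))\<^sup>2 \<le> (ln 2 / g)\<^sup>2"
        proof (cases "\<psi> i = 0")
          case False
          assume le: "(norm (\<psi> i))\<^sup>2 * (norm (\<psi> i))\<^sup>2 \<le> (ln 2 / g)\<^sup>2 * (norm (\<psi> i))\<^sup>2"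
          show ?thesis by (rule mult_right_le_imp_le[OF le]) (use False in simp)
        qed simp
        then have "norm (\<psi> i) \<le> ln 2 / g" by (rule power2_le_imp_le) (use gt gt0 in auto)
        also have "\<dots> \<le> U" unfolding U_def using gt gt0 by (intro divide_left_mono) auto
        finally show ?thesis .
      qed
      show "0 < exp x0 / 3" by simp
      show "0 < r0" using W \<kappa>0 by (simp add: r0_def)
      have "0 \<le> \<kappa> * (r - r0)" unfolding rr0 using x0x by simp
      then show "r0 \<le> r" using \<kappa>0 by (simp add: zero_le_mult_iff)
      show "(1 + exp x0 / 3) * (31/25 * (p / 2) + r0 / (10 * U)) \<le> r0\<^sup>2"
      proof -
        have "r0 / (10 * U) = W * ((sqrt 8 + 1) / (10 * ln 2))"
          using gt0 by (simp add: r0_def U_def \<kappa>_def)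
        also have "\<dots> \<le> W * (575/1000)"
        proof (rule mult_left_mono)
          have "sqrt 8 + 1 \<le> 575/1000 * (10 * (2/3))" using sqrt2_bounds by (simp add: sqrt8_eq)
          also have "\<dots> \<le> 575/1000 * (10 * ln 2)" using ln2_ge_two_thirds by simp
          finally show "(sqrt 8 + 1) / (10 * ln 2) \<le> 575/1000" by (simp add: pos_divide_le_eq)
        qed (use W in simp)
        finally have "(1 + exp x0 / 3) * (31/25 * (p / 2) + r0 / (10 * U)) \<le> (1 + exp x0 / 3) * (62/100 * a\<^sup>2 + 575/1000 * W)"
          by (intro mult_left_mono) (auto simp: a2 intro: add_nonneg_nonneg)
        also have "\<dots> = (1 + exp x0 / 3) * (\<mu> * e\<^sup>2 * (62/100 * a\<^sup>2 + 575/1000 * W)) / \<kappa>\<^sup>2"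
          using \<mu>01 e0 by (simp add: \<kappa>e power_mult_distrib)
        also have "\<dots> \<le> W\<^sup>2 / \<kappa>\<^sup>2" using WW by (intro divide_right_mono) auto
        finally show ?thesis by (simp add: r0_def power_divide)
      qed
    qed
    also have "\<dots> = 3 * exp (- x)" unfolding rr0 by (simp add: exp_diff exp_minus field_simps)
    finally show ?thesis by (simp add: r_def \<kappa>_def)
  qed
qed

subsection \<open>Eigenbases and square roots of symmetric matrices\<close>

text \<open>The first-order condition at a maximum: the witness \<open>a / k\<close> has the sign of
  \<open>a\<close> and is small enough for the linear term to dominate.\<close>

lemma quadratic_nonpos_imp_linear_zero:
  fixes a b :: real
  assumes "\<And>t. 2 * t * a + t\<^sup>2 * b \<le> 0"
  shows "a = 0"
proof (rule ccontr)
  assume "a \<noteq> 0"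
  define k where "k = \<bar>b\<bar> + 1"
  have k: "k > 0" by (simp add: k_def)
  have "2 * (a / k) * a + (a / k)\<^sup>2 * b = (a / k)\<^sup>2 * (2 * k + b)"
    using k by (simp add: power2_eq_square field_simps)
  moreover have "\<dots> > 0" using k \<open>a \<noteq> 0\<close> by (intro mult_pos_pos) (auto simp: k_def)
  ultimately show False using assms[of "a / k"] by simp
qed

text \<open>A unit vector of \<open>W\<close> maximising the quadratic form is an eigenvector, and its orthogonal
  complement in \<open>W\<close> is invariant again.\<close>

lemma selfadjoint_eigenbasis_subspace:
  fixes f :: "'v::euclidean_space \<Rightarrow> 'v"
  assumes f: "linear f" and sa: "\<And>x y. f x \<bullet> y = x \<bullet> f y"
    and W: "subspace W" "f ` W \<subseteq> W"
  shows "\<exists>E. finite E \<and> pairwise orthogonal E \<and> (\<forall>v\<in>E. norm v = 1 \<and> (\<exists>c. f v = c *\<^sub>R v)) \<and> span E = W"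
  using W
proof (induction "dim W" arbitrary: W rule: less_induct)
  case less
  note W = less.prems
  show ?case
  proof (cases "W \<subseteq> {0}")
    case True
    then have "W = {0}" using subspace_0[OF W(1)] by auto
    then show ?thesis by (intro exI[of _ "{}"]) auto
  next
    case False
    then obtain w where w: "w \<in> W" "w \<noteq> 0" by auto
    define K where "K = sphere 0 1 \<inter> W"
    have "compact K" unfolding K_def
      by (intro compact_Int_closed closed_subspace W) auto
    moreover have "K \<noteq> {}"
    proof -
      have "w /\<^sub>R norm w \<in> K" using w W by (simp add: K_def subspace_scale)
      then show ?thesis by blast
    qed
    moreover have "continuous_on K (\<lambda>x. x \<bullet> f x)"
      by (intro continuous_intros linear_continuous_on linear_conv_bounded_linear[THEN iffD1] f)
    ultimately obtain v where v: "v \<in> K" and max: "\<And>x. x \<in> K \<Longrightarrow> x \<bullet> f x \<le> v \<bullet> f v"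
      using continuous_attains_sup[of K "\<lambda>x. x \<bullet> f x"] by blast
    have v1: "norm v = 1" "v \<in> W" using v by (auto simp: K_def)
    have vv: "v \<bullet> v = 1" using v1 by (simp add: norm_eq_1)
    define c where "c = v \<bullet> f v"
    have maxW: "x \<bullet> f x \<le> c * (x \<bullet> x)" if "x \<in> W" for x
    proof (cases "x = 0")
      case True
      then show ?thesis by simp
    next
      case False
      then have "x /\<^sub>R norm x \<in> K" using that W by (simp add: K_def subspace_scale)
      from max[OF this] have "(x \<bullet> f x) / (norm x)\<^sup>2 \<le> c"
        by (simp add: linear_scale[OF f] c_def power2_eq_square field_simps)
      then show ?thesis using False by (simp add: power2_norm_eq_inner field_simps)
    qed
    have orth: "w \<bullet> f v = 0" if "w \<in> W" "w \<bullet> v = 0" for w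
    proof (rule quadratic_nonpos_imp_linear_zero)
      fix t :: real
      have "v + t *\<^sub>R w \<in> W" using W v1 that by (intro subspace_add subspace_scale) auto
      from maxW[OF this] show "2 * t * (w \<bullet> f v) + t\<^sup>2 * (w \<bullet> f w - c * (w \<bullet> w)) \<le> 0"
        using that(2) vv sa[of v w]
        by (simp add: linear_add[OF f] linear_scale[OF f] inner_add_left inner_add_right c_def[symmetric]
            inner_commute power2_eq_square algebra_simps)
    qed
    have fv: "f v = c *\<^sub>R v"
    proof -
      define u where "u = f v - c *\<^sub>R v"
      have u: "u \<in> W" unfolding u_def using W v1 by (intro subspace_diff subspace_scale) auto
      have uv: "u \<bullet> v = 0" unfolding u_def inner_diff_left c_def using vv by (simp add: inner_commute)
      have "u \<bullet> u = u \<bullet> f v - c * (u \<bullet> v)" by (subst (2) u_def) (simp add: inner_diff_right)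
      then have "u \<bullet> u = 0" using orth[OF u uv] uv by simp
      then show ?thesis by (simp add: u_def)
    qed
    define W' where "W' = {x \<in> W. x \<bullet> v = 0}"
    have W': "subspace W'"
      using W(1) by (auto simp: W'_def subspace_def inner_add_left)
    have inv: "f ` W' \<subseteq> W'"
      using W(2) by (auto simp: W'_def sa fv)
    have "v \<notin> W'" using vv by (simp add: W'_def)
    moreover have "W' \<subseteq> W" by (auto simp: W'_def)
    ultimately have "W' \<subset> W" using v1 by blast
    then have "dim W' < dim W" using W W' by (intro dim_psubset) (simp add: span_eq_iff[THEN iffD2])
    from less.hyps[OF this W' inv] obtain E where E: "finite E" "pairwise orthogonal E"
      "\<And>v. v \<in> E \<Longrightarrow> norm v = 1 \<and> (\<exists>c. f v = c *\<^sub>R v)" "span E = W'" by blast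
    have EW': "E \<subseteq> W'" using E(4) span_superset by blast
    have "pairwise orthogonal (insert v E)"
      using E(2) EW' by (auto simp: pairwise_insert W'_def orthogonal_def inner_commute)
    moreover have "span (insert v E) = W"
    proof
      show "span (insert v E) \<subseteq> W"
        using EW' v1 W(1) by (intro span_minimal) (auto simp: W'_def)
      show "W \<subseteq> span (insert v E)"
      proof
        fix x assume x: "x \<in> W"
        have "x - (x \<bullet> v) *\<^sub>R v \<in> W'"
          using x v1 W(1) vv by (simp add: W'_def subspace_diff subspace_scale inner_diff_left)
        then show "x \<in> span (insert v E)" unfolding span_insert E(4) by blast
      qed
    qed
    ultimately show ?thesis
      using E v1 fv by (intro exI[of _ "insert v E"]) auto
  qed
qed

definition eigenbasis :: "(real^'m) set \<Rightarrow> (real^'m \<Rightarrow> real) \<Rightarrow> real^'m^'m \<Rightarrow> bool" where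
  "eigenbasis E ew A \<longleftrightarrow> finite E \<and> pairwise orthogonal E \<and> span E = UNIV \<and>
     (\<forall>v\<in>E. norm v = 1 \<and> A *v v = ew v *\<^sub>R v)"

lemma matrix_selfadjoint: "transpose A = A \<Longrightarrow> (A *v x) \<bullet> y = x \<bullet> (A *v y)"
  for A :: "real^'m^'m"
  by (metis dot_lmul_matrix transpose_matrix_vector)

lemma symmetric_eigenbasis:
  fixes A :: "real^'m^'m"
  assumes "transpose A = A"
  obtains E ew where "eigenbasis E ew A"
proof -
  have "\<exists>E. finite E \<and> pairwise orthogonal E \<and> (\<forall>v\<in>E. norm v = 1 \<and> (\<exists>c. A *v v = c *\<^sub>R v)) \<and> span E = UNIV"
    by (rule selfadjoint_eigenbasis_subspace)
       (auto simp: matrix_vector_mul_linear matrix_selfadjoint[OF assms])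
  then obtain E where E: "finite E" "pairwise orthogonal E" "span E = UNIV"
    "\<forall>v\<in>E. norm v = 1 \<and> (\<exists>c. A *v v = c *\<^sub>R v)" by blast
  have "\<forall>v\<in>E. A *v v = (SOME c. A *v v = c *\<^sub>R v) *\<^sub>R v"
    using E(4) by (metis (mono_tags, lifting) someI_ex)
  then show ?thesis using that[of E "\<lambda>v. SOME c. A *v v = c *\<^sub>R v"] E by (simp add: eigenbasis_def)
qed

context
  fixes E :: "(real^'m) set" and ew :: "real^'m \<Rightarrow> real" and A :: "real^'m^'m"
  assumes eb: "eigenbasis E ew A"
begin

lemma eigenbasis_finite: "finite E"
  using eb by (simp add: eigenbasis_def)

lemma eigenbasis_eigenvector: "v \<in> E \<Longrightarrow> A *v v = ew v *\<^sub>R v"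
  using eb by (simp add: eigenbasis_def)

lemma eigenbasis_norm: "v \<in> E \<Longrightarrow> norm v = 1"
  using eb by (simp add: eigenbasis_def)

lemma eigenbasis_inner: "v \<in> E \<Longrightarrow> w \<in> E \<Longrightarrow> v \<bullet> w = (if v = w then 1 else 0)"
  using eb by (auto simp: eigenbasis_def pairwise_def orthogonal_def norm_eq_1)

lemma eigenbasis_expand: "(\<Sum>v\<in>E. (x \<bullet> v) *\<^sub>R v) = x"
proof (rule orthonormal_basis_expand)
  show "pairwise (\<lambda>i j. orthogonal i j) E" "finite E" "\<And>i. i \<in> E \<Longrightarrow> norm i = 1"
    using eb by (auto simp: eigenbasis_def)
  show "x \<in> span E" using eb by (simp add: eigenbasis_def)
qed

lemma eigenbasis_parseval: "x \<bullet> y = (\<Sum>v\<in>E. (x \<bullet> v) * (y \<bullet> v))"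
proof -
  have "x \<bullet> y = (\<Sum>v\<in>E. (x \<bullet> v) *\<^sub>R v) \<bullet> y" by (simp only: eigenbasis_expand)
  then show ?thesis by (simp add: inner_sum_left inner_commute[of y])
qed

lemma eigenbasis_norm_square: "(norm x)\<^sup>2 = (\<Sum>v\<in>E. (x \<bullet> v)\<^sup>2)"
  unfolding power2_norm_eq_inner by (subst eigenbasis_parseval) (simp add: power2_eq_square)

lemma eigenbasis_apply: "A *v x = (\<Sum>v\<in>E. (ew v * (x \<bullet> v)) *\<^sub>R v)"
proof -
  have "A *v x = A *v (\<Sum>v\<in>E. (x \<bullet> v) *\<^sub>R v)" by (simp add: eigenbasis_expand)
  also have "\<dots> = (\<Sum>v\<in>E. (x \<bullet> v) *\<^sub>R (A *v v))"
    by (simp add: linear_sum[OF matrix_vector_mul_linear] linear_scale[OF matrix_vector_mul_linear])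
  also have "\<dots> = (\<Sum>v\<in>E. (ew v * (x \<bullet> v)) *\<^sub>R v)"
    by (rule sum.cong) (auto simp: eigenbasis_eigenvector)
  finally show ?thesis .
qed

lemma eigenbasis_quadratic: "x \<bullet> (A *v x) = (\<Sum>v\<in>E. ew v * (x \<bullet> v)\<^sup>2)"
  by (subst eigenbasis_apply) (simp add: inner_sum_right power2_eq_square mult.assoc)

lemma eigenbasis_trace: "trace A = (\<Sum>v\<in>E. ew v)"
proof -
  have "trace A = (\<Sum>i\<in>UNIV. axis i 1 \<bullet> (A *v axis i 1))"
    by (simp add: trace_def inner_axis' matrix_vector_mult_basis column_def)
  also have "\<dots> = (\<Sum>i\<in>UNIV. \<Sum>v\<in>E. ew v * (v $ i)\<^sup>2)"
    by (simp add: eigenbasis_quadratic inner_axis')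
  also have "\<dots> = (\<Sum>v\<in>E. ew v * (v \<bullet> v))"
    by (subst sum.swap) (simp add: sum_distrib_left inner_vec_def power2_eq_square)
  also have "\<dots> = (\<Sum>v\<in>E. ew v)" by (rule sum.cong) (auto simp: eigenbasis_inner)
  finally show ?thesis .
qed

lemma eigenbasis_square: "eigenbasis E (\<lambda>v. (ew v)\<^sup>2) (A ** A)"
  using eb by (auto simp: eigenbasis_def power2_eq_square linear_scale[OF matrix_vector_mul_linear]
      simp flip: matrix_vector_mul_assoc)

lemma eigenbasis_transpose: "transpose A = A"
proof -
  have "(A *v x) \<bullet> y = x \<bullet> (A *v y)" for x y
    by (simp add: eigenbasis_apply inner_sum_left inner_sum_right inner_commute mult_ac)
  then have "transpose A *v x = A *v x" for x
    by (metis (no_types) dot_lmul_matrix inner_commute transpose_matrix_vector vector_eq_rdot)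
  then show ?thesis by (simp add: matrix_eq)
qed

lemma eigenbasis_onorm:
  assumes "\<And>v. v \<in> E \<Longrightarrow> 0 \<le> ew v"
  shows "v \<in> E \<Longrightarrow> ew v \<le> op_norm A" and "A \<noteq> 0 \<Longrightarrow> \<exists>v\<in>E. ew v = op_norm A"
proof -
  have bl: "bounded_linear (\<lambda>x. A *v x)" by (simp add: linear_conv_bounded_linear[THEN iffD1] matrix_vector_mul_linear)
  show le: "ew v \<le> op_norm A" if "v \<in> E" for v
    using onorm[OF bl, of v] that assms[OF that]
    by (simp add: eigenbasis_eigenvector eigenbasis_norm op_norm_def)
  assume "A \<noteq> 0"
  have "E \<noteq> {}"
  proof
    assume "E = {}"
    then have "A *v x = 0" for x by (simp add: eigenbasis_apply)
    then have "A = 0" by (simp add: matrix_eq)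
    with \<open>A \<noteq> 0\<close> show False ..
  qed
  define L where "L = Max (ew ` E)"
  have L: "\<And>v. v \<in> E \<Longrightarrow> ew v \<le> L" and "L \<in> ew ` E"
    unfolding L_def using eigenbasis_finite \<open>E \<noteq> {}\<close> by (auto intro: Max_in)
  then obtain v where v: "v \<in> E" "L = ew v" by blast
  have "norm (A *v x) \<le> L * norm x" for x
  proof (rule power2_le_imp_le)
    have "(norm (A *v x))\<^sup>2 = (\<Sum>v\<in>E. (ew v)\<^sup>2 * (x \<bullet> v)\<^sup>2)"
      by (subst eigenbasis_norm_square)
         (auto intro!: sum.cong simp: matrix_selfadjoint[OF eigenbasis_transpose] eigenbasis_eigenvector power_mult_distrib)
    also have "\<dots> \<le> (\<Sum>v\<in>E. L\<^sup>2 * (x \<bullet> v)\<^sup>2)"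
      using L assms by (intro sum_mono mult_right_mono power_mono) auto
    also have "\<dots> = (L * norm x)\<^sup>2"
      by (simp add: power_mult_distrib eigenbasis_norm_square[of x] sum_distrib_left)
    finally show "(norm (A *v x))\<^sup>2 \<le> (L * norm x)\<^sup>2" .
    show "0 \<le> L * norm x" using v assms by simp
  qed
  then have "op_norm A \<le> L" unfolding op_norm_def by (intro onorm_le)
  with le[OF v(1)] v show "\<exists>v\<in>E. ew v = op_norm A" by force
qed

end

section \<open>Square roots and inverses of positive definite matrices\<close>

lemma eigenbasis_unique:
  assumes "eigenbasis E ew A" "eigenbasis E ew C"
  shows "A = C"
  using assms by (simp add: matrix_eq eigenbasis_apply)

lemma posdef_eigenbasis_pos:
  assumes "eigenbasis E ew A" "sym_posdef A" "v \<in> E"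
  shows "0 < ew v"
proof -
  have "v \<noteq> 0" using eigenbasis_norm[OF assms(1,3)] by auto
  then have "0 < v \<bullet> (A *v v)" using assms(2) by (simp add: sym_posdef_def)
  then show ?thesis
    using eigenbasis_norm[OF assms(1,3)] by (simp add: eigenbasis_eigenvector[OF assms(1,3)] norm_eq_1)
qed

lemma sym_posdef_sqrt_exists:
  assumes "sym_posdef A"
  shows "\<exists>V. sym_posdef V \<and> V ** V = A"
proof -
  from assms obtain E ew where eb: "eigenbasis E ew A"
    using symmetric_eigenbasis unfolding sym_posdef_def by blast
  note pos = posdef_eigenbasis_pos[OF eb assms]
  define f where "f x = (\<Sum>v\<in>E. (sqrt (ew v) * (x \<bullet> v)) *\<^sub>R v)" for x
  have "linear f" unfolding f_def
    by (intro linearI) (simp_all add: inner_add_left algebra_simps sum.distrib scaleR_sum_right)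
  define V where "V = matrix f"
  have V: "V *v x = f x" for x unfolding V_def using \<open>linear f\<close> by (simp add: matrix_works linear_matrix_vector_mul_eq)
  have ebV: "eigenbasis E (\<lambda>v. sqrt (ew v)) V"
    unfolding eigenbasis_def
  proof (intro conjI ballI)
    fix v assume v: "v \<in> E"
    have "f v = (\<Sum>w\<in>E. if w = v then sqrt (ew v) *\<^sub>R v else 0)"
      unfolding f_def by (rule sum.cong) (auto simp: eigenbasis_inner[OF eb v])
    then show "V *v v = sqrt (ew v) *\<^sub>R v" unfolding V using v eigenbasis_finite[OF eb] by simp
  qed (use eb in \<open>auto simp: eigenbasis_def\<close>)
  have "eigenbasis E (\<lambda>v. (sqrt (ew v))\<^sup>2) (V ** V)" by (rule eigenbasis_square[OF ebV])
  then have "eigenbasis E ew (V ** V)"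
    using pos by (auto simp: eigenbasis_def less_imp_le)
  then have "V ** V = A" using eb by (rule eigenbasis_unique)
  moreover have "sym_posdef V"
    unfolding sym_posdef_def
  proof (intro conjI allI impI)
    show "transpose V = V" by (rule eigenbasis_transpose[OF ebV])
    fix u :: "real^'a" assume "u \<noteq> 0"
    then have "0 < (\<Sum>v\<in>E. (u \<bullet> v)\<^sup>2)" by (simp flip: eigenbasis_norm_square[OF eb])
    then obtain v where v: "v \<in> E" "(u \<bullet> v)\<^sup>2 \<noteq> 0"
      by (metis (no_types, lifting) less_irrefl sum.neutral)
    have "0 < (\<Sum>v\<in>E. sqrt (ew v) * (u \<bullet> v)\<^sup>2)"
      using v pos by (intro sum_pos2[OF eigenbasis_finite[OF eb] v(1)]) (auto simp: less_imp_le)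
    then show "0 < u \<bullet> (V *v u)" by (simp add: eigenbasis_quadratic[OF ebV])
  qed
  ultimately show ?thesis by blast
qed

text \<open>An eigenvector \<open>v\<close> of \<open>V\<close> with eigenvalue \<open>c > 0\<close> satisfies
  \<open>W (W v - c v) = - c (W v - c v)\<close>, which forces \<open>W v = c v\<close>.\<close>

lemma sym_posdef_sqrt_unique:
  assumes V: "sym_posdef V" and W: "sym_posdef W" and eq: "V ** V = W ** W"
  shows "V = W"
proof -
  from V obtain E ew where eb: "eigenbasis E ew V"
    using symmetric_eigenbasis unfolding sym_posdef_def by blast
  have "W *v v = ew v *\<^sub>R v" if v: "v \<in> E" for v
  proof (rule ccontr)
    define c where "c = ew v"
    have c: "0 < c" unfolding c_def by (rule posdef_eigenbasis_pos[OF eb V v])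
    define u where "u = W *v v - c *\<^sub>R v"
    assume "W *v v \<noteq> ew v *\<^sub>R v"
    then have "u \<noteq> 0" by (simp add: u_def c_def)
    have "W *v (W *v v) = V *v (V *v v)" by (simp add: matrix_vector_mul_assoc eq)
    also have "\<dots> = c *\<^sub>R (c *\<^sub>R v)"
      by (simp add: eigenbasis_eigenvector[OF eb v] c_def linear_scale[OF matrix_vector_mul_linear])
    finally have "W *v u = - (c *\<^sub>R u)"
      by (simp add: u_def matrix_vector_mult_diff_distrib linear_scale[OF matrix_vector_mul_linear] scaleR_diff_right)
    then have "u \<bullet> (W *v u) = - (c * (norm u)\<^sup>2)" by (simp add: power2_norm_eq_inner)
    moreover have "0 < c * (norm u)\<^sup>2" using c \<open>u \<noteq> 0\<close> by simp
    moreover have "0 < u \<bullet> (W *v u)" using W \<open>u \<noteq> 0\<close> by (simp add: sym_posdef_def)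
    ultimately show False by simp
  qed
  then have "eigenbasis E ew W" using eb by (simp add: eigenbasis_def)
  with eb show ?thesis by (rule eigenbasis_unique)
qed

lemma posdef_sqrt:
  assumes "sym_posdef A"
  shows "sym_posdef (posdef_sqrt A)" and "posdef_sqrt A ** posdef_sqrt A = A"
proof -
  have "\<exists>!V. sym_posdef V \<and> V ** V = A"
    using sym_posdef_sqrt_exists[OF assms] sym_posdef_sqrt_unique by metis
  then have "sym_posdef (posdef_sqrt A) \<and> posdef_sqrt A ** posdef_sqrt A = A"
    unfolding posdef_sqrt_def by (rule theI')
  then show "sym_posdef (posdef_sqrt A)" "posdef_sqrt A ** posdef_sqrt A = A" by auto
qed

lemma sym_posdef_matrix_inv:
  assumes "sym_posdef A"
  shows "A ** matrix_inv A = mat 1"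
proof -
  have "\<forall>x. A *v x = 0 \<longrightarrow> x = 0" using assms unfolding sym_posdef_def by (metis inner_zero_right less_irrefl)
  then have "invertible A" by (simp add: invertible_left_inverse matrix_left_invertible_ker)
  then have "\<exists>A'. A ** A' = mat 1 \<and> A' ** A = mat 1" by (simp add: invertible_def)
  then show ?thesis unfolding matrix_inv_def by (rule someI2_ex) simp
qed

subsection \<open>Moments of Bernoulli vectors\<close>

text \<open>Integration by parts in the first factor: switching coordinate \<open>k\<close> shifts
  the second one by the constant \<open>\<psi> k \<bullet> y\<close>, so cross terms never
  appear.\<close>

lemma bern_expect_covariance:
  fixes \<psi> :: "'n::finite \<Rightarrow> 'v::real_inner"
  shows "bern_expect \<theta> (\<lambda>b. (bern_sum \<theta> \<psi> b \<bullet> x) * (bern_sum \<theta> \<psi> b \<bullet> y)) =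
    (\<Sum>k\<in>UNIV. \<theta> k * (1 - \<theta> k) * (\<psi> k \<bullet> x) * (\<psi> k \<bullet> y))"
proof -
  have "bern_expect \<theta> (\<lambda>b. (bern_sum \<theta> \<psi> b \<bullet> x) * (bern_sum \<theta> \<psi> b \<bullet> y)) =
    bern_expect \<theta> (\<lambda>b. \<Sum>k\<in>UNIV. (\<psi> k \<bullet> x) * ((of_bool (b k) - \<theta> k) * (bern_sum \<theta> \<psi> b \<bullet> y)))"
    by (subst inner_bern_sum[of _ _ _ x]) (simp add: sum_distrib_right sum_distrib_left mult_ac)
  also have "\<dots> = (\<Sum>k\<in>UNIV. (\<psi> k \<bullet> x) * (\<theta> k * (1 - \<theta> k) * (\<psi> k \<bullet> y)))"
  proof -
    have "bern_expect \<theta> (\<lambda>b. (of_bool (b k) - \<theta> k) * (bern_sum \<theta> \<psi> b \<bullet> y)) = \<theta> k * (1 - \<theta> k) * (\<psi> k \<bullet> y)" for k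
      by (subst bern_expect_centered_mult[of \<theta> k]) (simp add: bern_sum_upd inner_add_left bern_expect_const)
    then show ?thesis by (simp add: bern_expect_sum bern_expect_cmult)
  qed
  finally show ?thesis by (simp add: mult_ac)
qed

section \<open>From the probability space to finite sums\<close>

context prob_space
begin

context
  fixes Y :: "'a \<Rightarrow> real^'n" and \<theta> :: "'n \<Rightarrow> real"
  assumes \<theta>: "\<And>i. 0 \<le> \<theta> i \<and> \<theta> i \<le> 1"
    and Y: "\<And>i. distr M borel (\<lambda>\<omega>. Y \<omega> $ i) = distr (measure_pmf (bernoulli_pmf (\<theta> i))) borel of_bool"
    and indep: "indep_vars (\<lambda>_. borel) (\<lambda>i \<omega>. Y \<omega> $ i) UNIV"
begin

lemma bern_component_measurable [measurable]: "(\<lambda>\<omega>. Y \<omega> $ i) \<in> borel_measurable M"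
  using indep by (simp add: indep_vars_def)

lemma bern_vector_measurable [measurable]: "Y \<in> borel_measurable M"
  unfolding borel_measurable_euclidean_space[where f = Y]
  by (auto simp: Basis_vec_def inner_axis)

lemma bern_component_prob:
  "prob ((\<lambda>\<omega>. Y \<omega> $ i) -` {of_bool c} \<inter> space M) = (if c then \<theta> i else 1 - \<theta> i)"
proof -
  have "prob ((\<lambda>\<omega>. Y \<omega> $ i) -` {of_bool c} \<inter> space M) = measure (distr M borel (\<lambda>\<omega>. Y \<omega> $ i)) {of_bool c}"
    by (rule measure_distr[symmetric]) auto
  also have "\<dots> = measure (measure_pmf (bernoulli_pmf (\<theta> i))) (of_bool -` {of_bool c :: real})"
    unfolding Y by (subst measure_distr) auto
  also have "of_bool -` {of_bool c :: real} = {c}" by (auto split: if_splits)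
  also have "measure (measure_pmf (bernoulli_pmf (\<theta> i))) {c} = (if c then \<theta> i else 1 - \<theta> i)"
    using \<theta>[of i] by (cases c) (simp_all add: measure_pmf_single)
  finally show ?thesis .
qed

definition bern_atom :: "('n \<Rightarrow> bool) \<Rightarrow> 'a set" where
  "bern_atom b = {\<omega> \<in> space M. Y \<omega> = (\<chi> i. of_bool (b i))}"

lemma bern_atom_sets [measurable]: "bern_atom b \<in> sets M"
  unfolding bern_atom_def by measurable

lemma bern_atom_prob: "prob (bern_atom b) = bern_weight \<theta> b"
proof -
  have "bern_atom b = (\<Inter>i\<in>UNIV. (\<lambda>\<omega>. Y \<omega> $ i) -` {of_bool (b i)} \<inter> space M)"
    by (auto simp: bern_atom_def vec_eq_iff)
  also have "prob \<dots> = (\<Prod>i\<in>UNIV. prob ((\<lambda>\<omega>. Y \<omega> $ i) -` {of_bool (b i)} \<inter> space M))"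
    by (rule indep_varsD[OF indep]) auto
  finally show ?thesis by (simp add: bern_component_prob bern_weight_def)
qed

text \<open>The atoms are disjoint and their probabilities, the product weights, add up to 1, so
  they exhaust the space up to a null set.\<close>

lemma bern_atom_AE: "AE \<omega> in M. (\<Sum>b\<in>UNIV. indicator (bern_atom b) \<omega> :: real) = 1"
proof -
  have disj: "disjoint_family_on bern_atom UNIV"
    by (auto simp: disjoint_family_on_def bern_atom_def vec_eq_iff fun_eq_iff)
  have "prob (\<Union>b\<in>UNIV. bern_atom b) = (\<Sum>b\<in>UNIV. prob (bern_atom b))"
    by (rule finite_measure_finite_Union[OF _ _ disj]) auto
  also have "\<dots> = 1"
    using bern_expect_const[of \<theta> "1 :: real"] by (simp add: bern_atom_prob bern_expect_def)
  finally have "AE \<omega> in M. \<omega> \<in> (\<Union>b\<in>UNIV. bern_atom b)"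
    by (subst (asm) prob_eq_1) auto
  then show ?thesis
  proof eventually_elim
    case (elim \<omega>)
    then obtain b where b: "\<omega> \<in> bern_atom b" by blast
    have "indicator (bern_atom b') \<omega> = (if b' = b then 1 else 0 :: real)" for b'
      using b disj by (auto simp: disjoint_family_on_def indicator_def)
    then show ?case by simp
  qed
qed

lemma bern_integral:
  fixes F :: "real^'n \<Rightarrow> 'c::{banach, second_countable_topology}"
  assumes F [measurable]: "(\<lambda>\<omega>. F (Y \<omega>)) \<in> borel_measurable M"
  shows "integral\<^sup>L M (\<lambda>\<omega>. F (Y \<omega>)) = bern_expect \<theta> (\<lambda>b. F (\<chi> i. of_bool (b i)))"
proof -
  have "integral\<^sup>L M (\<lambda>\<omega>. F (Y \<omega>)) =
    integral\<^sup>L M (\<lambda>\<omega>. \<Sum>b\<in>UNIV. indicator (bern_atom b) \<omega> *\<^sub>R F (\<chi> i. of_bool (b i)))"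
  proof (rule integral_cong_AE)
    show "AE \<omega> in M. F (Y \<omega>) = (\<Sum>b\<in>UNIV. indicator (bern_atom b) \<omega> *\<^sub>R F (\<chi> i. of_bool (b i)))"
      using bern_atom_AE
    proof eventually_elim
      case (elim \<omega>)
      have "(\<Sum>b\<in>UNIV. indicator (bern_atom b) \<omega> *\<^sub>R F (\<chi> i. of_bool (b i)))
        = (\<Sum>b\<in>UNIV. indicator (bern_atom b) \<omega> *\<^sub>R F (Y \<omega>))"
        by (rule sum.cong) (auto simp: bern_atom_def indicator_def)
      also have "\<dots> = F (Y \<omega>)" using elim by (simp flip: scaleR_left.sum)
      finally show ?case by simp
    qed
    show "(\<lambda>\<omega>. \<Sum>b\<in>UNIV. indicator (bern_atom b) \<omega> *\<^sub>R F (\<chi> i. of_bool (b i))) \<in> borel_measurable M"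
      by (intro borel_measurable_sum borel_measurable_scaleR borel_measurable_indicator bern_atom_sets) auto
  qed (rule F)
  also have "\<dots> = bern_expect \<theta> (\<lambda>b. F (\<chi> i. of_bool (b i)))"
    by (subst Bochner_Integration.integral_sum)
       (auto simp: bern_expect_def bern_atom_prob less_top[symmetric])
  finally show ?thesis .
qed

lemma bern_prob:
  assumes [measurable]: "{y. P y} \<in> sets borel"
  shows "prob {\<omega> \<in> space M. P (Y \<omega>)} = bern_expect \<theta> (\<lambda>b. of_bool (P (\<chi> i. of_bool (b i))))"
proof -
  have [measurable]: "Measurable.pred borel P" using assms by (simp add: pred_def)
  have "prob {\<omega> \<in> space M. P (Y \<omega>)} = integral\<^sup>L M (indicator {\<omega> \<in> space M. P (Y \<omega>)})"
    by simp
  also have "\<dots> = integral\<^sup>L M (\<lambda>\<omega>. of_bool (P (Y \<omega>)))"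
    by (rule Bochner_Integration.integral_cong) (auto simp: indicator_def)
  also have "\<dots> = bern_expect \<theta> (\<lambda>b. of_bool (P (\<chi> i. of_bool (b i))))"
    by (rule bern_integral[where F = "\<lambda>y. of_bool (P y)"]) measurable
  finally show ?thesis .
qed

lemma bern_mean: "integral\<^sup>L M Y = (\<chi> i. \<theta> i)"
proof -
  have "integral\<^sup>L M Y = bern_expect \<theta> (\<lambda>b. (\<chi> i. of_bool (b i)))"
    using bern_integral[where F = "\<lambda>y. y"] by simp
  also have "\<dots> = (\<chi> i. \<theta> i)"
  proof -
    have "bern_expect \<theta> (\<lambda>b. (\<chi> i. of_bool (b i))) $ i = \<theta> i" for i
    proof -
      have "bern_expect \<theta> (\<lambda>b. (\<chi> i. of_bool (b i))) $ i = bern_expect \<theta> (\<lambda>b. of_bool (b i) :: real)"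
        by (simp add: bern_expect_def)
      also have "\<dots> = \<theta> i"
        by (subst bern_expect_resample[of _ _ i]) (simp add: bern_expect_const)
      finally show ?thesis .
    qed
    then show ?thesis by (simp add: vec_eq_iff)
  qed
  finally show ?thesis .
qed

end

end

subsection \<open>The critical value\<close>

context
  fixes B :: "real^'m^'m" and g :: real
  assumes L: "0 < op_norm B" and v: "0 < v_of B" and p: "0 < trace B" and g: "0 < g"
begin

definition inv_mu :: "real \<Rightarrow> real" where
  "inv_mu x = 1 + v_of B / (2 * op_norm B * sqrt x)"

lemma mu_of_eq: "mu_of B x = inverse (inv_mu x)"
  by (simp add: mu_of_def inv_mu_def)

lemma inv_mu_gt_1: "0 < x \<Longrightarrow> 1 < inv_mu x"
  using L v by (simp add: inv_mu_def)

lemma inv_mu_antimono: "0 < x \<Longrightarrow> x \<le> y \<Longrightarrow> inv_mu y \<le> inv_mu x"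
  unfolding inv_mu_def using L v
  by (intro add_left_mono divide_left_mono mult_left_mono mult_pos_pos) auto

lemma crit_term_eq:
  "0 < x \<Longrightarrow> crit_term B g x = sqrt (inv_mu x) * (g * sqrt (op_norm B) * sqrt (inv_mu x) - sqrt (trace B))"
  using inv_mu_gt_1[of x]
  by (simp add: crit_term_def mu_of_eq real_sqrt_mult right_diff_distrib divide_inverse mult_ac)

text \<open>The factored form is a product of two factors that increase with \<open>inv_mu\<close>,
  hence decrease in \<open>x\<close>; positivity of the second one passes from \<open>y\<close> to
  \<open>x\<close>.\<close>

lemma crit_term_antimono:
  assumes "0 < x" "x \<le> y" "0 < crit_term B g y"
  shows "crit_term B g y \<le> crit_term B g x"
proof -
  define c where "c = g * sqrt (op_norm B)"
  have c: "0 < c" using g L by (simp add: c_def)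
  have i: "1 < inv_mu x" "1 < inv_mu y" "inv_mu y \<le> inv_mu x"
    using assms inv_mu_gt_1 inv_mu_antimono by auto
  have "0 < c * sqrt (inv_mu y) - sqrt (trace B)"
    using assms i by (simp add: crit_term_eq c_def zero_less_mult_iff)
  moreover have "c * sqrt (inv_mu y) \<le> c * sqrt (inv_mu x)" using c i by (intro mult_left_mono) auto
  ultimately show ?thesis
    using assms i by (simp add: crit_term_eq c_def[symmetric]) (intro mult_mono, auto)
qed

lemma z_sq_pos: "0 \<le> x \<Longrightarrow> 0 < z_sq B x"
  unfolding z_sq_def using L v p by (intro add_pos_nonneg mult_nonneg_nonneg) auto

lemma z_sq_strict_mono: "0 \<le> x \<Longrightarrow> x < y \<Longrightarrow> z_sq B x < z_sq B y"
  unfolding z_sq_def using L v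
  by (intro add_le_less_mono add_left_mono mult_left_mono mult_strict_right_mono) auto

lemma x_crit_root_iff:
  assumes "0 < x"
  shows "crit_term B g x > 0 \<and> z_sq B x = 1 / 2 * (crit_term B g x)\<^sup>2 \<longleftrightarrow> crit_term B g x = sqrt 2 * z_of B x"
proof
  assume a: "crit_term B g x > 0 \<and> z_sq B x = 1 / 2 * (crit_term B g x)\<^sup>2"
  then have "2 * z_sq B x = (crit_term B g x)\<^sup>2" by simp
  then have "sqrt (2 * z_sq B x) = sqrt ((crit_term B g x)\<^sup>2)" by (rule arg_cong)
  then have "sqrt 2 * z_of B x = sqrt ((crit_term B g x)\<^sup>2)" by (simp only: z_of_def real_sqrt_mult)
  with a show "crit_term B g x = sqrt 2 * z_of B x" by simp
next
  assume a: "crit_term B g x = sqrt 2 * z_of B x"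
  have "0 < z_sq B x" using assms by (simp add: z_sq_pos)
  then show "crit_term B g x > 0 \<and> z_sq B x = 1 / 2 * (crit_term B g x)\<^sup>2"
    unfolding a by (simp add: z_of_def power_mult_distrib)
qed

lemma x_crit_root_exists: "\<exists>x>0. crit_term B g x = sqrt 2 * z_of B x"
proof -
  define c where "c = g * sqrt (op_norm B)"
  have c: "0 < c" using g L by (simp add: c_def)
  define h where "h x = crit_term B g x - sqrt 2 * z_of B x" for x
  \<comment> \<open>Once \<open>sqrt (inv_mu x)\<close> reaches \<open>K\<close>,
    \<open>crit_term\<close> is at least \<open>sqrt 2 * z_of B 1\<close>; \<open>t0\<close> is
    small enough for \<open>inv_mu t0\<close> to reach \<open>K^2\<close>.\<close>
  define K where "K = max 1 ((sqrt (trace B) + sqrt 2 * z_of B 1) / c)"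
  define t0 where "t0 = min 1 ((v_of B / (2 * op_norm B * K\<^sup>2))\<^sup>2)"
  have K: "1 \<le> K" "sqrt (trace B) + sqrt 2 * z_of B 1 \<le> c * K"
    using c by (auto simp: K_def max_def field_simps)
  have t0: "0 < t0" "t0 \<le> 1" using K v L by (auto simp: t0_def)
  have h0: "0 \<le> h t0"
  proof -
    have "sqrt t0 \<le> v_of B / (2 * op_norm B * K\<^sup>2)"
      using K v L by (intro real_le_lsqrt) (auto simp: t0_def)
    then have "K\<^sup>2 \<le> v_of B / (2 * op_norm B * sqrt t0)"
      using K v L t0 by (simp add: field_simps)
    then have "K\<^sup>2 \<le> inv_mu t0" by (simp add: inv_mu_def)
    then have Ks: "K \<le> sqrt (inv_mu t0)" by (rule real_le_rsqrt)
    have z1: "0 \<le> z_of B 1" using z_sq_pos[of 1] by (simp add: z_of_def)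
    have "c * K \<le> c * sqrt (inv_mu t0)" using Ks c by (intro mult_left_mono) auto
    then have 1: "sqrt 2 * z_of B 1 \<le> c * sqrt (inv_mu t0) - sqrt (trace B)" using K by simp
    have "1 * (sqrt 2 * z_of B 1) \<le> sqrt (inv_mu t0) * (c * sqrt (inv_mu t0) - sqrt (trace B))"
      using 1 K Ks z1 inv_mu_gt_1[OF t0(1)] by (intro mult_mono) auto
    moreover have "z_sq B t0 \<le> z_sq B 1"
      using z_sq_strict_mono[of t0 1] t0 by (cases "t0 = 1") auto
    then have "sqrt 2 * z_of B t0 \<le> sqrt 2 * z_of B 1" by (simp add: z_of_def)
    moreover have "crit_term B g t0 = sqrt (inv_mu t0) * (c * sqrt (inv_mu t0) - sqrt (trace B))"
      using t0 by (simp add: crit_term_eq c_def)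
    ultimately show ?thesis unfolding h_def by linarith
  qed
  \<comment> \<open>At \<open>t1\<close> the linear term of \<open>z_sq\<close> alone exceeds
    \<open>(c * inv_mu 1)^2\<close>, while \<open>crit_term\<close> stays below
    \<open>c * inv_mu 1\<close> beyond 1.\<close>
  define t1 where "t1 = max 1 ((c * inv_mu 1)\<^sup>2 / op_norm B)"
  have t1: "1 \<le> t1" by (simp add: t1_def)
  have h1: "h t1 \<le> 0"
  proof -
    have i: "1 < inv_mu t1" "inv_mu t1 \<le> inv_mu 1" using t1 inv_mu_gt_1 inv_mu_antimono by auto
    have "(c * inv_mu 1)\<^sup>2 / op_norm B \<le> t1" by (simp add: t1_def)
    then have "(c * inv_mu 1)\<^sup>2 \<le> t1 * op_norm B" using L by (simp add: pos_divide_le_eq)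
    also have "\<dots> \<le> 2 * z_sq B t1" unfolding z_sq_def using p v L t1 by (auto intro!: add_nonneg_nonneg)
    finally have "c * inv_mu 1 \<le> sqrt (2 * z_sq B t1)" by (rule real_le_rsqrt)
    moreover have "crit_term B g t1 \<le> c * inv_mu 1"
    proof -
      have "crit_term B g t1 = c * inv_mu t1 - sqrt (inv_mu t1) * sqrt (trace B)"
        using t1 i by (simp add: crit_term_eq c_def right_diff_distrib)
      also have "\<dots> \<le> c * inv_mu t1" using i p by simp
      also have "\<dots> \<le> c * inv_mu 1" using i c by (intro mult_left_mono) auto
      finally show ?thesis .
    qed
    ultimately show ?thesis by (simp add: h_def z_of_def real_sqrt_mult)
  qed
  have nz: "2 * op_norm B * sqrt x \<noteq> 0" "1 + v_of B / (2 * op_norm B * sqrt x) \<noteq> 0"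
    "inverse (1 + v_of B / (2 * op_norm B * sqrt x)) \<noteq> 0" if "x \<in> {t0..t1}" for x
    using that t0 L inv_mu_gt_1[of x] by (auto simp: inv_mu_def)
  have "continuous_on {t0..t1} h"
    unfolding h_def crit_term_def mu_of_def z_of_def z_sq_def
    by (intro continuous_intros ballI nz; assumption)
  then obtain x where "t0 \<le> x" "x \<le> t1" "h x = 0"
    using IVT2'[of h t1 0 t0] h0 h1 t0 t1 by auto
  then show ?thesis using t0 by (intro exI[of _ x]) (auto simp: h_def)
qed

lemma x_crit_root: "0 < x_crit B g" "crit_term B g (x_crit B g) = sqrt 2 * z_of B (x_crit B g)"
proof -
  \<comment> \<open>A positive decreasing left side meets a strictly increasing right side at most
    once.\<close>
  have uniq: "\<not> x < y"
    if "0 < x" "0 < y" "crit_term B g x = sqrt 2 * z_of B x" "crit_term B g y = sqrt 2 * z_of B y" for x y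
  proof
    assume xy: "x < y"
    have "0 < crit_term B g y" using z_sq_pos[of y] that by (simp add: z_of_def)
    then have "crit_term B g y \<le> crit_term B g x" using xy that by (intro crit_term_antimono) auto
    then show False using z_sq_strict_mono[of x y] xy that by (simp add: z_of_def)
  qed
  have "\<exists>!x. 0 < x \<and> crit_term B g x = sqrt 2 * z_of B x"
    using x_crit_root_exists uniq by (metis linorder_neqE)
  moreover have "x_crit B g = (THE x. 0 < x \<and> crit_term B g x = sqrt 2 * z_of B x)"
    unfolding x_crit_def using x_crit_root_iff by (intro arg_cong[where f = The] ext) blast
  ultimately have "0 < x_crit B g \<and> crit_term B g (x_crit B g) = sqrt 2 * z_of B (x_crit B g)"
    using theI'[of "\<lambda>x. 0 < x \<and> crit_term B g x = sqrt 2 * z_of B x"] by simp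
  then show "0 < x_crit B g" "crit_term B g (x_crit B g) = sqrt 2 * z_of B (x_crit B g)" by auto
qed

lemma crit_term_ge:
  assumes "0 < x" "x \<le> x_crit B g"
  shows "sqrt 2 * z_of B x \<le> crit_term B g x"
proof -
  define xc where "xc = x_crit B g"
  have xc: "0 < xc" "crit_term B g xc = sqrt 2 * z_of B xc" using x_crit_root by (auto simp: xc_def)
  have "0 < crit_term B g xc" using z_sq_pos[of xc] xc by (simp add: z_of_def)
  then have "crit_term B g xc \<le> crit_term B g x" using assms by (intro crit_term_antimono) (auto simp: xc_def)
  moreover have "z_sq B x \<le> z_sq B xc"
    using z_sq_strict_mono[of x xc] assms by (cases "x = xc") (auto simp: xc_def)
  then have "sqrt 2 * z_of B x \<le> sqrt 2 * z_of B xc" by (simp add: z_of_def)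
  ultimately show ?thesis using xc by linarith
qed

end

subsection \<open>The deviation bound\<close>

lemma eigenbasis_quadratic_combination:
  assumes "eigenbasis E ew A"
  defines "y \<equiv> \<lambda>u. \<Sum>v\<in>E. u v *\<^sub>R v"
  shows "y u \<bullet> (A *v y u) = (\<Sum>v\<in>E. ew v * (u v)\<^sup>2)"
proof -
  have "y u \<bullet> v = u v" if "v \<in> E" for v
    using that eigenbasis_finite[OF assms(1)]
    by (simp add: y_def inner_sum_left eigenbasis_inner[OF assms(1) _ that] if_distrib[of "\<lambda>c. _ * c"] cong: sum.cong if_cong)
  then show ?thesis by (simp add: eigenbasis_quadratic[OF assms(1)])
qed

theorem theorem3p2:
  fixes M :: "'a measure"
    and Y :: "'a \<Rightarrow> real^'n"
    and \<theta> :: "'n \<Rightarrow> real"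
    and \<Psi> :: "real^'n^'p"
    and \<xi> :: "'a \<Rightarrow> real^'p"
    and V2 :: "real^'p^'p"
    and w g x :: real
    and Q :: "real^'p^'q"
    and B :: "real^'q^'q"
  assumes "prob_space M"
    and "\<And>i. 0 \<le> \<theta> i \<and> \<theta> i \<le> 1"
    and "\<And>i. distr M borel (\<lambda>\<omega>. Y \<omega> $ i) = distr (measure_pmf (bernoulli_pmf (\<theta> i))) borel of_bool"
    and "prob_space.indep_vars M (\<lambda>_. borel) (\<lambda>i \<omega>. Y \<omega> $ i) UNIV"
    and "\<Psi> \<noteq> 0"
    and "\<xi> = (\<lambda>\<omega>. \<Psi> *v (Y \<omega> - (\<integral>\<omega>'. Y \<omega>' \<partial>M)))"
    and "sym_posdef V2"
    and "loewner_le (2 *\<^sub>R covariance_matrix M \<xi>) V2"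
    and "w = (MAX i. norm (matrix_inv (posdef_sqrt V2) *v column i \<Psi>))"
    and "g = ln 2 / w"
    and "B = Q ** V2 ** transpose Q"
    and "B \<noteq> 0"
    and "x > 0"
  shows "measure M {\<omega> \<in> space M. norm (Q *v \<xi> \<omega>) \<ge> z_crit B g x} \<le> 3 * exp (- x)"
proof -
  interpret prob_space M by fact
  note \<theta> = assms(2) and Ydist = assms(3) and indep = assms(4)
  note [measurable] = bern_component_measurable[OF \<theta> Ydist indep]
  define col where "col k = column k \<Psi>" for k
  define V where "V = posdef_sqrt V2"
  have V: "sym_posdef V" "V ** V = V2"
    unfolding V_def by (rule posdef_sqrt[OF assms(7)])+
  have Vsym: "transpose V = V" using V by (simp add: sym_posdef_def)
  have Vinv: "V *v (matrix_inv V *v c) = c" for c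
    by (simp add: matrix_vector_mul_assoc sym_posdef_matrix_inv[OF V(1)])
  have w_ge: "norm (matrix_inv V *v col k) \<le> w" for k
    unfolding assms(9) V_def col_def by (rule Max_ge) auto
  \<comment> \<open>Some column is nonzero and stays so under the inverse of \<open>V\<close>. Hence
    \<open>g\<close> is a genuine positive quotient, not the default value of a division by
    0.\<close>
  have w0: "0 < w"
  proof -
    obtain k where "col k \<noteq> 0"
    proof (rule ccontr)
      assume "\<not> thesis"
      then have "column k \<Psi> = 0" for k using that by (auto simp: col_def)
      then have "\<Psi> = 0" by (simp add: vec_eq_iff column_def)
      with assms(5) show False ..
    qed
    then have "matrix_inv V *v col k \<noteq> 0" using Vinv[of "col k"] by auto
    then have "0 < norm (matrix_inv V *v col k)" by simp
    then show ?thesis using w_ge[of k] by (rule less_le_trans)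
  qed
  have g0: "0 < g" using w0 by (simp add: assms(10))
  have wg: "ln 2 / g = w" using w0 by (simp add: assms(10))

  have \<xi>Y: "\<xi> \<omega> = \<Psi> *v (Y \<omega> - (\<chi> i. \<theta> i))" for \<omega>
    by (simp add: assms(6) bern_mean[OF \<theta> Ydist indep])
  have \<xi>b: "\<Psi> *v ((\<chi> i. of_bool (b i)) - (\<chi> i. \<theta> i)) = bern_sum \<theta> col b" for b
    by (simp add: bern_sum_def col_def matrix_vector_mult_def column_def vec_eq_iff sum_distrib_left mult_ac)
  have \<xi>_mean: "(\<integral>\<omega>. \<xi> \<omega> $ i \<partial>M) = 0" for i
  proof -
    have "(\<integral>\<omega>. \<xi> \<omega> $ i \<partial>M) = bern_expect \<theta> (\<lambda>b. bern_sum \<theta> col b $ i)"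
      unfolding \<xi>Y \<xi>b[symmetric]
      by (rule bern_integral[OF \<theta> Ydist indep, where F = "\<lambda>y. (\<Psi> *v (y - (\<chi> i. \<theta> i))) $ i"])
         (simp add: matrix_vector_mult_def, measurable)
    also have "\<dots> = bern_expect \<theta> (\<lambda>b. \<Sum>k\<in>UNIV. (col k $ i) * ((of_bool (b k) - \<theta> k) * 1))"
      by (simp add: bern_sum_def mult.commute)
    also have "\<dots> = 0"
    proof -
      have "bern_expect \<theta> (\<lambda>b. (of_bool (b k) - \<theta> k) * 1) = 0" for k
        by (subst bern_expect_centered_mult[of \<theta> k]) (simp add: bern_expect_const)
      then show ?thesis by (simp only: bern_expect_sum bern_expect_cmult) simp
    qed
    finally show ?thesis .
  qed
  have cov_entry: "covariance_matrix M \<xi> $ i $ j = (\<Sum>k\<in>UNIV. \<theta> k * (1 - \<theta> k) * (col k $ i) * (col k $ j))" for i j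
  proof -
    have "covariance_matrix M \<xi> $ i $ j = (\<integral>\<omega>. \<xi> \<omega> $ i * \<xi> \<omega> $ j \<partial>M)"
      by (simp add: covariance_matrix_def \<xi>_mean)
    also have "\<dots> = bern_expect \<theta> (\<lambda>b. bern_sum \<theta> col b $ i * bern_sum \<theta> col b $ j)"
      unfolding \<xi>Y \<xi>b[symmetric]
      by (rule bern_integral[OF \<theta> Ydist indep, where F = "\<lambda>y. (\<Psi> *v (y - (\<chi> i. \<theta> i))) $ i * (\<Psi> *v (y - (\<chi> i. \<theta> i))) $ j"])
         (simp add: matrix_vector_mult_def, measurable)
    also have "\<dots> = (\<Sum>k\<in>UNIV. \<theta> k * (1 - \<theta> k) * (col k $ i) * (col k $ j))"
      using bern_expect_covariance[of \<theta> col "axis i 1" "axis j 1"] by (simp add: inner_axis)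
    finally show ?thesis .
  qed
  have cov_quad: "u \<bullet> (covariance_matrix M \<xi> *v u) = (\<Sum>k\<in>UNIV. \<theta> k * (1 - \<theta> k) * (col k \<bullet> u)\<^sup>2)" for u
  proof -
    have "u \<bullet> (covariance_matrix M \<xi> *v u) =
      (\<Sum>i\<in>UNIV. \<Sum>j\<in>UNIV. \<Sum>k\<in>UNIV. \<theta> k * (1 - \<theta> k) * ((col k $ i * u $ i) * (col k $ j * u $ j)))"
      by (simp add: inner_vec_def matrix_vector_mult_def cov_entry sum_distrib_left sum_distrib_right mult_ac)
    also have "\<dots> = (\<Sum>i\<in>UNIV. \<Sum>k\<in>UNIV. \<Sum>j\<in>UNIV. \<theta> k * (1 - \<theta> k) * ((col k $ i * u $ i) * (col k $ j * u $ j)))"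
      by (intro sum.cong refl sum.swap)
    also have "\<dots> = (\<Sum>k\<in>UNIV. \<Sum>i\<in>UNIV. \<Sum>j\<in>UNIV. \<theta> k * (1 - \<theta> k) * ((col k $ i * u $ i) * (col k $ j * u $ j)))"
      by (rule sum.swap)
    also have "\<dots> = (\<Sum>k\<in>UNIV. \<theta> k * (1 - \<theta> k) * (col k \<bullet> u)\<^sup>2)"
    proof -
      have "(col k \<bullet> u)\<^sup>2 = (\<Sum>i\<in>UNIV. \<Sum>j\<in>UNIV. (col k $ i * u $ i) * (col k $ j * u $ j))" for k
        by (simp add: inner_vec_def power2_eq_square sum_product)
      then show ?thesis by (simp add: sum_distrib_left)
    qed
    finally show ?thesis .
  qed
  have var_le: "2 * (\<Sum>k\<in>UNIV. \<theta> k * (1 - \<theta> k) * (col k \<bullet> u)\<^sup>2) \<le> u \<bullet> (V2 *v u)" for u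
  proof -
    have "0 \<le> u \<bullet> ((V2 - 2 *\<^sub>R covariance_matrix M \<xi>) *v u)"
      using assms(8) by (simp add: loewner_le_def sym_possemidef_def)
    also have "\<dots> = u \<bullet> (V2 *v u) - 2 * (u \<bullet> (covariance_matrix M \<xi> *v u))"
      by (simp add: matrix_vector_mult_diff_rdistrib inner_diff_right scaleR_matrix_vector_assoc[symmetric])
    finally show ?thesis by (simp add: cov_quad)
  qed
  have V2_quad: "u \<bullet> (V2 *v u) = (norm (V *v u))\<^sup>2" for u
    by (simp add: V(2)[symmetric] power2_norm_eq_inner matrix_selfadjoint[OF Vsym] flip: matrix_vector_mul_assoc)
  have transp: "(transpose Q *v y) \<bullet> u = y \<bullet> (Q *v u)" for y u
    unfolding transpose_matrix_vector by (rule dot_lmul_matrix)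
  have B_quad: "y \<bullet> (B *v y) = (transpose Q *v y) \<bullet> (V2 *v (transpose Q *v y))" for y
    unfolding transp by (simp add: assms(11) flip: matrix_vector_mul_assoc)
  have "transpose V2 = V2" using assms(7) by (simp add: sym_posdef_def)
  then have "transpose B = B"
    unfolding assms(11) by (simp add: matrix_transpose_mul matrix_mul_assoc)
  then obtain E ew where eb: "eigenbasis E ew B" using symmetric_eigenbasis by blast
  have B_psd: "0 \<le> y \<bullet> (B *v y)" for y unfolding B_quad V2_quad by simp
  have ew0: "0 \<le> ew v" if "v \<in> E" for v
    using B_psd[of v] eigenbasis_norm[OF eb that] by (simp add: eigenbasis_eigenvector[OF eb that] norm_eq_1)
  define L where "L = op_norm B"
  have ewL: "ew v \<le> L" if "v \<in> E" for v unfolding L_def by (rule eigenbasis_onorm(1)[OF eb ew0 that])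
  obtain v0 where v0: "v0 \<in> E" "ew v0 = L"
    using eigenbasis_onorm(2)[OF eb ew0 assms(12)] by (auto simp: L_def)
  have L0: "0 < L"
  proof (rule ccontr)
    assume "\<not> 0 < L"
    then have "ew v = 0" if "v \<in> E" for v using ewL[OF that] ew0[OF that] by simp
    then have "B *v y = 0" for y by (simp add: eigenbasis_apply[OF eb])
    then have "B = 0" by (simp add: matrix_eq)
    with assms(12) show False ..
  qed
  have tr: "trace B = (\<Sum>v\<in>E. ew v)" by (rule eigenbasis_trace[OF eb])
  \<comment> \<open>After normalisation this is the hypothesis \<open>1 \<le> p\<close> of
    \<open>bern_sum_tail\<close>.\<close>
  have trL: "L \<le> trace B"
    unfolding tr using member_le_sum[OF v0(1), of ew] ew0 eigenbasis_finite[OF eb] v0(2) by simp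
  have vB: "v_of B = sqrt (\<Sum>v\<in>E. (ew v)\<^sup>2)"
    by (simp add: v_of_def eigenbasis_trace[OF eigenbasis_square[OF eb]])
  have vB0: "0 < v_of B"
    unfolding vB using v0 L0 eigenbasis_finite[OF eb] by (auto intro!: sum_pos2[of _ v0])
  have trB0: "0 < trace B" using trL L0 by simp
  note crit_facts = L0[unfolded L_def] vB0 trB0 g0

  define \<psi> where "\<psi> k = (1 / sqrt L) *\<^sub>R (Q *v col k)" for k
  define l where "l v = ew v / L" for v
  have Qpsi: "Q *v bern_sum \<theta> col b = sqrt L *\<^sub>R bern_sum \<theta> \<psi> b" for b
    using L0 by (simp add: bern_sum_def \<psi>_def linear_sum[OF matrix_vector_mul_linear]
        linear_scale[OF matrix_vector_mul_linear] scaleR_sum_right)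
  have psi_inner: "\<psi> k \<bullet> y = (col k \<bullet> (transpose Q *v y)) / sqrt L" for k y
    using transp[of y "col k"] by (simp add: \<psi>_def inner_commute)
  have tail: "bern_expect \<theta> (\<lambda>b. of_bool (z_of B t / sqrt L + (x - t) / (gt / (sqrt 8 + 1)) \<le> norm (bern_sum \<theta> \<psi> b))) \<le> 3 * exp (- x)"
    if t: "0 < t" "t \<le> x" and x: "ln 3 \<le> x"
      and gt: "gt = sqrt 2 * mu_of B t * (z_of B t / sqrt L) + sqrt (mu_of B t * (trace B / L))" "gt \<le> g"
    for t gt
  proof (rule bern_sum_tail[OF \<theta> eigenbasis_finite[OF eb] eigenbasis_parseval[OF eb], where l = l and g = g
        and p = "trace B / L" and w = "v_of B / L" and \<mu> = "mu_of B t"])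
    show "0 \<le> l v \<and> l v \<le> 1" if "v \<in> E" for v
      using ew0[OF that] ewL[OF that] L0 by (simp add: l_def)
    show "trace B / L = (\<Sum>v\<in>E. l v)" by (simp add: tr l_def sum_divide_distrib)
    show "1 \<le> trace B / L" using trL L0 by simp
    show "v_of B / L = sqrt (\<Sum>v\<in>E. (l v)\<^sup>2)"
      using L0 by (simp add: vB l_def power_divide real_sqrt_divide flip: sum_divide_distrib)
    show "mu_of B t = inverse (1 + v_of B / L / (2 * sqrt t))"
      by (simp add: mu_of_def L_def mult_ac)
    show "z_of B t / sqrt L = sqrt (trace B / L + 2 * (v_of B / L) * sqrt t + 2 * t)"
      using L0 by (simp add: z_of_def z_sq_def L_def[symmetric] add_divide_distrib flip: real_sqrt_divide)
    fix u :: "real^'q \<Rightarrow> real"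
    define y where "y = (\<Sum>v\<in>E. u v *\<^sub>R v)"
    have yB: "y \<bullet> (B *v y) = L * (\<Sum>v\<in>E. l v * (u v)\<^sup>2)"
      unfolding y_def eigenbasis_quadratic_combination[OF eb] using L0 by (simp add: l_def sum_distrib_left)
    have uy: "(\<Sum>v\<in>E. u v * (\<psi> i \<bullet> v)) = \<psi> i \<bullet> y" for i
      by (simp add: y_def inner_sum_right)
    show "(\<Sum>i\<in>UNIV. \<theta> i * (1 - \<theta> i) * (\<Sum>v\<in>E. u v * (\<psi> i \<bullet> v))\<^sup>2) \<le> (\<Sum>v\<in>E. l v * (u v)\<^sup>2) / 2"
    proof -
      have "(\<Sum>i\<in>UNIV. \<theta> i * (1 - \<theta> i) * (\<psi> i \<bullet> y)\<^sup>2) = (\<Sum>i\<in>UNIV. \<theta> i * (1 - \<theta> i) * (col i \<bullet> (transpose Q *v y))\<^sup>2) / L"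
        using L0 by (simp add: psi_inner power_divide sum_divide_distrib)
      also have "\<dots> \<le> (y \<bullet> (B *v y) / 2) / L"
        using var_le[of "transpose Q *v y"] L0 by (intro divide_right_mono) (auto simp: B_quad)
      also have "\<dots> = (\<Sum>v\<in>E. l v * (u v)\<^sup>2) / 2" unfolding yB using L0 by simp
      finally show ?thesis unfolding uy .
    qed
    show "(\<Sum>v\<in>E. u v * (\<psi> i \<bullet> v))\<^sup>2 \<le> (ln 2 / g)\<^sup>2 * (\<Sum>v\<in>E. l v * (u v)\<^sup>2)" for i
    proof -
      define c where "c = matrix_inv V *v col i"
      \<comment> \<open>Writing \<open>col i\<close> as \<open>V\<close> applied to \<open>c\<close>
        and moving \<open>V\<close> across separates the jump size, at most \<open>w\<close>, from a
        vector whose squared norm is the quadratic form of \<open>B\<close>.\<close>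
      have "\<bar>col i \<bullet> (transpose Q *v y)\<bar> = \<bar>c \<bullet> (V *v (transpose Q *v y))\<bar>"
        unfolding matrix_selfadjoint[OF Vsym, symmetric] c_def Vinv ..
      also have "\<dots> \<le> norm c * norm (V *v (transpose Q *v y))" by (rule Cauchy_Schwarz_ineq2)
      also have "\<dots> \<le> w * norm (V *v (transpose Q *v y))" unfolding c_def by (intro mult_right_mono w_ge) simp
      finally have "\<bar>col i \<bullet> (transpose Q *v y)\<bar>\<^sup>2 \<le> (w * norm (V *v (transpose Q *v y)))\<^sup>2"
        by (rule power_mono) simp
      then have "(col i \<bullet> (transpose Q *v y))\<^sup>2 \<le> w\<^sup>2 * (y \<bullet> (B *v y))"
        by (simp add: power_mult_distrib B_quad V2_quad)
      then have "(\<psi> i \<bullet> y)\<^sup>2 \<le> w\<^sup>2 * (y \<bullet> (B *v y)) / L"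
        using L0 by (simp add: psi_inner power_divide divide_right_mono)
      also have "\<dots> = w\<^sup>2 * (\<Sum>v\<in>E. l v * (u v)\<^sup>2)" unfolding yB using L0 by simp
      finally show ?thesis unfolding uy wg .
    qed
  qed (use that in auto)

  have transfer: "measure M {\<omega> \<in> space M. norm (Q *v \<xi> \<omega>) \<ge> r} =
    bern_expect \<theta> (\<lambda>b. of_bool (r / sqrt L \<le> norm (bern_sum \<theta> \<psi> b)))" for r
  proof -
    have "{y. r \<le> norm (Q *v (\<Psi> *v (y - (\<chi> i. \<theta> i))))} \<in> sets borel"
      by (intro borel_closed closed_Collect_le continuous_on_const continuous_on_norm continuous_on_diff
          continuous_on_id bounded_linear.continuous_on[OF matrix_vector_mul_bounded_linear])
    then have "prob {\<omega> \<in> space M. r \<le> norm (Q *v (\<Psi> *v (Y \<omega> - (\<chi> i. \<theta> i))))} =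
       bern_expect \<theta> (\<lambda>b. of_bool (r \<le> norm (Q *v (\<Psi> *v ((\<chi> i. of_bool (b i)) - (\<chi> i. \<theta> i))))))"
      by (rule bern_prob[OF \<theta> Ydist indep])
    then show ?thesis
      unfolding \<xi>Y \<xi>b Qpsi using L0 by (simp add: pos_divide_le_eq mult.commute)
  qed
  show ?thesis
  proof (cases "x < ln 3")
    case True
    have "measure M {\<omega> \<in> space M. norm (Q *v \<xi> \<omega>) \<ge> z_crit B g x} \<le> 1" by (rule prob_le_1)
    also have "1 = 3 * exp (- ln (3::real))" by (simp add: exp_minus)
    also have "\<dots> \<le> 3 * exp (- x)" using True by simp
    finally show ?thesis .
  next
    case False
    define gt where "gt t = sqrt 2 * mu_of B t * (z_of B t / sqrt L) + sqrt (mu_of B t * (trace B / L))" for t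
    \<comment> \<open>Up to a positive factor, \<open>gt t \<le> g\<close> is the inequality
      \<open>sqrt 2 * z_of B t \<le> crit_term B g t\<close>, which holds up to the critical value
      and is an equality there.\<close>
    have gt_crit: "g - gt t = mu_of B t / sqrt L * (crit_term B g t - sqrt 2 * z_of B t)" if "0 < t" for t
    proof -
      have \<mu>: "0 < mu_of B t" using vB0 L0 that by (simp add: mu_of_def L_def add_pos_pos)
      have "mu_of B t * crit_term B g t = g * sqrt L - sqrt (mu_of B t * trace B)"
      proof -
        have "mu_of B t * sqrt (trace B / mu_of B t) = (mu_of B t / sqrt (mu_of B t)) * sqrt (trace B)"
          by (simp add: real_sqrt_divide)
        also have "\<dots> = sqrt (mu_of B t * trace B)"
          using \<mu> by (simp add: real_div_sqrt real_sqrt_mult)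
        finally show ?thesis using \<mu> by (simp add: crit_term_def L_def right_diff_distrib)
      qed
      then have "mu_of B t / sqrt L * (crit_term B g t - sqrt 2 * z_of B t) =
        (g * sqrt L - sqrt (mu_of B t * trace B) - mu_of B t * (sqrt 2 * z_of B t)) / sqrt L"
        by (simp add: right_diff_distrib diff_divide_distrib)
      also have "\<dots> = g - gt t"
        using L0 by (simp add: gt_def diff_divide_distrib real_sqrt_divide mult_ac)
      finally show ?thesis by simp
    qed
    show ?thesis
    proof (cases "x \<le> x_crit B g")
      case True
      have "0 \<le> g - gt x"
        unfolding gt_crit[OF assms(13)] using crit_term_ge[OF crit_facts assms(13) True] vB0 L0 assms(13)
        by (intro mult_nonneg_nonneg divide_nonneg_nonneg) (auto simp: mu_of_def L_def)
      then have gx: "gt x \<le> g" by simp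
      \<comment> \<open>With \<open>t = x\<close> only the starting point of the line is
        used.\<close>
      have "bern_expect \<theta> (\<lambda>b. of_bool (z_of B x / sqrt L + (x - x) / (gt x / (sqrt 8 + 1)) \<le> norm (bern_sum \<theta> \<psi> b))) \<le> 3 * exp (- x)"
        by (rule tail[OF assms(13) order_refl _ gt_def gx]) (use False in simp)
      then show ?thesis unfolding transfer using True by (simp add: z_crit_def)
    next
      case x: False
      define xc where "xc = x_crit B g"
      have xc: "0 < xc" "crit_term B g xc = sqrt 2 * z_of B xc"
        unfolding xc_def by (rule x_crit_root[OF crit_facts])+
      then have gxc: "gt xc = g" using gt_crit[of xc] by simp
      have "bern_expect \<theta> (\<lambda>b. of_bool (z_of B xc / sqrt L + (x - xc) / (g / (sqrt 8 + 1)) \<le> norm (bern_sum \<theta> \<psi> b))) \<le> 3 * exp (- x)"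
        unfolding gxc[symmetric]
        by (rule tail[OF xc(1) _ _ gt_def]) (use False x gxc in \<open>simp_all add: xc_def\<close>)
      \<comment> \<open>Dividing by \<open>sqrt L\<close> cancels the root of the norm in
        \<open>kappa_of\<close>, so the slope becomes \<open>(sqrt 8 + 1) / g\<close>.\<close>
      moreover have "z_crit B g x / sqrt L = z_of B xc / sqrt L + (x - xc) / (g / (sqrt 8 + 1))"
        using x L0 by (simp add: z_crit_def xc_def kappa_of_def L_def add_divide_distrib)
      ultimately show ?thesis unfolding transfer by simp
    qed
  qed
qed

end
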